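(* Suppose $n = 2^{\alpha} k$ where $\alpha \geq 2$ and $k$ is odd. Let $K$ be an algebraic number field such that $-1$ is not a square in $K$. Then there exists a cyclic Galois extension $L$ of $K$ of degree $n$ with Galois group $\langle \sigma \rangle$ such that there is a direct decomposition $$\mathrm{Alt}_K(L) = B^1 \oplus \bigoplus_{\substack{\mathrm{ord}(\sigma^i) \equiv 2 \ (\mathrm{mod}\ 4)\\ \mathrm{ord}(\sigma^i) \neq 2}} (\mathcal{U}_i \oplus \mathcal{V}_i) \oplus \bigoplus_{\mathrm{ord}(\sigma^i) \equiv 1\ (\mathrm{mod}\ 2)} A^i \oplus \bigoplus_{\mathrm{ord}(\sigma^i) \equiv 0\ (\mathrm{mod}\ 4)} \big(\mathcal{V}^i_1 \oplus \mathcal{V}^i_2 \oplus \mathcal{E}^i_{\beta_i-1} \oplus \cdots \oplus \mathcal{E}^i_1\big),$$ where the index $i$ ranges over $1 \leq i \leq n/2 - 1$, and: - for each $i$ with $\mathrm{ord}(\sigma^i) \equiv 2 \pmod 4$ and $\mathrm{ord}(\sigma^i) \neq 2$, $\mathcal{U}_i, \mathcal{V}_i \subseteq A^i$ are respectively an $n$-subspace of dimension $n/2$ and an $(n - 2n/\mathrm{ord}(\sigma^i))$-subspace of dimension $n/2$; - for each $i$ with $\mathrm{ord}(\sigma^i) \equiv 0 \pmod 4$, writing $\mathrm{ord}(\sigma^i) = 2^{\beta_i} k'_i$ with $k'_i$ odd, $\mathcal{E}^i_s \subseteq A^i$ is an $n$-subspace of dimension $n/2^s$ for $1 \leq s \leq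 \beta_i - 1$, and $\mathcal{V}^i_1,\mathcal{V}^i_2 \subseteq A^i$ are $(n - 2n/\mathrm{ord}(\sigma^i))$-subspaces of dimension $k'_i n/\mathrm{ord}(\sigma^i)$.
   Context: For a finite Galois extension $L/K$, $\mathrm{Alt}_K(L)$ denotes the $K$-space of alternating $K$-bilinear forms (skew-forms) $L \times L \to K$, and $\mathrm{Tr}^L_K(a) = \sum_{\theta \in \mathrm{Gal}(L/K)} \theta(a)$. For $\tau \in \mathrm{Gal}(L/K)$ and $b \in L$ define the skew-form $f_{b,\tau}(x,y) = \mathrm{Tr}^L_K\big(b(x\tau(y) - \tau(x)y)\big)$ for $x,y \in L$, and the subspace $A^{\tau} = \{ f_{b,\tau} : b \in L\}$ of $\mathrm{Alt}_K(L)$. If $\mathrm{Gal}(L/K) = \langle \sigma\rangle$ is cyclic of even order $n$, write $A^i = A^{\sigma^i}$ and $B^1 = A^{\sigma^{n/2}}$. An $r$-subspace of $\mathrm{Alt}_K(L)$ is a $K$-subspace all of whose nonzero skew-forms have rank $r$. Dimensions are over $K$, and $\mathrm{ord}(\tau)$ is the order of $\tau$. *)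

theory Defs
  imports "HOL-Algebra.Bij" "HOL-Algebra.Generated_Groups" "HOL-Algebra.Algebraic_Closure_Type"
    "HOL-Library.Function_Algebras"
begin

text \<open>
  The base field \<open>K\<close> is an arbitrary type \<open>'k\<close> of class field. Up to \<open>K\<close>-isomorphism, its finite
  extensions are the intermediate fields \<open>L\<close> of \<open>K\<close> and its algebraic closure that have finite
  degree; here \<open>to_ac\<close> embeds \<open>K\<close> and \<open>of_ac\<close> inverts this embedding on its range.
\<close>

definition number_field :: "'k::field_char_0 itself \<Rightarrow> bool" where
  "number_field _ \<longleftrightarrow>
     (\<exists>B::'k set. finite B \<and> module.span (\<lambda>(q::rat) x. of_rat q * x) B = UNIV)"

lemma vector_space_rat: "vector_space (\<lambda>(q::rat) (x::'k::field_char_0). of_rat q * x)"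
  by unfold_locales (auto simp: algebra_simps of_rat_add of_rat_mult)


section \<open>Galois extensions\<close>

definition ext_scale :: "'k::field \<Rightarrow> 'k alg_closure \<Rightarrow> 'k alg_closure" where
  "ext_scale c x = to_ac c * x"

lemma vector_space_ext_scale: "vector_space ext_scale"
  by unfold_locales (auto simp: ext_scale_def algebra_simps)

definition intermediate_field :: "'k::field alg_closure set \<Rightarrow> bool" where
  "intermediate_field L \<longleftrightarrow> subfield L ring_of_type_algebra \<and> range to_ac \<subseteq> L"

definition finite_extension :: "'k::field alg_closure set \<Rightarrow> bool" where
  "finite_extension L \<longleftrightarrow>
     intermediate_field L \<and> (\<exists>B. finite B \<and> module.span ext_scale B = L)"

definition ext_degree :: "'k::field alg_closure set \<Rightarrow> nat" where
  "ext_degree L = vector_space.dim ext_scale L"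

text \<open>As in \<^const>\<open>BijGroup\<close>, automorphisms of \<open>L\<close> are functions that are undefined outside \<open>L\<close>.\<close>

definition Gal :: "'k::field alg_closure set \<Rightarrow> ('k alg_closure \<Rightarrow> 'k alg_closure) monoid" where
  "Gal L = BijGroup L \<lparr>carrier := {\<theta> \<in> Bij L.
     (\<forall>x\<in>L. \<forall>y\<in>L. \<theta> (x + y) = \<theta> x + \<theta> y \<and> \<theta> (x * y) = \<theta> x * \<theta> y) \<and>
     (\<forall>c. \<theta> (to_ac c) = to_ac c)}\<rparr>"

definition galois_extension :: "'k::field alg_closure set \<Rightarrow> bool" where
  "galois_extension L \<longleftrightarrow>
     finite_extension L \<and> {x \<in> L. \<forall>\<theta>\<in>carrier (Gal L). \<theta> x = x} = range to_ac"

lemma intermediate_field_closed: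
  assumes "intermediate_field L" "x \<in> L" "y \<in> L"
  shows "x + y \<in> L" "x * y \<in> L"
proof -
  have "subring L ring_of_type_algebra"
    using assms subfieldE(1) by (auto simp: intermediate_field_def)
  from subringE(6,7)[OF this assms(2,3)] show "x + y \<in> L" "x * y \<in> L"
    by (auto simp: ring_of_type_algebra_def)
qed

lemma group_Gal:
  assumes L: "intermediate_field L"
  shows "group (Gal L)"
proof -
  let ?H = "carrier (Gal L)"
  have K: "to_ac c \<in> L" for c using L by (auto simp: intermediate_field_def)
  interpret B: group "BijGroup L" by (rule group_BijGroup)
  have "subgroup ?H (BijGroup L)"
  proof (rule B.subgroupI)
    show "?H \<subseteq> carrier (BijGroup L)" by (auto simp: Gal_def BijGroup_def)
    have "(\<lambda>x\<in>L. x) \<in> ?H"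
      using K intermediate_field_closed[OF L] by (auto simp: Gal_def id_Bij)
    thus "?H \<noteq> {}" by blast
  next
    fix f assume f: "f \<in> ?H"
    hence fB: "f \<in> Bij L" by (auto simp: Gal_def)
    hence bij: "bij_betw f L L" by (auto simp: Bij_def)
    let ?g = "inv_into L f"
    have g: "?g x \<in> L" "f (?g x) = x" if "x \<in> L" for x
      using bij that by (auto simp: bij_betw_def f_inv_into_f inv_into_into)
    have gf: "?g (f x) = x" if "x \<in> L" for x
      using bij that by (auto simp: bij_betw_def)
    have add: "?g (x + y) = ?g x + ?g y" if "x \<in> L" "y \<in> L" for x y
    proof -
      have "f (?g x + ?g y) = x + y" using f g that by (auto simp: Gal_def)
      thus ?thesis using gf[of "?g x + ?g y"] intermediate_field_closed[OF L] g that by metis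
    qed
    have mult: "?g (x * y) = ?g x * ?g y" if "x \<in> L" "y \<in> L" for x y
    proof -
      have "f (?g x * ?g y) = x * y" using f g that by (auto simp: Gal_def)
      thus ?thesis using gf[of "?g x * ?g y"] intermediate_field_closed[OF L] g that by metis
    qed
    have fix': "?g (to_ac c) = to_ac c" for c
    proof -
      have "f (to_ac c) = to_ac c" using f by (auto simp: Gal_def)
      thus ?thesis using gf[OF K[of c]] by simp
    qed
    show "inv\<^bsub>BijGroup L\<^esub> f \<in> ?H"
      unfolding inv_BijGroup[OF fB]
      using restrict_inv_into_Bij[OF fB] add mult fix' K intermediate_field_closed[OF L]
      by (auto simp: Gal_def)
  next
    fix f g assume fg: "f \<in> ?H" "g \<in> ?H"
    hence B: "f \<in> Bij L" "g \<in> Bij L" by (auto simp: Gal_def)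
    have "g x \<in> L" if "x \<in> L" for x using B(2) that by (auto simp: Bij_def bij_betw_def)
    thus "f \<otimes>\<^bsub>BijGroup L\<^esub> g \<in> ?H"
      using fg B K intermediate_field_closed[OF L] compose_Bij[OF B]
      by (auto simp: Gal_def BijGroup_def compose_def)
  qed
  hence "group (BijGroup L \<lparr>carrier := ?H\<rparr>)"
    by (rule B.subgroup_imp_group)
  thus ?thesis by (simp add: Gal_def)
qed

text \<open>In a Galois extension the sum below lies in \<open>range to_ac\<close>.\<close>

definition trace :: "'k::field alg_closure set \<Rightarrow> 'k alg_closure \<Rightarrow> 'k" where
  "trace L a = of_ac (\<Sum>\<theta>\<in>carrier (Gal L). \<theta> a)"


section \<open>Skew-forms\<close>

definition form_scale :: "'k::field \<Rightarrow> ('a \<Rightarrow> 'a \<Rightarrow> 'k) \<Rightarrow> 'a \<Rightarrow> 'a \<Rightarrow> 'k" where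
  "form_scale c f = (\<lambda>x y. c * f x y)"

definition functional_scale :: "'k::field \<Rightarrow> ('a \<Rightarrow> 'k) \<Rightarrow> 'a \<Rightarrow> 'k" where
  "functional_scale c g = (\<lambda>y. c * g y)"

lemma vector_space_form_scale: "vector_space form_scale"
  by unfold_locales (auto simp: form_scale_def algebra_simps fun_eq_iff)

lemma vector_space_functional_scale: "vector_space functional_scale"
  by unfold_locales (auto simp: functional_scale_def algebra_simps fun_eq_iff)

text \<open>
  A form on \<open>L\<close> is extended by zero outside \<open>L\<close>, so that forms are equal iff they agree on \<open>L\<close> and
  addition and scalar multiplication are pointwise.
\<close>

definition Alt :: "'k::field alg_closure set \<Rightarrow> ('k alg_closure \<Rightarrow> 'k alg_closure \<Rightarrow> 'k) set" where
  "Alt L = {f.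
     (\<forall>x\<in>L. \<forall>y\<in>L. \<forall>z\<in>L. f (x + y) z = f x z + f y z \<and> f z (x + y) = f z x + f z y) \<and>
     (\<forall>c. \<forall>x\<in>L. \<forall>y\<in>L. f (ext_scale c x) y = c * f x y \<and> f x (ext_scale c y) = c * f x y) \<and>
     (\<forall>x\<in>L. f x x = 0) \<and>
     (\<forall>x y. x \<notin> L \<or> y \<notin> L \<longrightarrow> f x y = 0)}"

text \<open>The rank of \<open>f\<close> is the rank of the linear map \<open>x \<mapsto> f(x, _)\<close> from \<open>L\<close> to its dual.\<close>

definition form_rank ::
  "'k::field alg_closure set \<Rightarrow> ('k alg_closure \<Rightarrow> 'k alg_closure \<Rightarrow> 'k) \<Rightarrow> nat" where
  "form_rank L f = vector_space.dim functional_scale (f ` L)"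

definition form_dim :: "('k::field alg_closure \<Rightarrow> 'k alg_closure \<Rightarrow> 'k) set \<Rightarrow> nat" where
  "form_dim W = vector_space.dim form_scale W"

definition rank_subspace ::
  "'k::field alg_closure set \<Rightarrow> nat \<Rightarrow> ('k alg_closure \<Rightarrow> 'k alg_closure \<Rightarrow> 'k) set \<Rightarrow> bool" where
  "rank_subspace L r W \<longleftrightarrow>
     W \<subseteq> Alt L \<and> module.subspace form_scale W \<and> (\<forall>f\<in>W. f \<noteq> 0 \<longrightarrow> form_rank L f = r)"

definition skew_form ::
  "'k::field alg_closure set \<Rightarrow> ('k alg_closure \<Rightarrow> 'k alg_closure) \<Rightarrow> 'k alg_closure
     \<Rightarrow> 'k alg_closure \<Rightarrow> 'k alg_closure \<Rightarrow> 'k" where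
  "skew_form L \<tau> b = (\<lambda>x y. if x \<in> L \<and> y \<in> L then trace L (b * (x * \<tau> y - \<tau> x * y)) else 0)"

definition A_space ::
  "'k::field alg_closure set \<Rightarrow> ('k alg_closure \<Rightarrow> 'k alg_closure)
     \<Rightarrow> ('k alg_closure \<Rightarrow> 'k alg_closure \<Rightarrow> 'k) set" where
  "A_space L \<tau> = skew_form L \<tau> ` L"


section \<open>Direct decompositions\<close>

definition direct_decomposition ::
  "('a \<Rightarrow> 'a \<Rightarrow> 'k::field) set \<Rightarrow> 'i set \<Rightarrow> ('i \<Rightarrow> ('a \<Rightarrow> 'a \<Rightarrow> 'k) set) \<Rightarrow> bool" where
  "direct_decomposition S J W \<longleftrightarrow>
     finite J \<and> (\<forall>j\<in>J. module.subspace form_scale (W j)) \<and>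
     bij_betw (\<lambda>w. \<Sum>j\<in>J. w j) (\<Pi>\<^sub>E j\<in>J. W j) S"

text \<open>Labels of the summands of one flat direct sum; \<open>SB\<close> stands for the component of the involution.\<close>

datatype summand = SB | SU nat | SV nat | SA nat | SV1 nat | SV2 nat | SE nat nat

end

theory Submission
  imports Defs "HOL-Number_Theory.Number_Theory"
begin

text \<open>
  Write \<open>\<tau> = \<sigma>\<^sup>i\<close>, let \<open>2\<^sup>\<beta> k\<close> with \<open>k\<close> odd be its order, and put \<open>f\<^sub>i(b) = f\<^bsub>b,\<tau>\<^esub>\<close>.

  The direct sum. Let \<open>\<theta>\<close> be an element of \<open>L\<close> with \<open>n\<close> distinct conjugates. The coefficients of the
  Lagrange polynomial that is 1 at \<open>\<theta>\<close> and 0 at the other conjugates form the basis dual to the powers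
  of \<open>\<theta>\<close> under the trace form. Expanding in these two bases shows that every bilinear form is
  \<open>(x, y) \<mapsto> Tr (x * (\<Sum>i<n. a\<^sub>i * \<sigma>\<^sup>i y))\<close> for unique \<open>a\<^sub>i\<close>, and that it is alternating iff
  \<open>\<sigma>\<^sup>i a\<^bsub>n-i\<^esub> = - a\<^sub>i\<close>. Pairing \<open>i\<close> with \<open>n - i\<close> turns it into a sum of \<open>f\<^sub>i(a\<^sub>i)\<close> over \<open>1 \<le> i < n/2\<close>
  and one form of the involution (\<open>Alt_decompose\<close>, \<open>F_unique\<close>). So it remains to split each copy
  \<open>A\<^sup>i\<close> of \<open>L\<close>. Let \<open>N\<^sub>s\<close> and \<open>P\<^sub>s\<close> be the eigenspaces of \<open>\<sigma>\<^bsup>n/2^s\<^esup>\<close> for \<open>-1\<close> and \<open>1\<close>. Since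
  \<open>P\<^bsub>s-1\<^esub> = P\<^sub>s \<oplus> N\<^sub>s\<close>, one gets \<open>L = N\<^sub>1 \<oplus> \<dots> \<oplus> N\<^sub>\<beta> \<oplus> P\<^sub>\<beta>\<close> with \<open>dim N\<^sub>s = dim P\<^sub>s = n/2\<^sup>s\<close>. The
  summands are the images under \<open>f\<^sub>i\<close>: \<open>N\<^sub>s\<close> gives \<open>\<E>\<^sub>s\<close> for \<open>s < \<beta>\<close>, and \<open>P\<^sub>\<beta>\<close>, \<open>N\<^sub>\<beta>\<close> give \<open>\<V>\<^sub>1\<close>, \<open>\<V>\<^sub>2\<close>; if
  \<open>\<beta> = 1\<close>, then \<open>N\<^sub>1\<close> gives \<open>\<U>\<close> and \<open>P\<^sub>1\<close> gives \<open>\<V>\<close>.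

  The ranks. The radical of \<open>f\<^sub>i(b)\<close> consists of the \<open>x\<close> with \<open>b x = \<tau>(b) \<tau>\<^sup>2(x)\<close>. If it contains some
  \<open>x \<noteq> 0\<close>, it is \<open>x\<close> times the fixed field of \<open>\<tau>\<^sup>2\<close>, of dimension \<open>2n / ord \<tau>\<close> for \<open>\<beta> > 0\<close>,
  and the norm of \<open>b\<close> along
  \<open>\<tau>\<^sup>2\<close> is fixed by \<open>\<tau>\<close>. For \<open>b\<close> in \<open>P\<^sub>\<beta>\<close>, or in \<open>N\<^sub>\<beta>\<close> with \<open>\<beta> \<ge> 2\<close>, a product of conjugates of \<open>b\<close> gives
  such an \<open>x\<close> explicitly (\<open>degenerate_vector\<close>). For \<open>b\<close> in \<open>N\<^sub>s\<close> with \<open>0 < s < \<beta>\<close> the norm is, up to sign,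
  \<open>Q ^ 2\<^sup>s\<close> with \<open>\<tau>\<^sup>2 Q = - Q\<close>; if it were fixed by \<open>\<tau>\<close>, then \<open>z = \<tau>(Q) / Q\<close> would be a root of unity of
  2-power order with \<open>z * \<tau> z = - 1\<close>. As soon as \<open>L\<close> has no square root of \<open>-1\<close>, such a \<open>z\<close> is \<open>1\<close> or
  \<open>-1\<close>, a contradiction (\<open>N_nondegenerate\<close>). For \<open>\<beta> = 1\<close> and \<open>b\<close> in \<open>N\<^sub>1\<close> the norm has \<open>k\<close> factors and is negated by
  \<open>\<tau>\<^sup>k\<close>, so \<open>\<tau>\<close> cannot fix it (\<open>N_1_nondegenerate\<close>).

  The field. It therefore suffices to find a cyclic \<open>L\<close> of degree \<open>n\<close> without a square root of \<open>-1\<close>. Let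
  \<open>d = [K : \<rat>]\<close> and take a prime \<open>p\<close> that is \<open>1\<close> modulo \<open>4 n d!\<close> such that neither \<open>p\<close> nor \<open>-p\<close> is a square in
  \<open>K\<close>; only finitely many primes violate the latter, as square roots of distinct primes are independent
  over \<open>\<rat>\<close>. With \<open>\<zeta>\<close> of order \<open>p\<close>, the extension \<open>K(\<zeta>)\<close> is cyclic of a degree \<open>h\<close> dividing \<open>p - 1\<close>, and
  \<open>(p - 1) / h \<le> d\<close> because \<open>[\<rat>(\<zeta>) : \<rat>] = p - 1\<close>; hence \<open>n\<close> divides \<open>h\<close>, and \<open>L\<close> is the subfield of degree
  \<open>n\<close>. Moreover \<open>\<int>[\<zeta>]\<close> contains a square root of \<open>p\<close>. A generator of the Galois group negates it, and would also
  negate a square root of \<open>-1\<close>, so it would fix the product, a square root of \<open>-p\<close>; but no such element lies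
  in \<open>K\<close>.
\<close>


section \<open>Evaluating polynomials along a ring homomorphism\<close>

locale coefficient_hom =
  fixes h :: "'a::comm_ring_1 \<Rightarrow> 'b::comm_ring_1"
  assumes hom_0: "h 0 = 0" and hom_1: "h 1 = 1"
    and hom_add: "h (x + y) = h x + h y" and hom_mult: "h (x * y) = h x * h y"
begin

definition ev :: "'a poly \<Rightarrow> 'b \<Rightarrow> 'b" where
  "ev p x = poly (map_poly h p) x"

lemma hom_sum: "h (\<Sum>i\<in>A. f i) = (\<Sum>i\<in>A. h (f i))"
  by (induction A rule: infinite_finite_induct) (auto simp: hom_0 hom_add)

lemma map_poly_hom_add: "map_poly h (p + q) = map_poly h p + map_poly h q"
  by (rule poly_eqI) (simp add: coeff_map_poly hom_0 hom_add)

lemma map_poly_hom_mult: "map_poly h (p * q) = map_poly h p * map_poly h q"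
  by (rule poly_eqI) (simp add: coeff_map_poly hom_0 coeff_mult hom_sum hom_mult)

lemma ev_0 [simp]: "ev 0 x = 0"
  by (simp add: ev_def)

lemma ev_1 [simp]: "ev 1 x = 1"
  by (simp add: ev_def hom_1)

lemma ev_add [simp]: "ev (p + q) x = ev p x + ev q x"
  by (simp add: ev_def map_poly_hom_add)

lemma ev_mult [simp]: "ev (p * q) x = ev p x * ev q x"
  by (simp add: ev_def map_poly_hom_mult)

lemma ev_minus [simp]: "ev (- p) x = - ev p x"
  using ev_add[of p "- p" x] by (simp add: eq_neg_iff_add_eq_0 add.commute)

lemma ev_diff [simp]: "ev (p - q) x = ev p x - ev q x"
  using ev_add[of p "- q" x] by simp

lemma ev_sum: "ev (\<Sum>i\<in>A. f i) x = (\<Sum>i\<in>A. ev (f i) x)"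
  by (induction A rule: infinite_finite_induct) auto

lemma ev_prod: "ev (\<Prod>i\<in>A. f i) x = (\<Prod>i\<in>A. ev (f i) x)"
  by (induction A rule: infinite_finite_induct) auto

lemma ev_pCons [simp]: "ev (pCons a p) x = h a + x * ev p x"
  by (simp add: ev_def map_poly_pCons hom_0)

lemma ev_monom [simp]: "ev (Polynomial.monom a i) x = h a * x ^ i"
  by (simp add: ev_def map_poly_monom hom_0 poly_monom)

lemma ev_pcompose: "ev (pcompose p q) x = ev p (ev q x)"
  by (induction p) (auto simp: pcompose_pCons)

lemma ev_dvd: "p dvd q \<Longrightarrow> ev p x = 0 \<Longrightarrow> ev q x = 0"
  by (auto simp: dvd_def)

end

lemma coefficient_hom_of_int: "coefficient_hom (of_int :: int \<Rightarrow> 'a::comm_ring_1)"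
  by unfold_locales auto

section \<open>Primes congruent to one\<close>

text \<open>
  Divide \<open>x\<^sup>N - 1\<close> by its common divisor \<open>d\<close> with the \<open>x\<^bsup>N/q\<^esup> - 1\<close>, \<open>q\<close> a prime divisor of \<open>N\<close>. The quotient \<open>f\<close>
  vanishes at a primitive \<open>N\<close>-th root of unity, so it is not constant. If a prime \<open>p\<close> not dividing \<open>N\<close>
  divides \<open>f(a)\<close>, then \<open>a\<close> has order exactly \<open>N\<close> modulo \<open>p\<close>: otherwise \<open>p\<close> divides \<open>d(a)\<close> too, and \<open>a\<close> is a double
  root of \<open>x\<^sup>N - 1\<close> modulo \<open>p\<close>. Taking \<open>a\<close> divisible by \<open>N\<close> keeps \<open>p\<close> away from \<open>N\<close>.
\<close>

lemma prime_cong_1_exists: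
  assumes N: "N > 0"
  shows "\<exists>p::nat. prime p \<and> [p = 1] (mod N)"
proof (cases "N = 1")
  case True
  thus ?thesis by (intro exI[of _ 2]) auto
next
  case False
  with N have N2: "N \<ge> 2" by simp
  define C :: "nat \<Rightarrow> int poly" where "C m = Polynomial.monom 1 m - 1" for m
  have polyC: "poly (C m) a = a ^ m - 1" for m a by (simp add: C_def poly_monom)
  define Q where "Q = prime_factors N"
  have Q: "q dvd N" "q > 1" "N div q < N" "N div q > 0" if "q \<in> Q" for q
  proof -
    show *: "q dvd N" "q > 1" using that by (auto simp: Q_def in_prime_factors_iff dest: prime_gt_1_nat)
    show "N div q < N" "N div q > 0" using * N by (auto simp: dvd_div_eq_0_iff intro: Nat.gr0I)
  qed
  define g where "g = (\<Prod>q\<in>Q. C (N div q))"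
  define d where "d = gcd (C N) g"
  have "d dvd C N" by (simp add: d_def)
  then obtain f where f: "C N = d * f" by (auto simp: dvd_def)
  have Cdvd: "C (N div q) dvd d" if "q \<in> Q" for q
  proof -
    have "N = (N div q) * q" using Q(1)[OF that] by simp
    then obtain c where c: "N = (N div q) * c" ..
    define y :: "int poly" where "y = Polynomial.monom 1 (N div q)"
    have "Polynomial.monom 1 N = (y ^ c :: int poly)"
      unfolding y_def by (subst c) (simp add: monom_power)
    hence "C N = (y - 1) * (\<Sum>i<c. y ^ i)" by (simp add: C_def power_diff_1_eq)
    hence "C (N div q) dvd C N" by (simp add: C_def y_def)
    moreover have "C (N div q) dvd g" unfolding g_def
      using that by (intro dvd_prodI) (auto simp: Q_def)
    ultimately show ?thesis by (simp add: d_def)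
  qed
  have "Polynomial.degree f > 0"
  proof (rule ccontr)
    assume "\<not> ?thesis"
    then obtain c where c: "f = [:c:]" by (metis degree_eq_zeroE neq0_conv)
    interpret coefficient_hom "of_int :: int \<Rightarrow> complex" by (rule coefficient_hom_of_int)
    define z where "z = cis (2 * pi / N)"
    have z: "z ^ m = cis (2 * pi * (m / N))" for m by (simp add: z_def DeMoivre field_simps)
    have zN: "z ^ N = 1" using N by (simp add: z)
    have z1: "z ^ m \<noteq> 1" if "0 < m" "m < N" for m
    proof
      assume "z ^ m = 1"
      hence "cos (2 * pi * (m / N)) = 1" by (simp add: z complex_eq_iff)
      then obtain k :: int where "2 * pi * (m / N) = real_of_int k * 2 * pi"
        unfolding cos_one_2pi_int by blast
      hence "real m = k * real N" using N by (simp add: field_simps)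
      hence "int m = k * int N" by (metis of_int_eq_iff of_int_mult of_int_of_nat_eq)
      hence "int N dvd int m" by simp
      thus False using that by (auto dest: dvd_imp_le)
    qed
    have evC: "ev (C m) z = z ^ m - 1" for m by (simp add: C_def)
    have "ev d z * of_int c = 0"
      using arg_cong[OF f, of "\<lambda>p. ev p z"] zN unfolding c evC ev_mult by simp
    moreover have "c \<noteq> 0" using f polyC[of N 2] N2 by (auto simp: c)
    ultimately have "ev d z = 0" by simp
    hence "ev g z = 0" using ev_dvd[of d g z] by (simp add: d_def)
    then obtain q where "q \<in> Q" "z ^ (N div q) = 1" by (auto simp: g_def ev_prod evC Q_def)
    thus False using z1 Q by blast
  qed
  \<comment> \<open>A value of \<open>f\<close> outside \<open>{-1, 0, 1}\<close> has a prime factor.\<close>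
  define R where "R = (f - 1) * f * (f + 1)"
  have "R \<noteq> 0" using \<open>Polynomial.degree f > 0\<close> 
    by (auto simp: R_def add_eq_0_iff2)
  hence "finite {x. poly R x = 0}" by (rule poly_roots_finite)
  moreover have "infinite (range (\<lambda>t. int N * int t))"
    using N by (intro range_inj_infinite) (auto simp: inj_on_def)
  ultimately obtain t where t: "poly R (int N * int t) \<noteq> 0"
    using finite_subset[of "range (\<lambda>t. int N * int t)" "{x. poly R x = 0}"] by blast
  define a where "a = int N * int t"
  have "\<bar>poly f a\<bar> \<noteq> 1" "poly f a \<noteq> 0" using t by (auto simp: R_def a_def abs_if split: if_splits)
  then obtain p' where p': "prime p'" "p' dvd poly f a"
    using prime_divisor_exists[of "poly f a"] by auto
  define p where "p = nat p'"
  have p: "prime p" "int p dvd poly f a" using p' prime_gt_0_int[of p'] by (auto simp: p_def)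
  have faN: "a ^ N - 1 = poly d a * poly f a" using f polyC by (metis poly_mult)
  have pa: "\<not> int p dvd a"
  proof
    assume "int p dvd a"
    hence "int p dvd a ^ N" using N dvd_trans dvd_power[of N a] by blast
    moreover have "int p dvd a ^ N - 1" using p by (simp add: faN)
    ultimately have "int p dvd a ^ N - (a ^ N - 1)" by (rule dvd_diff)
    hence "int p dvd 1" by simp
    thus False using p(1) by (auto simp: prime_nat_iff)
  qed
  hence pN: "\<not> p dvd N" by (auto simp: a_def)
  have aN: "[a ^ N = 1] (mod int p)" using p faN by (simp add: cong_iff_dvd_diff)
  have naq: "\<not> [a ^ (N div q) = 1] (mod int p)" if q: "q \<in> Q" for q
  proof
    assume "[a ^ (N div q) = 1] (mod int p)"
    hence "int p dvd poly (C (N div q)) a" by (simp add: cong_iff_dvd_diff polyC)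
    hence pd: "int p dvd poly d a" using Cdvd[OF q] by (auto simp: dvd_def)
    have "pderiv (C N) = d * pderiv f + f * pderiv d" by (simp add: f pderiv_mult)
    hence "poly (pderiv (C N)) a = poly d a * poly (pderiv f) a + poly f a * poly (pderiv d) a" by simp
    hence "int p dvd poly (pderiv (C N)) a" using pd p(2) by simp
    also have "poly (pderiv (C N)) a = int N * a ^ (N - 1)"
      by (simp add: C_def pderiv_diff pderiv_monom poly_monom)
    finally have "int p dvd int N \<or> int p dvd a"
      using p'(1) prime_dvd_power[of p' a] by (auto simp: p_def prime_dvd_mult_iff prime_ge_0_int)
    thus False using pa pN by simp
  qed
  define b where "b = nat (a mod int p)"
  have p0: "p > 0" using p(1) by (simp add: prime_gt_0_nat)
  have ab: "[int b = a] (mod int p)" using p0 by (simp add: b_def cong_def)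
  have ba: "[b ^ m = 1] (mod p) \<longleftrightarrow> [a ^ m = 1] (mod int p)" for m
  proof -
    have "[b ^ m = 1] (mod p) \<longleftrightarrow> [int b ^ m = 1] (mod int p)"
      by (metis cong_int_iff of_nat_1 of_nat_power)
    also have "\<dots> \<longleftrightarrow> [a ^ m = 1] (mod int p)"
      using cong_pow[OF ab, of m] cong_trans cong_sym by blast
    finally show ?thesis .
  qed
  have ordN: "ord p b dvd N" using aN ba ord_divides by blast
  have "ord p b = N"
  proof (rule ccontr)
    assume ne: "ord p b \<noteq> N"
    obtain c where c: "N = ord p b * c" using ordN by (auto simp: dvd_def)
    with ne have "c \<noteq> 1" by auto
    then obtain q where q: "prime q" "q dvd c" using prime_factor_nat by blast
    hence "q \<in> Q" using c N by (auto simp: Q_def in_prime_factors_iff)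
    moreover have "ord p b dvd N div q" using q c by (metis N div_mult_swap dvd_triv_left)
    ultimately show False using naq ba ord_divides by blast
  qed
  moreover have "coprime p b"
  proof (rule prime_imp_coprime[OF p(1)])
    have "\<not> int p dvd int b" using pa ab by (simp add: cong_def dvd_eq_mod_eq_0)
    thus "\<not> p dvd b" by simp
  qed
  ultimately have "N dvd totient p" using order_divides_totient by blast
  hence "N dvd p - 1" using p(1) by (simp add: totient_prime)
  hence "[p = 1] (mod N)" using p0 by (subst cong_altdef_nat) auto
  thus ?thesis using p(1) by blast
qed


section \<open>Square roots of primes in a number field\<close>

text \<open>
  The exponent of \<open>p\<close> is odd on the left and even on the right.
\<close>

lemma prime_neq_square_times_primes:
  fixes q :: rat and e :: int
  assumes p: "prime p" and S: "finite S" "\<And>r. r \<in> S \<Longrightarrow> prime r" "p \<notin> S"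
    and e: "\<bar>e\<bar> = 1" and eq: "of_int e * of_nat p = q\<^sup>2 * (\<Prod>r\<in>S. of_nat r)"
  shows False
proof -
  obtain a b where ab: "quotient_of q = (a, b)" by fastforce
  have q: "q = of_int a / of_int b" "b > 0"
    using quotient_of_div[OF ab] quotient_of_denom_pos[OF ab] by auto
  have "of_int (e * int p * b\<^sup>2) = (of_int (a\<^sup>2 * int (\<Prod>S)) :: rat)"
    using eq q(2) by (simp add: q(1) power_divide field_simps)
  hence eq: "e * int p * b\<^sup>2 = a\<^sup>2 * int (\<Prod>S)" by (simp only: of_int_eq_iff)
  define A where "A = nat \<bar>a\<bar>"
  define B where "B = nat \<bar>b\<bar>"
  have "int p * b\<^sup>2 = \<bar>e * int p * b\<^sup>2\<bar>" using e by (simp add: abs_mult)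
  also have "\<dots> = a\<^sup>2 * int (\<Prod>S)" unfolding eq by (simp add: abs_mult del: of_nat_prod)
  finally have "int (p * B\<^sup>2) = int (A\<^sup>2 * \<Prod>S)" by (simp add: A_def B_def)
  hence eqn: "p * B\<^sup>2 = A\<^sup>2 * \<Prod>S" by (simp only: of_nat_eq_iff)
  have B: "B > 0" using q(2) by (simp add: B_def)
  have "p > 0" using p by (simp add: prime_gt_0_nat)
  with B have "p * B\<^sup>2 > 0" by simp
  hence "A\<^sup>2 * \<Prod>S > 0" by (simp only: eqn)
  hence A: "A > 0" "\<Prod>S > 0" by (auto simp del: prod_pos_nat_iff simp: zero_less_mult_iff)
  have "\<not> p dvd \<Prod>S"
  proof
    assume "p dvd \<Prod>S"
    then obtain r where "r \<in> S" "p dvd r" using prime_dvd_prod_iff[OF S(1) p] by auto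
    thus False using S(2,3) p primes_dvd_imp_eq by blast
  qed
  hence mS: "multiplicity p (\<Prod>S) = 0" by (rule not_dvd_imp_multiplicity_0)
  have el: "prime_elem p" "A \<noteq> 0" "B \<noteq> 0" "\<Prod>S \<noteq> 0" "p \<noteq> 0" using p A B \<open>p > 0\<close> by auto
  have "multiplicity p (A\<^sup>2 * \<Prod>S) = 2 * multiplicity p A"
    using prime_elem_multiplicity_mult_distrib[of p "A\<^sup>2" "\<Prod>S"] el(2,4)
      prime_elem_multiplicity_power_distrib[of p A 2] by (simp only: el(1) mS) simp
  moreover have "multiplicity p (p * B\<^sup>2) = 1 + 2 * multiplicity p B"
    using prime_elem_multiplicity_mult_distrib[of p p "B\<^sup>2"] p el(1,3,5)
      prime_elem_multiplicity_power_distrib[of p B 2] by simp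
  ultimately have "1 + 2 * multiplicity p B = 2 * multiplicity p A" by (simp only: eqn)
  thus False by presburger
qed

definition rational_field :: "'k::field_char_0 set \<Rightarrow> bool" where
  "rational_field F \<longleftrightarrow> \<rat> \<subseteq> F \<and>
     (\<forall>x\<in>F. \<forall>y\<in>F. x + y \<in> F \<and> x * y \<in> F) \<and> (\<forall>x\<in>F. - x \<in> F \<and> inverse x \<in> F)"

text \<open>
  The inverse of \<open>a + b t\<close> is \<open>(a - b t) / (a\<^sup>2 - b\<^sup>2 t\<^sup>2)\<close>, whose denominator vanishes only if \<open>t\<close> is in \<open>F\<close>.
\<close>

lemma adjoin_square_root:
  fixes F :: "'k::field_char_0 set"
  assumes F: "rational_field F" and t: "t\<^sup>2 \<in> F" "t \<notin> F"
  shows "rational_field {a + b * t |a b. a \<in> F \<and> b \<in> F}" (is "rational_field ?F'")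
  unfolding rational_field_def
proof (intro conjI ballI)
  have Fc: "x + y \<in> F" "x * y \<in> F" "- x \<in> F" "inverse x \<in> F" if "x \<in> F" "y \<in> F" for x y
    using F that by (auto simp: rational_field_def)
  have Fd: "x - y \<in> F" "x / y \<in> F" if "x \<in> F" "y \<in> F" for x y
    using Fc[of x "- y"] Fc[of x "inverse y"] Fc that by (simp_all add: divide_inverse)
  have F0: "0 \<in> F" using F by (auto simp: rational_field_def)
  have mem: "a + b * t \<in> ?F'" if "a \<in> F" "b \<in> F" for a b using that by blast
  show "\<rat> \<subseteq> ?F'"
  proof
    fix x :: 'k assume "x \<in> \<rat>"
    thus "x \<in> ?F'" using F F0 mem[of x 0] by (auto simp: rational_field_def)
  qed
  fix x assume "x \<in> ?F'"
  then obtain a b where x: "x = a + b * t" "a \<in> F" "b \<in> F" by blast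
  show "- x \<in> ?F'" using mem[of "- a" "- b"] Fc x by simp
  show "inverse x \<in> ?F'"
  proof (cases "x = 0")
    case True
    thus ?thesis using mem[OF F0 F0] by simp
  next
    case False
    define N where "N = a\<^sup>2 - b\<^sup>2 * t\<^sup>2"
    have NF: "N \<in> F" using Fc Fd x t by (auto simp: N_def power2_eq_square)
    have N: "N = x * (a - b * t)" by (simp add: N_def x algebra_simps power2_eq_square)
    have "N \<noteq> 0"
    proof
      assume "N = 0"
      hence ab: "a = b * t" using N False by simp
      moreover have "b \<noteq> 0" using ab x False by auto
      ultimately have "t = a / b" by simp
      thus False using Fd x t(2) by blast
    qed
    hence "inverse x = (a - b * t) / N" using False by (simp add: N field_simps)
    hence "inverse x = a / N + (- b / N) * t" by (simp add: diff_divide_distrib)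
    thus ?thesis using mem[of "a / N" "- b / N"] Fd Fc x NF by simp
  qed
  fix y assume "y \<in> ?F'"
  then obtain c d where y: "y = c + d * t" "c \<in> F" "d \<in> F" by blast
  show "x + y \<in> ?F'" using mem[of "a + c" "b + d"] Fc x y by (simp add: algebra_simps)
  show "x * y \<in> ?F'" using mem[of "a * c + b * d * t\<^sup>2" "a * d + b * c"] Fc x y t
    by (simp add: algebra_simps power2_eq_square)
qed

lemma square_root_neq_product:
  fixes s :: "nat \<Rightarrow> 'k::field_char_0" and e :: "nat \<Rightarrow> int"
  assumes S: "finite S" "p \<notin> S" and pr: "\<And>r. r \<in> insert p S \<Longrightarrow> prime r"
    and e: "\<And>r. r \<in> insert p S \<Longrightarrow> \<bar>e r\<bar> = 1"
    and s: "\<And>r. r \<in> insert p S \<Longrightarrow> (s r)\<^sup>2 = of_int (e r) * of_nat r"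
    and q: "q \<in> \<rat>"
  shows "s p \<noteq> q * (\<Prod>r\<in>S. s r)"
proof
  assume sp: "s p = q * (\<Prod>r\<in>S. s r)"
  from q obtain q' where q': "q = of_rat q'" by (auto simp: Rats_def)
  have "of_int (e p) * of_nat p = q\<^sup>2 * (\<Prod>r\<in>S. (s r)\<^sup>2)"
    using sp s[of p] by (simp add: power_mult_distrib prod_power_distrib)
  also have "(\<Prod>r\<in>S. (s r)\<^sup>2) = (\<Prod>r\<in>S. of_int (e r) * of_nat r)"
    using s by (intro prod.cong) auto
  also have "q\<^sup>2 * \<dots> = of_rat (q'\<^sup>2 * of_int (\<Prod>r\<in>S. e r) * (\<Prod>r\<in>S. of_nat r))"
    by (simp add: q' of_rat_mult of_rat_power prod.distrib of_rat_prod)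
  also have "of_int (e p) * of_nat p = (of_rat (of_int (e p) * of_nat p) :: 'k)"
    by (simp add: of_rat_mult)
  finally have eq: "of_int (e p) * of_nat p = q'\<^sup>2 * of_int (\<Prod>r\<in>S. e r) * (\<Prod>r\<in>S. of_nat r)"
    by (simp only: of_rat_eq_iff)
  have E: "\<bar>\<Prod>r\<in>S. e r\<bar> = 1" using e by (simp add: abs_prod)
  hence E2: "(\<Prod>r\<in>S. e r) * (\<Prod>r\<in>S. e r) = 1" by (metis abs_mult_self_eq mult_1)
  have "of_int ((\<Prod>r\<in>S. e r) * e p) * of_nat p
      = of_int (\<Prod>r\<in>S. e r) * (q'\<^sup>2 * of_int (\<Prod>r\<in>S. e r) * (\<Prod>r\<in>S. of_nat r))"
    by (simp only: of_int_mult mult.assoc eq)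
  also have "\<dots> = q'\<^sup>2 * of_int ((\<Prod>r\<in>S. e r) * (\<Prod>r\<in>S. e r)) * (\<Prod>r\<in>S. of_nat r)"
    by (simp only: of_int_mult mult_ac)
  finally have "of_int ((\<Prod>r\<in>S. e r) * e p) * of_nat p = q'\<^sup>2 * (\<Prod>r\<in>S. of_nat r)"
    by (simp only: E2 of_int_1 mult_1_right)
  moreover have "\<bar>(\<Prod>r\<in>S. e r) * e p\<bar> = 1" using E e[of p] by (simp only: abs_mult) simp
  ultimately show False using prime_neq_square_times_primes[of p S] S pr by blast
qed

text \<open>
  Kummer theory by hand. When \<open>t = \<surd>(\<plusminus>p)\<close> is adjoined to \<open>F\<close>, an element \<open>x = a + b t\<close> with rational square must
  have \<open>a b = 0\<close>, for otherwise \<open>t\<close> could be computed inside \<open>F\<close>. So \<open>x\<close> or \<open>x t\<close> lies in \<open>F\<close>, and induction applies.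
\<close>

lemma square_roots_of_primes_field:
  fixes s :: "nat \<Rightarrow> 'k::field_char_0" and e :: "nat \<Rightarrow> int"
  assumes "finite P" "\<And>p. p \<in> P \<Longrightarrow> prime p" "\<And>p. p \<in> P \<Longrightarrow> \<bar>e p\<bar> = 1"
    and "\<And>p. p \<in> P \<Longrightarrow> (s p)\<^sup>2 = of_int (e p) * of_nat p"
  shows "\<exists>F. rational_field F \<and> s ` P \<subseteq> F \<and>
    (\<forall>x\<in>F. x\<^sup>2 \<in> \<rat> \<longrightarrow> (\<exists>S\<subseteq>P. \<exists>q\<in>\<rat>. x = q * (\<Prod>r\<in>S. s r)))"
  using assms
proof (induction P rule: finite_induct)
  case empty
  have "rational_field (\<rat> :: 'k set)" by (auto simp: rational_field_def)
  moreover have "\<exists>S\<subseteq>{}. \<exists>q\<in>\<rat>. x = q * (\<Prod>r\<in>S. s r)" if "x \<in> \<rat>" for x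
    using that by (intro exI[of _ "{}"] conjI bexI[of _ x]) auto
  ultimately show ?case by (intro exI[of _ "\<rat>"]) auto
next
  case (insert p P)
  obtain F where F: "rational_field F" "s ` P \<subseteq> F"
    and sq: "\<And>x. x \<in> F \<Longrightarrow> x\<^sup>2 \<in> \<rat> \<Longrightarrow> \<exists>S\<subseteq>P. \<exists>q\<in>\<rat>. x = q * (\<Prod>r\<in>S. s r)"
  proof -
    have "\<exists>F. rational_field F \<and> s ` P \<subseteq> F \<and>
        (\<forall>x\<in>F. x\<^sup>2 \<in> \<rat> \<longrightarrow> (\<exists>S\<subseteq>P. \<exists>q\<in>\<rat>. x = q * (\<Prod>r\<in>S. s r)))"
      by (rule insert.IH) (auto intro: insert.prems)
    then obtain F where "rational_field F" "s ` P \<subseteq> F"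
      and *: "\<forall>x\<in>F. x\<^sup>2 \<in> \<rat> \<longrightarrow> (\<exists>S\<subseteq>P. \<exists>q\<in>\<rat>. x = q * (\<Prod>r\<in>S. s r))"
      by (elim exE conjE)
    from this(1,2) *[rule_format] show thesis by (rule that)
  qed
  have Fc: "x + y \<in> F" "x * y \<in> F" "- x \<in> F" "inverse x \<in> F" if "x \<in> F" "y \<in> F" for x y
    using F that by (auto simp: rational_field_def)
  have Fd: "x - y \<in> F" "x / y \<in> F" if "x \<in> F" "y \<in> F" for x y
    using Fc[of x "- y"] Fc[of x "inverse y"] Fc that by (simp_all add: divide_inverse)
  have FQ: "\<rat> \<subseteq> F" using F by (auto simp: rational_field_def)
  define t where "t = s p"
  have t2: "t\<^sup>2 = of_int (e p) * of_nat p" using insert.prems by (simp add: t_def)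
  hence t2Q: "t\<^sup>2 \<in> \<rat>" by simp
  have t0: "t \<noteq> 0"
    using t2 insert.prems(1)[of p] insert.prems(2)[of p] by (auto simp: prime_gt_0_nat)
  have tF: "t \<notin> F"
  proof
    assume "t \<in> F"
    then obtain S q where S: "S \<subseteq> P" "q \<in> \<rat>" and tq: "s p = q * (\<Prod>r\<in>S. s r)"
      using sq t2Q unfolding t_def by blast
    have "finite S" using S(1) insert.hyps finite_subset by blast
    moreover have "insert p S \<subseteq> insert p P" "p \<notin> S" using S(1) insert.hyps by auto
    ultimately show False
      using square_root_neq_product[of S p e s q] insert.prems S(2) tq by blast
  qed
  define F' where "F' = {a + b * t |a b. a \<in> F \<and> b \<in> F}"
  have "rational_field F'"
    unfolding F'_def using adjoin_square_root[OF F(1) _ tF] t2Q FQ by blast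
  moreover have "s ` insert p P \<subseteq> F'"
  proof -
    have "s r \<in> F'" if "r \<in> P" for r
    proof -
      have "s r \<in> F" "0 \<in> F" using F(2) FQ that by auto
      hence "s r + 0 * t \<in> F'" unfolding F'_def by blast
      thus ?thesis by simp
    qed
    moreover have "0 + 1 * t \<in> F'" unfolding F'_def using FQ Rats_0 Rats_1 by blast
    ultimately show ?thesis by (auto simp: t_def)
  qed
  moreover have "\<forall>x\<in>F'. x\<^sup>2 \<in> \<rat> \<longrightarrow> (\<exists>S\<subseteq>insert p P. \<exists>q\<in>\<rat>. x = q * (\<Prod>r\<in>S. s r))"
  proof (intro ballI impI)
    fix x assume xF: "x \<in> F'" "x\<^sup>2 \<in> \<rat>"
    obtain a b where x: "x = a + b * t" "a \<in> F" "b \<in> F" using xF(1) by (auto simp: F'_def)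
    have "a * b = 0"
    proof (rule ccontr)
      assume ab: "a * b \<noteq> 0"
      have "x\<^sup>2 - a\<^sup>2 - b\<^sup>2 * t\<^sup>2 = 2 * a * b * t" by (simp add: x algebra_simps power2_eq_square)
      hence "t = (x\<^sup>2 - a * a - b * b * t\<^sup>2) / (2 * a * b)" using ab by (simp add: power2_eq_square)
      moreover have "2 \<in> F" "x\<^sup>2 \<in> F" "t\<^sup>2 \<in> F" using FQ xF t2Q by auto
      hence "(x\<^sup>2 - a * a - b * b * t\<^sup>2) / (2 * a * b) \<in> F" using x(2,3) by (intro Fc Fd)
      ultimately have "t \<in> F" by (rule ssubst)
      thus False using tF by simp
    qed
    then consider "b = 0" | "a = 0" by auto
    thus "\<exists>S\<subseteq>insert p P. \<exists>q\<in>\<rat>. x = q * (\<Prod>r\<in>S. s r)"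
    proof cases
      case 1
      hence "x \<in> F" using x by simp
      thus ?thesis using sq[of x] xF by auto
    next
      case 2
      have "x * t = b * t\<^sup>2" using x 2 by (simp add: power2_eq_square)
      hence "x * t \<in> F" using Fc x t2Q FQ by auto
      moreover have "(x * t)\<^sup>2 \<in> \<rat>" using xF t2Q by (simp add: power_mult_distrib)
      ultimately obtain S q where S: "S \<subseteq> P" "q \<in> \<rat>" "x * t = q * (\<Prod>r\<in>S. s r)" using sq by blast
      have "finite S" "p \<notin> S" using S insert.hyps finite_subset by auto
      hence "(\<Prod>r\<in>insert p S. s r) = t * (\<Prod>r\<in>S. s r)" by (simp add: t_def)
      hence "x * t\<^sup>2 = q * (\<Prod>r\<in>insert p S. s r)" using S(3) by (simp add: power2_eq_square algebra_simps)
      hence "x = (q / t\<^sup>2) * (\<Prod>r\<in>insert p S. s r)" using t0 by (simp add: field_simps)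
      moreover have "q / t\<^sup>2 \<in> \<rat>" using S(2) t2Q by simp
      moreover have "insert p S \<subseteq> insert p P" using S by auto
      ultimately show ?thesis by blast
    qed
  qed
  ultimately show ?case by (intro exI[of _ F'] conjI)
qed

text \<open>
  Square roots of distinct primes (up to sign) are linearly independent over the rationals: the field
  generated by the others contains only such square roots as are rational multiples of their products.
  Hence there are at most \<open>[K : \<rat>]\<close> of them in \<open>K\<close>.
\<close>

lemma finite_primes_with_square_root:
  assumes K: "number_field TYPE('k::field_char_0)"
  shows "finite {p::nat. prime p \<and> (\<exists>s::'k. s\<^sup>2 = of_nat p \<or> s\<^sup>2 = - of_nat p)}" (is "finite ?P")
proof (rule ccontr)
  interpret Q: vector_space "\<lambda>(q::rat) (x::'k). of_rat q * x" by (rule vector_space_rat)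
  obtain B :: "'k set" where B: "finite B" "Q.span B = UNIV" using K by (auto simp: number_field_def)
  assume "infinite ?P"
  then obtain P where P: "finite P" "card P = Suc (card B)" "P \<subseteq> ?P"
    using infinite_arbitrarily_large by blast
  have "\<exists>w::int \<times> 'k. \<bar>fst w\<bar> = 1 \<and> (snd w)\<^sup>2 = of_int (fst w) * of_nat p" if "p \<in> P" for p
  proof -
    from that P obtain s :: 'k where "s\<^sup>2 = of_nat p \<or> s\<^sup>2 = - of_nat p" by blast
    thus ?thesis
    proof
      assume "s\<^sup>2 = of_nat p"
      thus ?thesis by (intro exI[of _ "(1, s)"]) simp
    next
      assume "s\<^sup>2 = - of_nat p"
      thus ?thesis by (intro exI[of _ "(- 1, s)"]) simp
    qed
  qed
  hence "\<forall>p\<in>P. \<exists>w::int \<times> 'k. \<bar>fst w\<bar> = 1 \<and> (snd w)\<^sup>2 = of_int (fst w) * of_nat p" by (intro ballI)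
  from bchoice[OF this] obtain w :: "nat \<Rightarrow> int \<times> 'k"
    where w: "\<forall>p\<in>P. \<bar>fst (w p)\<bar> = 1 \<and> (snd (w p))\<^sup>2 = of_int (fst (w p)) * of_nat p"
    by (elim exE)
  define s e where "s p = snd (w p)" and "e p = fst (w p)" for p
  have se: "\<bar>e p\<bar> = 1" "(s p)\<^sup>2 = of_int (e p) * (of_nat p :: 'k)" if "p \<in> P" for p
    using w that by (auto simp: s_def e_def)
  have pr: "prime p" if "p \<in> P" for p using that P by auto
  have indep: "s p \<notin> Q.span (s ` (P - {p}))" if p: "p \<in> P" for p
  proof
    assume sp: "s p \<in> Q.span (s ` (P - {p}))"
    have "\<exists>F. rational_field F \<and> s ` (P - {p}) \<subseteq> F \<and>
        (\<forall>x\<in>F. x\<^sup>2 \<in> \<rat> \<longrightarrow> (\<exists>S\<subseteq>P - {p}. \<exists>q\<in>\<rat>. x = q * (\<Prod>r\<in>S. s r)))"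
      by (rule square_roots_of_primes_field[of _ e]) (use P(1) pr se in auto)
    then obtain F where F: "rational_field F" "s ` (P - {p}) \<subseteq> F"
      and sq: "\<forall>x\<in>F. x\<^sup>2 \<in> \<rat> \<longrightarrow> (\<exists>S\<subseteq>P - {p}. \<exists>q\<in>\<rat>. x = q * (\<Prod>r\<in>S. s r))"
      by (elim exE conjE)
    have "Q.subspace F" using F(1)
      by (intro Q.subspaceI) (auto simp: rational_field_def subset_iff)
    hence "s p \<in> F" using sp F(2) Q.span_minimal by blast
    moreover have "(s p)\<^sup>2 \<in> \<rat>" by (simp only: se(2)[OF p]) simp
    ultimately obtain S q where S: "S \<subseteq> P - {p}" "q \<in> \<rat>" "s p = q * (\<Prod>r\<in>S. s r)"
      using sq by blast
    have "finite S" "p \<notin> S" "insert p S \<subseteq> P" using S(1) P(1) p finite_subset by auto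
    thus False using square_root_neq_product[of S p e s q] S(2,3) se pr by blast
  qed
  have "inj_on s P"
  proof (rule inj_onI, rule ccontr)
    fix p r assume "p \<in> P" "r \<in> P" "s p = s r" "p \<noteq> r"
    hence "s p \<in> s ` (P - {p})" by auto
    hence "s p \<in> Q.span (s ` (P - {p}))" by (rule Q.span_base)
    thus False using indep[OF \<open>p \<in> P\<close>] by simp
  qed
  moreover from this have "s ` (P - {p}) = s ` P - {s p}" if "p \<in> P" for p
    using that by (auto simp: inj_on_def)
  hence "Q.independent (s ` P)" using indep by (auto simp: Q.dependent_def)
  hence "card (s ` P) \<le> card B" using Q.independent_span_bound[OF B(1)] B(2) by auto
  ultimately show False using P(2) by (simp add: card_image)
qed


section \<open>Roots of unity of prime order\<close>

lemma poly_eq_0_of_many_roots: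
  fixes p :: "'a::idom poly"
  assumes "inj_on f A" "finite A" "\<And>a. a \<in> A \<Longrightarrow> poly p (f a) = 0" "Polynomial.degree p < card A"
  shows "p = 0"
proof (rule ccontr)
  assume "p \<noteq> 0"
  hence "finite {x. poly p x = 0}" "card {x. poly p x = 0} \<le> Polynomial.degree p"
    by (auto intro: poly_roots_finite card_poly_roots_bound)
  moreover have "f ` A \<subseteq> {x. poly p x = 0}" using assms(3) by auto
  ultimately have "card (f ` A) \<le> Polynomial.degree p" using card_mono le_trans by blast
  thus False using assms(1,4) by (simp add: card_image)
qed

locale prime_root_of_unity =
  fixes p :: nat and z :: "'a::field_char_0"
  assumes prime_p: "prime p" and z_pow: "z ^ p = 1" and z_neq_1: "z \<noteq> 1"
begin

sublocale int: coefficient_hom "of_int :: int \<Rightarrow> 'a"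
  by (rule coefficient_hom_of_int)

lemma p_gt_1: "p > 1" using prime_p by (rule prime_gt_1_nat)

lemma z_nonzero: "z \<noteq> 0"
  using z_pow p_gt_1 by (auto simp: power_0_left)

lemma z_pow_mod: "z ^ (m mod p) = z ^ m"
proof -
  have "z ^ m = z ^ (p * (m div p) + m mod p)" by simp
  also have "\<dots> = z ^ (m mod p)" by (simp only: power_add power_mult z_pow power_one mult_1)
  finally show ?thesis ..
qed

lemma z_pow_cong: "[i = j] (mod p) \<Longrightarrow> z ^ i = z ^ j"
  using z_pow_mod[of i] z_pow_mod[of j] by (simp add: cong_def)

lemma z_pow_eq_1: "z ^ m = 1 \<longleftrightarrow> p dvd m"
proof
  assume z1: "z ^ m = 1"
  show "p dvd m"
  proof (rule ccontr)
    assume "\<not> p dvd m"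
    hence "coprime m p" using prime_imp_coprime[OF prime_p] by (simp add: coprime_commute)
    then obtain x where "[m * x = 1] (mod p)" using cong_solve_coprime_nat by auto
    hence "z ^ (m * x) = z ^ 1" by (rule z_pow_cong)
    thus False using z1 z_neq_1 by (simp add: power_mult)
  qed
qed (auto simp: dvd_def power_mult z_pow)

lemma z_pow_eq_iff: "z ^ i = z ^ j \<longleftrightarrow> [i = j] (mod p)"
proof
  have *: "[i = j] (mod p)" if "z ^ i = z ^ j" "i \<le> j" for i j
  proof -
    have "z ^ j = z ^ i * z ^ (j - i)" using that(2) by (simp flip: power_add)
    hence "z ^ (j - i) = 1" using that(1) z_nonzero by simp
    hence "[j = i] (mod p)" using that(2) by (simp add: z_pow_eq_1 cong_altdef_nat)
    thus ?thesis by (rule cong_sym)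
  qed
  assume "z ^ i = z ^ j"
  thus "[i = j] (mod p)" using *[of i j] *[of j i] by (metis cong_sym nat_le_linear)
qed (rule z_pow_cong)

lemma z_pow_inj: "inj_on (\<lambda>j. z ^ j) {..<p}"
  by (rule inj_onI) (simp add: z_pow_eq_iff cong_def)

lemma sum_powers_eq_0: "\<not> p dvd j \<Longrightarrow> (\<Sum>i<p. (z ^ j) ^ i) = 0"
proof -
  assume "\<not> p dvd j"
  hence "z ^ j \<noteq> 1" by (simp add: z_pow_eq_1)
  moreover have "(z ^ j) ^ p = 1" by (metis mult.commute power_mult power_one z_pow)
  ultimately show ?thesis using power_diff_1_eq[of "z ^ j" p] by simp
qed

lemma prod_linear_factors: "(\<Prod>j\<in>{1..<p}. x - z ^ j) = (\<Sum>i<p. x ^ i)"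
proof -
  define P where "P = (\<Prod>j\<in>{1..<p}. [:- (z ^ j), 1:])"
  define S where "S = (\<Sum>i<p. Polynomial.monom (1::'a) i)"
  have nd: "\<not> p dvd j" if "j \<in> {1..<p}" for j using that by (auto dest: dvd_imp_le)
  have degP: "Polynomial.degree P = p - 1" by (simp add: P_def degree_prod_eq_sum_degree)
  have coP: "Polynomial.coeff P (p - 1) = 1"
    using lead_coeff_prod[of "\<lambda>j. [:- (z ^ j), 1:]" "{1..<p}"] degP by (simp add: P_def)
  have coS: "Polynomial.coeff S n = (if n < p then 1 else 0)" for n
    by (simp add: S_def coeff_sum sum.delta)
  have "Polynomial.degree (S - P) < card {1..<p}"
  proof (rule le_neq_implies_less)
    show "Polynomial.degree (S - P) \<le> card {1..<p}"
      by (rule degree_le) (use degP coS in \<open>auto simp: coeff_eq_0\<close>)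
    have "Polynomial.coeff (S - P) (p - 1) = 0" using coS coP p_gt_1 by simp
    thus "Polynomial.degree (S - P) \<noteq> card {1..<p}"
      using p_gt_1 by (metis One_nat_def card_atLeastLessThan degree_0 leading_coeff_0_iff less_numeral_extra(3) zero_less_diff)
  qed
  moreover have "poly (S - P) (z ^ j) = 0" if "j \<in> {1..<p}" for j
    using sum_powers_eq_0[OF nd[OF that]] that
    by (auto simp: S_def P_def poly_sum poly_monom poly_prod)
  moreover have "inj_on (\<lambda>j. z ^ j) {1..<p}" by (rule inj_on_subset[OF z_pow_inj]) auto
  ultimately have "S - P = 0" using poly_eq_0_of_many_roots[of "\<lambda>j. z ^ j" "{1..<p}" "S - P"] by simp
  hence "poly S x = poly P x" by simp
  thus ?thesis by (simp add: S_def P_def poly_sum poly_monom poly_prod)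
qed

lemma prod_one_minus_powers: "(\<Prod>j\<in>{1..<p}. 1 - z ^ j) = of_nat p"
  using prod_linear_factors[of 1] by simp

text \<open>
  In \<open>p = (1 - z) (1 - z\<^sup>2) \<dots> (1 - z\<^bsup>p-1\<^esup>)\<close> the factors for \<open>j\<close> and \<open>p - j\<close> differ by \<open>- z\<^bsup>p-j\<^esup>\<close>, and every power
  of \<open>z\<close> is a square since \<open>p\<close> is odd. The signs cancel because \<open>(p - 1) / 2\<close> is even.
\<close>

lemma sqrt_p_exists:
  assumes "[p = 1] (mod 4)"
  shows "\<exists>f. (int.ev f z)\<^sup>2 = of_nat p"
proof -
  from assms have p4: "p mod 4 = 1" by (simp add: cong_def)
  define h where "h = (p - 1) div 2"
  have h: "p = 2 * h + 1" "even h" using p4 unfolding h_def by presburger+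
  define m where "m = (\<Sum>j\<in>{1..h}. p - j)"
  define s where "s = z ^ (m * (h + 1)) * (\<Prod>j\<in>{1..h}. 1 - z ^ j)"
  have "of_nat p = (\<Prod>j\<in>{1..h} \<union> {h+1..<p}. 1 - z ^ j)"
    using h by (subst prod_one_minus_powers[symmetric], intro prod.cong) auto
  also have "\<dots> = (\<Prod>j\<in>{1..h}. 1 - z ^ j) * (\<Prod>j\<in>{h+1..<p}. 1 - z ^ j)"
    by (rule prod.union_disjoint) auto
  also have "(\<Prod>j\<in>{h+1..<p}. 1 - z ^ j) = (\<Prod>j\<in>{1..h}. 1 - z ^ (p - j))"
    by (rule prod.reindex_bij_witness[of _ "\<lambda>j. p - j" "\<lambda>j. p - j"]) (use h in auto)
  also have "\<dots> = (\<Prod>j\<in>{1..h}. (- 1) * (z ^ (p - j) * (1 - z ^ j)))"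
  proof (rule prod.cong)
    fix j assume "j \<in> {1..h}"
    hence "z ^ (p - j) * z ^ j = 1" using h z_pow by (simp flip: power_add)
    thus "1 - z ^ (p - j) = (- 1) * (z ^ (p - j) * (1 - z ^ j))" by (simp add: algebra_simps)
  qed simp
  also have "\<dots> = z ^ m * (\<Prod>j\<in>{1..h}. 1 - z ^ j)"
    unfolding prod.distrib using h(2) by (simp add: m_def power_sum)
  also have "z ^ m = z ^ (m * (h + 1) * 2)"
  proof (rule z_pow_cong)
    have "[1 = p + 1] (mod p)" unfolding cong_def by (subst mod_add_self1) simp
    hence "[m * 1 = m * (p + 1)] (mod p)" by (intro cong_mult cong_refl)
    thus "[m = m * (h + 1) * 2] (mod p)" using h by (simp add: algebra_simps)
  qed
  also have "\<dots> = (z ^ (m * (h + 1)))\<^sup>2" by (rule power_mult)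
  finally have "s\<^sup>2 = of_nat p" by (simp only: s_def power2_eq_square mult_ac)
  moreover have "int.ev (Polynomial.monom 1 (m * (h + 1)) * (\<Prod>j\<in>{1..h}. 1 - Polynomial.monom 1 j)) z = s"
    by (simp add: s_def int.ev_prod)
  ultimately show ?thesis by blast
qed

text \<open>
  The product of the \<open>w(x\<^sup>j)\<close> over \<open>0 < j < p\<close> vanishes at all primitive \<open>p\<close>-th roots of unity, so the
  cyclotomic polynomial divides it over the integers. At 1 this says that \<open>p\<close> divides \<open>w(1)\<^bsup>p-1\<^esup>\<close>.
\<close>

lemma p_dvd_value_at_1:
  assumes w: "int.ev w z = 0"
  shows "int p dvd poly w 1"
proof -
  define S where "S = (\<Sum>i<p. Polynomial.monom (1::int) i)"
  define F where "F = (\<Prod>j\<in>{1..<p}. pcompose w (Polynomial.monom 1 j))"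
  have coS: "Polynomial.coeff S n = (if n < p then 1 else 0)" for n
    by (simp add: S_def coeff_sum sum.delta)
  have degS: "Polynomial.degree S = p - 1"
  proof (rule antisym)
    show "Polynomial.degree S \<le> p - 1" by (rule degree_le) (auto simp: coS)
    show "p - 1 \<le> Polynomial.degree S" by (rule le_degree) (use p_gt_1 in \<open>simp add: coS\<close>)
  qed
  hence "S \<noteq> 0" using coS[of 0] p_gt_1 by auto
  obtain Q R where QR: "pseudo_divmod F S = (Q, R)" by fastforce
  have "Polynomial.smult (lead_coeff S ^ (Suc (Polynomial.degree F) - Polynomial.degree S)) F = S * Q + R"
    and dR: "R = 0 \<or> Polynomial.degree R < Polynomial.degree S"
    using pseudo_divmod[OF \<open>S \<noteq> 0\<close> QR] by auto
  hence F: "F = S * Q + R" using degS coS p_gt_1 by simp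
  have "map_poly of_int R = (0 :: 'a poly)"
  proof (rule poly_eq_0_of_many_roots)
    show "inj_on (\<lambda>j. z ^ j) {1..<p}" by (rule inj_on_subset[OF z_pow_inj]) auto
    have "Polynomial.degree R < p - 1" using dR degS p_gt_1 by auto
    thus "Polynomial.degree (map_poly of_int R :: 'a poly) < card {1..<p}"
      by (simp add: degree_map_poly)
    fix i assume i: "i \<in> {1..<p}"
    hence ip: "\<not> p dvd i" by (auto dest: dvd_imp_le)
    hence "coprime i p" using prime_imp_coprime[OF prime_p] by (simp add: coprime_commute)
    then obtain x where x: "[i * x = 1] (mod p)" using cong_solve_coprime_nat by auto
    define j where "j = x mod p"
    have ij: "[i * j = 1] (mod p)" using x by (simp add: j_def cong_def mod_simps)
    have "j \<noteq> 0"
    proof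
      assume "j = 0"
      thus False using ij p_gt_1 by (simp add: cong_def)
    qed
    hence j: "j \<in> {1..<p}" using p_gt_1 by (simp add: j_def)
    have "(z ^ i) ^ j = z" using z_pow_cong[OF ij] by (simp add: power_mult)
    hence "int.ev (pcompose w (Polynomial.monom 1 j)) (z ^ i) = 0"
      using w by (simp add: int.ev_pcompose)
    hence "int.ev F (z ^ i) = 0" using j by (auto simp: F_def int.ev_prod)
    moreover have "int.ev S (z ^ i) = 0"
      using sum_powers_eq_0[OF ip] by (simp add: S_def int.ev_sum)
    ultimately have "int.ev R (z ^ i) = 0" by (simp add: F)
    thus "poly (map_poly of_int R :: 'a poly) (z ^ i) = 0" by (simp add: int.ev_def)
  qed simp
  hence "R = 0" by (simp add: map_poly_eq_0_iff)
  hence "poly F 1 = int p * poly Q 1" by (simp add: F S_def poly_sum poly_monom)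
  moreover have "poly F 1 = poly w 1 ^ (p - 1)"
    by (simp add: F_def poly_prod poly_pcompose poly_monom)
  ultimately have "int p dvd poly w 1 ^ (p - 1)" by simp
  moreover have "prime (int p)" using prime_p by simp
  ultimately show ?thesis by (rule prime_dvd_power[rotated])
qed

text \<open>
  Total ramification at \<open>y = 1 - z\<close>: expand \<open>f\<close> in powers of \<open>y\<close> with coefficients \<open>a\<^sub>i\<close>, without loss of
  generality not all divisible by \<open>p\<close>, and let \<open>a\<^sub>k\<close> be the first one that is not. Since \<open>p\<close> is a multiple of
  \<open>y\<^bsup>p-1\<^esup>\<close> and \<open>k < p - 1\<close>, dividing by \<open>y\<^sup>k\<close> leaves a relation \<open>a\<^sub>k + y * \<dots> = 0\<close>. By the previous lemma \<open>p\<close> divides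
  \<open>a\<^sub>k\<close>, since \<open>y\<close> becomes 0 when \<open>z\<close> is replaced by 1.
\<close>

lemma powers_independent_int:
  assumes deg: "Polynomial.degree f < p - 1" and f: "int.ev f z = 0"
  shows "f = 0"
proof (rule ccontr)
  assume "f \<noteq> 0"
  define y where "y = 1 - z"
  have y0: "y \<noteq> 0" using z_neq_1 by (simp add: y_def)
  define g0 where "g0 = pcompose f [:1, - 1:]"
  have g00: "g0 \<noteq> 0" using \<open>f \<noteq> 0\<close> by (simp add: g0_def pcompose_eq_0_iff)
  define g where "g = primitive_part g0"
  have "int.ev g0 y = 0" using f by (simp add: g0_def int.ev_pcompose y_def)
  moreover have "g0 = [:content g0:] * g" by (simp add: g_def)
  ultimately have "of_int (content g0) * int.ev g y = 0"
    by (metis int.ev_mult int.ev_pCons int.ev_0 mult_zero_right add.right_neutral)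
  hence gy: "int.ev g y = 0" using g00 by simp
  have degg: "Polynomial.degree g < p - 1"
    using deg by (simp add: g_def g0_def degree_pcompose)
  have "\<exists>k. \<not> int p dvd Polynomial.coeff g k"
  proof (rule ccontr)
    assume "\<not> ?thesis"
    hence "[:int p:] dvd g" by (simp add: const_poly_dvd_iff)
    hence "int p dvd content g" by (simp add: const_poly_dvd_iff_dvd_content)
    thus False using g00 p_gt_1 by (simp add: g_def)
  qed
  then obtain k where k: "\<not> int p dvd Polynomial.coeff g k"
    and small: "\<And>j. j < k \<Longrightarrow> int p dvd Polynomial.coeff g j"
    using LeastI_ex[of "\<lambda>k. \<not> int p dvd Polynomial.coeff g k"] not_less_Least by blast
  define a where "a = Polynomial.coeff g"
  define d where "d = Polynomial.degree g"
  have kd: "k \<le> d" using k by (metis d_def coeff_eq_0 dvd_0_right not_le)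
  define A where "A = (\<Sum>i<k. Polynomial.monom (a i div int p) i)"
  define B where "B = (\<Sum>i\<in>{k<..d}. Polynomial.monom (a i) (i - k - 1))"
  define E where "E = (\<Prod>j\<in>{1..<p}. \<Sum>i<j. Polynomial.monom (1::int) i)"
  have E: "of_nat p = y ^ (p - 1) * int.ev E z"
  proof -
    have "of_nat p = (\<Prod>j\<in>{1..<p}. y * (\<Sum>i<j. z ^ i))"
      unfolding prod_one_minus_powers[symmetric] y_def one_diff_power_eq ..
    thus ?thesis by (simp add: prod.distrib E_def int.ev_prod int.ev_sum)
  qed
  have "0 = (\<Sum>i\<le>d. of_int (a i) * y ^ i)"
    using gy by (simp add: int.ev_def poly_altdef a_def d_def coeff_map_poly degree_map_poly)
  also have "{..d} = {..<k} \<union> insert k {k<..d}" using kd by auto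
  also have "(\<Sum>i\<in>{..<k} \<union> insert k {k<..d}. of_int (a i) * y ^ i)
      = (\<Sum>i<k. of_int (a i) * y ^ i) + (of_int (a k) * y ^ k + (\<Sum>i\<in>{k<..d}. of_int (a i) * y ^ i))"
    by (subst sum.union_disjoint) auto
  also have "(\<Sum>i<k. of_int (a i) * y ^ i) = of_nat p * int.ev A y"
  proof -
    have "(of_int (a i) :: 'a) = of_nat p * of_int (a i div int p)" if "i < k" for i
    proof -
      have "a i = int p * (a i div int p)" using small[OF that] by (simp add: a_def)
      thus ?thesis by (metis of_int_mult of_int_of_nat_eq)
    qed
    thus ?thesis by (simp add: A_def int.ev_sum sum_distrib_left mult.assoc)
  qed
  also have "(\<Sum>i\<in>{k<..d}. of_int (a i) * y ^ i) = y ^ k * (y * int.ev B y)"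
    unfolding B_def int.ev_sum sum_distrib_left
    by (intro sum.cong) (auto simp flip: power_Suc power_add simp: algebra_simps)
  also have "of_nat p = y ^ k * (y * y ^ (p - 2 - k) * int.ev E z)"
  proof -
    have "p - 1 = k + 1 + (p - 2 - k)" using kd degg d_def by simp
    thus ?thesis unfolding E by (simp only: power_add power_one_right mult.assoc)
  qed
  finally have "y ^ k * (of_int (a k) + y * (y ^ (p - 2 - k) * int.ev E z * int.ev A y + int.ev B y)) = 0"
    by (simp add: algebra_simps)
  hence "of_int (a k) + y * (y ^ (p - 2 - k) * int.ev E z * int.ev A y + int.ev B y) = 0"
    using y0 by simp
  moreover define w where "w = [:a k:] + [:1, - 1:] *
    ([:1, - 1:] ^ (p - 2 - k) * E * pcompose A [:1, - 1:] + pcompose B [:1, - 1:])"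
  have ev_pow: "int.ev (q ^ m) x = int.ev q x ^ m" for q m x by (induction m) auto
  have "int.ev w z = of_int (a k) + y * (y ^ (p - 2 - k) * int.ev E z * int.ev A y + int.ev B y)"
    unfolding w_def int.ev_add int.ev_mult ev_pow int.ev_pcompose by (simp add: y_def)
  ultimately have "int.ev w z = 0" by simp
  hence "int p dvd poly w 1" by (rule p_dvd_value_at_1)
  moreover have "poly w 1 = a k" by (simp add: w_def)
  ultimately show False using k by (simp add: a_def)
qed

end


section \<open>Rank and nullity\<close>

context vector_space
begin

text \<open>
  Bases are given as families below; the next two facts translate the vanishing of coefficients for a
  family into statements about its range.
\<close>

lemma independent_family_imp_inj:
  assumes "\<And>u. (\<Sum>j\<in>J. scale (u j) (b j)) = 0 \<Longrightarrow> \<forall>j\<in>J. u j = 0" and J: "finite J"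
  shows "inj_on b J"
proof (rule inj_onI, rule ccontr)
  fix i j assume ij: "i \<in> J" "j \<in> J" "b i = b j" "i \<noteq> j"
  define u :: "_ \<Rightarrow> 'a" where "u k = (if k = i then 1 else if k = j then - 1 else 0)" for k
  have "(\<Sum>k\<in>J. scale (u k) (b k)) = (\<Sum>k\<in>{i, j}. scale (u k) (b k))"
    by (rule sum.mono_neutral_right) (use ij J in \<open>auto simp: u_def\<close>)
  also have "\<dots> = 0" using ij by (simp add: u_def)
  finally have "u i = 0" using assms(1) ij(1) by blast
  thus False by (simp add: u_def)
qed

lemma independent_family:
  assumes *: "\<And>u. (\<Sum>j\<in>J. scale (u j) (b j)) = 0 \<Longrightarrow> \<forall>j\<in>J. u j = 0" and J: "finite J"
  shows "independent (b ` J)"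
proof -
  have inj: "inj_on b J" by (rule independent_family_imp_inj[OF assms])
  show ?thesis
  proof (rule independent_if_scalars_zero)
    fix u x assume "(\<Sum>x\<in>b ` J. scale (u x) x) = 0" "x \<in> b ` J"
    thus "u x = 0" using *[of "u \<circ> b"] by (auto simp: sum.reindex[OF inj])
  qed (use J in simp)
qed

lemma independent_span_Int:
  assumes D: "independent D" and C: "C \<subseteq> D" and x: "x \<in> span C" "x \<in> span (D - C)"
  shows "x = 0"
proof -
  have xD: "x \<in> span D" using x(1) C span_mono by blast
  have "representation D x = representation C x"
    by (rule representation_extend[OF D x(1) C])
  moreover have "representation D x = representation (D - C) x"
    by (rule representation_extend[OF D x(2)]) auto
  ultimately have "representation D x v = 0" for v
    using representation_ne_zero[of C x v] representation_ne_zero[of "D - C" x v] by auto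
  hence "(\<Sum>v | representation D x v \<noteq> 0. scale (representation D x v) v) = 0" by simp
  thus ?thesis using sum_nonzero_representation_eq[OF D xD] by simp
qed

end

text \<open>
  The map is only linear on \<open>S\<close>, since forms and automorphisms are additive only inside the field.
  Extend a basis of the kernel to a basis \<open>D\<close> of \<open>S\<close>; a linear map agreeing with \<open>f\<close> on \<open>D\<close> agrees with it on \<open>S\<close>
  and is injective on the span of the new vectors.
\<close>

lemma rank_nullity:
  fixes s1 :: "'a::field \<Rightarrow> 'b::ab_group_add \<Rightarrow> 'b" and s2 :: "'a \<Rightarrow> 'c::ab_group_add \<Rightarrow> 'c"
  assumes V1: "vector_space s1" and V2: "vector_space s2"
    and S: "module.subspace s1 S" and B: "finite B" "S \<subseteq> module.span s1 B"
    and add: "\<And>x y. x \<in> S \<Longrightarrow> y \<in> S \<Longrightarrow> f (x + y) = f x + f y"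
    and scale: "\<And>c x. x \<in> S \<Longrightarrow> f (s1 c x) = s2 c (f x)"
  shows "vector_space.dim s1 S = vector_space.dim s2 (f ` S) + vector_space.dim s1 {x\<in>S. f x = 0}"
proof -
  interpret V1: vector_space s1 by fact
  interpret V2: vector_space s2 by fact
  interpret P: vector_space_pair s1 s2 ..
  define N where "N = {x\<in>S. f x = 0}"
  have f0: "f 0 = 0" using scale[OF V1.subspace_0[OF S], of 0] by simp
  obtain C where C: "C \<subseteq> N" "V1.independent C" "N \<subseteq> V1.span C"
    using V1.maximal_independent_subset by blast
  have "C \<subseteq> S" using C by (auto simp: N_def)
  then obtain D where D: "C \<subseteq> D" "D \<subseteq> S" "V1.independent D" "S \<subseteq> V1.span D"
    using V1.maximal_independent_subset_extend C(2) by blast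
  have finD: "finite D" using V1.independent_span_bound[OF B(1) D(3)] D(2) B(2) by blast
  obtain g where g: "Vector_Spaces.linear s1 s2 g" "\<And>x. x \<in> D \<Longrightarrow> g x = f x"
    using P.linear_independent_extend[OF D(3), of f] by blast
  interpret g: Vector_Spaces.linear s1 s2 g by fact
  have spD: "V1.span D = S" using D S V1.span_minimal by blast
  have gf: "x \<in> V1.span D \<Longrightarrow> x \<in> S \<and> g x = f x" for x
  proof (induction x rule: V1.span_induct_alt)
    case base
    thus ?case using f0 S V1.subspace_0 by simp
  next
    case (step c x y)
    have x: "x \<in> S" "s1 c x \<in> S" using step(1) D(2) S V1.subspace_scale by auto
    thus ?case using step g(2) S V1.subspace_add[of S "s1 c x" y] 
      by (simp add: add scale g.add g.scale)
  qed
  have gS: "g ` S = f ` S" using gf spD by (auto simp: image_iff)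
  have ker: "x = 0" if "x \<in> V1.span (D - C)" "g x = 0" for x
  proof -
    have "x \<in> V1.span D" using that V1.span_mono[of "D - C" D] by blast
    hence "x \<in> N" using gf that by (auto simp: N_def)
    thus ?thesis using V1.independent_span_Int[OF D(3,1)] that C(3) by blast
  qed
  have inj: "inj_on g (V1.span (D - C))"
    using ker g.inj_on_iff_eq_0[OF V1.subspace_span, of "D - C"] by blast
  have "V2.independent (g ` (D - C))"
    using g.independent_injective_image[OF V1.independent_mono[OF D(3)] inj] by blast
  moreover have "f ` S \<subseteq> V2.span (g ` (D - C))"
  proof
    fix y assume "y \<in> f ` S"
    hence "y \<in> V2.span (g ` D)" using gS spD g.span_image[of D] by auto
    moreover have "g ` D \<subseteq> V2.span (g ` (D - C))"
    proof
      fix w assume "w \<in> g ` D"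
      then obtain x where x: "x \<in> D" "w = g x" by blast
      show "w \<in> V2.span (g ` (D - C))"
      proof (cases "x \<in> C")
        case True
        hence "w = 0" using C(1) x g(2) by (auto simp: N_def)
        thus ?thesis using V2.span_zero by simp
      next
        case False
        hence "g x \<in> g ` (D - C)" using x by (intro imageI) simp
        thus ?thesis using x(2) V2.span_base by simp
      qed
    qed
    ultimately show "y \<in> V2.span (g ` (D - C))" 
      using V2.span_minimal[OF _ V2.subspace_span] by blast
  qed
  moreover have "g ` (D - C) \<subseteq> f ` S" using D(2) g(2) by auto
  ultimately have "V2.dim (f ` S) = card (g ` (D - C))" using V2.basis_card_eq_dim by metis
  also have "\<dots> = card (D - C)"
    using inj inj_on_subset V1.span_superset by (intro card_image) blast
  also have "\<dots> = card D - card C" using D(1) finD by (simp add: card_Diff_subset finite_subset)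
  also have "card C = V1.dim N" using V1.basis_card_eq_dim[OF C(1,3,2)] .
  also have "card D = V1.dim S" using V1.basis_card_eq_dim[OF D(2,4,3)] .
  finally have "V2.dim (f ` S) = V1.dim S - V1.dim N" .
  moreover have "card C \<le> card D" using D(1) finD by (rule card_mono[rotated])
  hence "V1.dim N \<le> V1.dim S" using V1.basis_card_eq_dim[OF C(1,3,2)] V1.basis_card_eq_dim[OF D(2,4,3)] by simp
  ultimately show ?thesis by (simp add: N_def)
qed


section \<open>Cyclic extensions and the dual basis\<close>

global_interpretation KV: vector_space "ext_scale :: 'k::field \<Rightarrow> 'k alg_closure \<Rightarrow> 'k alg_closure"
  by (rule vector_space_ext_scale)

lemma subspace_ext_scale:
  assumes "0 \<in> S" "\<And>x y. x \<in> S \<Longrightarrow> y \<in> S \<Longrightarrow> x + y \<in> S" "\<And>c x. x \<in> S \<Longrightarrow> to_ac c * x \<in> S"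
  shows "KV.subspace S"
  by (rule KV.subspaceI) (auto simp: assms ext_scale_def)

text \<open>
  A cyclic extension in a form that can be verified by computation: a ring containing \<open>K\<close>, an
  endomorphism with fixed elements \<open>K\<close> and period \<open>n\<close>, and an element with \<open>n\<close> distinct conjugates. That \<open>L\<close> is
  a field of degree \<open>n\<close> whose Galois group is generated by \<open>\<sigma>\<close> is derived from this.
\<close>

locale cyclic_extension =
  fixes L :: "'k::field_char_0 alg_closure set"
    and \<sigma> :: "'k alg_closure \<Rightarrow> 'k alg_closure" and n :: nat and \<theta> :: "'k alg_closure"
  assumes n_pos: "n > 0"
    and K_closed [simp, intro]: "\<And>c. to_ac c \<in> L"
    and add_closed [simp, intro]: "\<And>x y. x \<in> L \<Longrightarrow> y \<in> L \<Longrightarrow> x + y \<in> L"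
    and mult_closed [simp, intro]: "\<And>x y. x \<in> L \<Longrightarrow> y \<in> L \<Longrightarrow> x * y \<in> L"
    and \<sigma>_closed: "\<And>x. x \<in> L \<Longrightarrow> \<sigma> x \<in> L"
    and \<sigma>_add: "\<And>x y. x \<in> L \<Longrightarrow> y \<in> L \<Longrightarrow> \<sigma> (x + y) = \<sigma> x + \<sigma> y"
    and \<sigma>_mult: "\<And>x y. x \<in> L \<Longrightarrow> y \<in> L \<Longrightarrow> \<sigma> (x * y) = \<sigma> x * \<sigma> y"
    and fixed_iff: "\<And>x. x \<in> L \<Longrightarrow> \<sigma> x = x \<longleftrightarrow> x \<in> range to_ac"
    and \<sigma>_order: "\<And>x. x \<in> L \<Longrightarrow> (\<sigma> ^^ n) x = x"
    and \<theta>_closed [simp]: "\<theta> \<in> L"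
    and \<theta>_inj: "inj_on (\<lambda>i. (\<sigma> ^^ i) \<theta>) {..<n}"
begin

abbreviation S :: "nat \<Rightarrow> 'k alg_closure \<Rightarrow> 'k alg_closure" where
  "S i \<equiv> \<sigma> ^^ i"

lemma zero_closed [simp, intro]: "0 \<in> L" using K_closed[of 0] by simp
lemma one_closed [simp, intro]: "1 \<in> L" using K_closed[of 1] by simp

lemma minus_closed [simp, intro]: "x \<in> L \<Longrightarrow> - x \<in> L"
  using mult_closed[OF K_closed[of "- 1"]] by simp

lemma diff_closed [simp, intro]: "x \<in> L \<Longrightarrow> y \<in> L \<Longrightarrow> x - y \<in> L"
  using add_closed[of x "- y"] by simp

lemma sum_closed [intro]: "(\<And>i. i \<in> A \<Longrightarrow> f i \<in> L) \<Longrightarrow> sum f A \<in> L"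
  by (induction A rule: infinite_finite_induct) auto

lemma prod_closed [intro]: "(\<And>i. i \<in> A \<Longrightarrow> f i \<in> L) \<Longrightarrow> prod f A \<in> L"
  by (induction A rule: infinite_finite_induct) auto

lemma power_closed [simp, intro]: "x \<in> L \<Longrightarrow> x ^ m \<in> L"
  by (induction m) auto

lemma S_closed [simp, intro]: "x \<in> L \<Longrightarrow> S i x \<in> L"
  by (induction i) (auto simp: \<sigma>_closed)

lemma S_S: "S i (S j x) = S (i + j) x"
  by (simp add: funpow_add)

lemma S_add: "x \<in> L \<Longrightarrow> y \<in> L \<Longrightarrow> S i (x + y) = S i x + S i y"
  by (induction i) (auto simp: \<sigma>_add)

lemma S_mult: "x \<in> L \<Longrightarrow> y \<in> L \<Longrightarrow> S i (x * y) = S i x * S i y"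
  by (induction i) (auto simp: \<sigma>_mult)

lemma S_to_ac [simp]: "S i (to_ac c) = to_ac c"
  by (induction i) (auto simp: fixed_iff)

lemma S_0 [simp]: "S i 0 = 0" using S_to_ac[of i 0] by simp
lemma S_1 [simp]: "S i 1 = 1" using S_to_ac[of i 1] by simp

lemma S_minus: "x \<in> L \<Longrightarrow> S i (- x) = - S i x"
  using S_add[of x "- x" i] by (simp add: eq_neg_iff_add_eq_0 add.commute)

lemma S_diff: "x \<in> L \<Longrightarrow> y \<in> L \<Longrightarrow> S i (x - y) = S i x - S i y"
  using S_add[of x "- y" i] by (simp add: S_minus)

lemma S_sum: "(\<And>j. j \<in> A \<Longrightarrow> f j \<in> L) \<Longrightarrow> S i (sum f A) = (\<Sum>j\<in>A. S i (f j))"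
  by (induction A rule: infinite_finite_induct) (auto simp: S_add sum_closed)

lemma S_prod: "(\<And>j. j \<in> A \<Longrightarrow> f j \<in> L) \<Longrightarrow> S i (prod f A) = (\<Prod>j\<in>A. S i (f j))"
  by (induction A rule: infinite_finite_induct) (auto simp: S_mult prod_closed)

lemma S_power: "x \<in> L \<Longrightarrow> S i (x ^ m) = S i x ^ m"
  by (induction m) (auto simp: S_mult)

lemma S_n_mult: "x \<in> L \<Longrightarrow> S (n * m) x = x"
  by (induction m) (auto simp: funpow_add \<sigma>_order)

lemma S_mod: "x \<in> L \<Longrightarrow> S (i mod n) x = S i x"
proof -
  assume x: "x \<in> L"
  have "S i x = S (i mod n) (S (n * (i div n)) x)" by (simp add: S_S)
  thus ?thesis using x by (simp add: S_n_mult)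
qed

lemma S_cong: "x \<in> L \<Longrightarrow> [i = j] (mod n) \<Longrightarrow> S i x = S j x"
  using S_mod[of x i] S_mod[of x j] by (simp add: cong_def)

lemma S_inverse_ex: "x \<in> L \<Longrightarrow> S (n * i - i) (S i x) = x"
  using n_pos by (simp add: S_S S_n_mult)

lemma S_eq_0_iff [simp]: "x \<in> L \<Longrightarrow> S i x = 0 \<longleftrightarrow> x = 0"
  using S_inverse_ex[of x i] by (metis S_0)

text \<open>
  The norm of \<open>x\<close> is fixed by \<open>\<sigma>\<close>, hence in \<open>K\<close>, and the other factors of the norm give the inverse.
\<close>

lemma inverse_closed [simp, intro]:
  assumes x: "x \<in> L"
  shows "inverse x \<in> L"
proof (cases "x = 0")
  case False
  define N where "N = (\<Prod>i<n. S i x)"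
  have NL: "N \<in> L" unfolding N_def using x by (intro prod_closed) auto
  have "\<sigma> N = (\<Prod>i<n. S (Suc i) x)"
    using S_prod[of "{..<n}" "\<lambda>i. S i x" 1] x by (simp add: N_def)
  also have "\<dots> = (\<Prod>i\<in>insert n {1..<n}. S i x)"
    by (rule prod.reindex_bij_witness[of _ "\<lambda>i. i - 1" Suc]) (use n_pos in auto)
  also have "\<dots> = (\<Prod>i\<in>insert 0 {1..<n}. S i x)"
    using x by (simp add: \<sigma>_order)
  also have "insert 0 {1..<n} = {..<n}" using n_pos by auto
  finally have "\<sigma> N = N" by (simp add: N_def)
  then obtain c where c: "N = to_ac c" using fixed_iff NL by auto
  have Nx: "N = x * (\<Prod>i\<in>{1..<n}. S i x)"
  proof -
    have "{..<n} = insert 0 {1..<n}" using n_pos by auto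
    thus ?thesis by (simp add: N_def)
  qed
  have "N \<noteq> 0" using False x by (simp add: N_def)
  hence "inverse x = to_ac (inverse c) * (\<Prod>i\<in>{1..<n}. S i x)"
    using False c Nx by (simp add: field_simps)
  moreover have "(\<Prod>i\<in>{1..<n}. S i x) \<in> L" using x by (intro prod_closed) auto
  ultimately show ?thesis by (metis K_closed mult_closed)
qed auto

lemma divide_closed [simp, intro]: "x \<in> L \<Longrightarrow> y \<in> L \<Longrightarrow> x / y \<in> L"
  by (simp add: divide_inverse)

lemma S_inverse: "x \<in> L \<Longrightarrow> S i (inverse x) = inverse (S i x)"
proof (cases "x = 0")
  case False
  assume x: "x \<in> L"
  have "S i x * S i (inverse x) = 1" using False x by (simp flip: S_mult)
  thus ?thesis using inverse_unique by metis
qed simp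

lemma S_divide: "x \<in> L \<Longrightarrow> y \<in> L \<Longrightarrow> S i (x / y) = S i x / S i y"
  by (simp add: divide_inverse S_mult S_inverse)

definition Tr :: "'k alg_closure \<Rightarrow> 'k alg_closure" where
  "Tr x = (\<Sum>i<n. S i x)"

lemma Tr_closed [simp, intro]: "x \<in> L \<Longrightarrow> Tr x \<in> L"
  unfolding Tr_def by (intro sum_closed) auto

lemma Tr_add: "x \<in> L \<Longrightarrow> y \<in> L \<Longrightarrow> Tr (x + y) = Tr x + Tr y"
  by (simp add: Tr_def S_add sum.distrib)

lemma Tr_minus: "x \<in> L \<Longrightarrow> Tr (- x) = - Tr x"
  by (simp add: Tr_def S_minus sum_negf)

lemma Tr_diff: "x \<in> L \<Longrightarrow> y \<in> L \<Longrightarrow> Tr (x - y) = Tr x - Tr y"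
  by (simp add: Tr_def S_diff sum_subtractf)

lemma Tr_scale: "x \<in> L \<Longrightarrow> Tr (to_ac c * x) = to_ac c * Tr x"
  by (simp add: Tr_def S_mult sum_distrib_left)

lemma Tr_0 [simp]: "Tr 0 = 0" by (simp add: Tr_def)

lemma Tr_sum: "(\<And>j. j \<in> A \<Longrightarrow> f j \<in> L) \<Longrightarrow> Tr (sum f A) = (\<Sum>j\<in>A. Tr (f j))"
  by (induction A rule: infinite_finite_induct) (auto simp: Tr_add sum_closed)

lemma Tr_\<sigma>: "x \<in> L \<Longrightarrow> Tr (\<sigma> x) = Tr x"
proof -
  assume x: "x \<in> L"
  have "Tr (\<sigma> x) = (\<Sum>i<n. S (Suc i) x)" by (simp add: Tr_def funpow_swap1)
  also have "\<dots> = (\<Sum>i\<in>insert n {1..<n}. S i x)"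
    by (rule sum.reindex_bij_witness[of _ "\<lambda>i. i - 1" Suc]) (use n_pos in auto)
  also have "\<dots> = (\<Sum>i\<in>insert 0 {1..<n}. S i x)"
    using x by (simp add: \<sigma>_order)
  also have "insert 0 {1..<n} = {..<n}" using n_pos by auto
  finally show ?thesis by (simp add: Tr_def)
qed

lemma Tr_S: "x \<in> L \<Longrightarrow> Tr (S j x) = Tr x"
  by (induction j) (auto simp: Tr_\<sigma>)

lemma Tr_in_K: "x \<in> L \<Longrightarrow> Tr x \<in> range to_ac"
proof -
  assume x: "x \<in> L"
  have "\<sigma> (Tr x) = (\<Sum>i<n. S (Suc i) x)"
    using S_sum[of "{..<n}" "\<lambda>i. S i x" 1] x by (simp add: Tr_def)
  also have "\<dots> = Tr (\<sigma> x)" by (simp add: Tr_def funpow_swap1)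
  finally show ?thesis using x fixed_iff[of "Tr x"] by (simp add: Tr_\<sigma>)
qed

text \<open>
  The Lagrange polynomial that is \<open>1\<close> at \<open>\<theta>\<close> and \<open>0\<close> at its other conjugates; its
  coefficients form the basis dual to the powers of \<open>\<theta>\<close> under the trace form.
\<close>

definition dual :: "nat \<Rightarrow> 'k alg_closure" where
  "dual j = Polynomial.coeff (\<Prod>i\<in>{1..<n}. Polynomial.smult (inverse (\<theta> - S i \<theta>)) [:- S i \<theta>, 1:]) j"

lemma dual_closed [simp, intro]: "dual j \<in> L"
proof -
  have "\<forall>j. Polynomial.coeff (\<Prod>i\<in>A. Polynomial.smult (inverse (\<theta> - S i \<theta>)) [:- S i \<theta>, 1:]) j \<in> L" for A
  proof (induction A rule: infinite_finite_induct)
    case (insert i A)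
    show ?case
      using insert by (auto simp: coeff_pCons split: nat.split)
  qed (auto simp: if_distrib)
  thus ?thesis by (simp add: dual_def)
qed

lemma dual_sum:
  assumes "i < n"
  shows "(\<Sum>j<n. dual j * S i (\<theta> ^ j)) = (if i = 0 then 1 else 0)"
proof -
  define l where "l = (\<Prod>i\<in>{1..<n}. Polynomial.smult (inverse (\<theta> - S i \<theta>)) [:- S i \<theta>, 1:])"
  have "Polynomial.degree (Polynomial.smult c [:x, 1:]) \<le> 1" for c x :: "'k alg_closure"
    by (rule order_trans[OF degree_smult_le]) simp
  hence "Polynomial.degree l \<le> (\<Sum>i\<in>{1..<n}. 1)"
    unfolding l_def by (intro order_trans[OF degree_prod_sum_le] sum_mono) (simp_all only: o_def finite_atLeastLessThan)
  hence deg: "Polynomial.degree l < n" using n_pos by simp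
  have "poly l x = (\<Sum>j<n. dual j * x ^ j)" for x
  proof -
    have "poly l x = (\<Sum>j\<le>Polynomial.degree l. Polynomial.coeff l j * x ^ j)" by (rule poly_altdef)
    also have "\<dots> = (\<Sum>j<n. Polynomial.coeff l j * x ^ j)"
      by (rule sum.mono_neutral_left) (use deg in \<open>auto simp: coeff_eq_0\<close>)
    finally show ?thesis by (simp add: dual_def l_def)
  qed
  moreover have "poly l (S i \<theta>) = (if i = 0 then 1 else 0)"
  proof (cases "i = 0")
    case True
    have "\<theta> - S k \<theta> \<noteq> 0" if "k \<in> {1..<n}" for k
      using inj_onD[OF \<theta>_inj, of 0 k] n_pos that by auto
    hence "inverse (\<theta> - S k \<theta>) * (\<theta> - S k \<theta>) = 1" if "k \<in> {1..<n}" for k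
      using that by (intro left_inverse)
    thus ?thesis using True by (auto simp: l_def poly_prod algebra_simps intro!: prod.neutral)
  next
    case False
    thus ?thesis using assms by (auto simp: l_def poly_prod intro!: bexI[of _ i])
  qed
  ultimately show ?thesis by (simp add: S_power)
qed

text \<open>
  Apply \<open>\<sigma>\<^sup>a\<close> to the interpolation property of the Lagrange polynomial at the conjugate of index \<open>b - a\<close>.
\<close>

lemma dual_sum_conj:
  assumes ab: "a < n" "b < n"
  shows "(\<Sum>j<n. S a (dual j) * S b (\<theta> ^ j)) = (if a = b then 1 else 0)"
proof -
  define c where "c = (b + (n - a)) mod n"
  have c: "c < n" "[a + c = b] (mod n)" "c = 0 \<longleftrightarrow> a = b"
  proof -
    show "c < n" using n_pos by (simp add: c_def)
    show *: "[a + c = b] (mod n)" using ab by (simp add: c_def cong_def mod_simps)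
    show "c = 0 \<longleftrightarrow> a = b"
    proof
      assume "c = 0"
      thus "a = b" using * ab by (simp add: cong_def)
    qed (use ab in \<open>simp add: c_def\<close>)
  qed
  have "(\<Sum>j<n. S a (dual j) * S b (\<theta> ^ j)) = (\<Sum>j<n. S a (dual j * S c (\<theta> ^ j)))"
    by (rule sum.cong) (use c(2) in \<open>auto simp: S_mult S_S intro!: S_cong[OF _ cong_sym]\<close>)
  also have "\<dots> = S a (\<Sum>j<n. dual j * S c (\<theta> ^ j))" by (rule S_sum[symmetric]) auto
  also have "\<dots> = (if a = b then 1 else 0)" using dual_sum[OF c(1)] c(3) by simp
  finally show ?thesis .
qed

lemma expansion:
  assumes y: "y \<in> L"
  shows "y = (\<Sum>j<n. Tr (dual j * y) * \<theta> ^ j)"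
proof -
  have "(\<Sum>j<n. Tr (dual j * y) * \<theta> ^ j) = (\<Sum>j<n. \<Sum>i<n. S i (dual j) * S 0 (\<theta> ^ j) * S i y)"
    using y by (simp add: Tr_def S_mult sum_distrib_left sum_distrib_right mult_ac)
  also have "\<dots> = (\<Sum>i<n. (\<Sum>j<n. S i (dual j) * S 0 (\<theta> ^ j)) * S i y)"
    by (subst sum.swap) (simp add: sum_distrib_right)
  also have "\<dots> = (\<Sum>i<n. (if i = 0 then 1 else 0) * S i y)"
    using n_pos by (intro sum.cong) (simp_all only: dual_sum_conj lessThan_iff)
  also have "\<dots> = y" using n_pos by (simp add: sum.delta if_distrib[of "\<lambda>c. c * _"] cong: if_cong)
  finally show ?thesis ..
qed

text \<open>
  Dedekind's lemma for the powers of \<open>\<sigma>\<close>: pairing with the dual basis isolates the coefficient \<open>a\<^sub>k\<close>.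
\<close>

lemma automorphisms_independent:
  assumes 0: "\<And>y. y \<in> L \<Longrightarrow> (\<Sum>i<n. a i * S i y) = 0" and k: "k < n"
  shows "a k = 0"
proof -
  have "0 = (\<Sum>j<n. S k (dual j) * (\<Sum>i<n. a i * S i (\<theta> ^ j)))" by (simp add: 0)
  also have "\<dots> = (\<Sum>i<n. a i * (\<Sum>j<n. S k (dual j) * S i (\<theta> ^ j)))"
    unfolding sum_distrib_left by (subst sum.swap) (simp add: mult_ac)
  also have "\<dots> = (\<Sum>i<n. a i * (if k = i then 1 else 0))"
    using k by (intro sum.cong) (simp_all only: dual_sum_conj lessThan_iff)
  also have "\<dots> = (\<Sum>i<n. if k = i then a i else 0)" by (intro sum.cong) auto
  also have "\<dots> = a k" using k by (simp add: sum.delta')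
  finally show ?thesis ..
qed

lemma Tr_nondegenerate:
  assumes "y \<in> L" "\<And>x. x \<in> L \<Longrightarrow> Tr (x * y) = 0"
  shows "y = 0"
  using expansion[OF assms(1)] assms(2) by simp

lemma subspace_L: "KV.subspace L"
  by (rule subspace_ext_scale) auto

lemma span_powers: "KV.span ((\<lambda>j. \<theta> ^ j) ` {..<n}) = L"
proof (rule KV.span_unique)
  fix T assume T: "(\<lambda>j. \<theta> ^ j) ` {..<n} \<subseteq> T" "KV.subspace T"
  show "L \<subseteq> T"
  proof
    fix y assume y: "y \<in> L"
    have "Tr (dual j * y) * \<theta> ^ j \<in> T" if "j < n" for j
    proof -
      obtain c where "Tr (dual j * y) = to_ac c" using Tr_in_K y by blast
      thus ?thesis using KV.subspace_scale[OF T(2), of "\<theta> ^ j" c] T(1) that by (auto simp: ext_scale_def)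
    qed
    hence "(\<Sum>j<n. Tr (dual j * y) * \<theta> ^ j) \<in> T" by (intro KV.subspace_sum[OF T(2)]) auto
    thus "y \<in> T" using expansion[OF y] by simp
  qed
qed (auto simp: subspace_L)

text \<open>
  A relation is a polynomial of degree below \<open>n\<close> over \<open>K\<close> that vanishes at the \<open>n\<close> conjugates of \<open>\<theta>\<close>.
\<close>

lemma powers_independent:
  fixes u :: "nat \<Rightarrow> 'k"
  assumes "(\<Sum>j<n. ext_scale (u j) (\<theta> ^ j)) = 0"
  shows "\<forall>j\<in>{..<n}. u j = 0"
proof -
  define q where "q = (\<Sum>j<n. Polynomial.monom (to_ac (u j)) j)"
  have co: "Polynomial.coeff q j = (if j < n then to_ac (u j) else 0)" for j
    by (simp add: q_def coeff_sum sum.delta)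
  have "q = 0"
  proof (rule poly_eq_0_of_many_roots[OF \<theta>_inj])
    have "Polynomial.degree q \<le> n - 1" by (rule degree_le) (auto simp: co)
    thus "Polynomial.degree q < card {..<n}" using n_pos by simp
    fix i
    have "0 = S i (\<Sum>j<n. ext_scale (u j) (\<theta> ^ j))" by (simp add: assms)
    also have "\<dots> = (\<Sum>j<n. to_ac (u j) * S i \<theta> ^ j)"
      by (subst S_sum) (auto simp: ext_scale_def S_mult S_power)
    finally show "poly q (S i \<theta>) = 0" by (simp add: q_def poly_sum poly_monom)
  qed simp
  thus ?thesis using co by (metis lessThan_iff coeff_0 to_ac_eq_0_iff)
qed

lemma dim_L: "KV.dim L = n"
proof -
  have inj: "inj_on (\<lambda>j. \<theta> ^ j) {..<n}"
    by (rule KV.independent_family_imp_inj) (use powers_independent in auto)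
  have "KV.independent ((\<lambda>j. \<theta> ^ j) ` {..<n})"
    by (rule KV.independent_family) (use powers_independent in auto)
  hence "KV.dim L = card ((\<lambda>j. \<theta> ^ j) ` {..<n})"
    using KV.dim_span_eq_card_independent span_powers by metis
  thus ?thesis by (simp add: card_image[OF inj])
qed

text \<open>
  The new generator is the relative norm of \<open>c - \<theta>\<close>. Its conjugates are the values at \<open>c\<close> of \<open>d\<close> polynomials
  with pairwise different sets of roots, so all but finitely many \<open>c\<close> in the infinite field \<open>K\<close> make them distinct.
\<close>

lemma fixed_field_cyclic:
  assumes d: "d dvd n"
  shows "\<exists>\<theta>'. cyclic_extension {x\<in>L. S d x = x} \<sigma> d \<theta>'"
proof -
  obtain e where e: "n = d * e" using d by (auto simp: dvd_def)
  have dp: "d > 0" "e > 0" using n_pos e by auto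
  define q where "q j = (\<Prod>t<e. [:- S (t * d + j) \<theta>, 1:])" for j
  have ne: "q j \<noteq> q j'" if jj: "j < d" "j' < d" "j \<noteq> j'" for j j'
  proof
    assume eq: "q j = q j'"
    have "poly (q j) (S j \<theta>) = 0" using dp by (auto simp: q_def poly_prod intro!: bexI[of _ 0])
    hence "poly (q j') (S j \<theta>) = 0" by (simp only: eq)
    then obtain t where t: "t < e" "S j \<theta> = S (t * d + j') \<theta>" by (auto simp: q_def poly_prod)
    have "t * d + j' < (t + 1) * d" using jj by simp
    also have "\<dots> \<le> e * d" using t by (intro mult_right_mono) auto
    finally have "t * d + j' < n" by (simp add: e mult.commute)
    moreover have "j < n" using jj dp e by (metis dvd_imp_le d n_pos order_less_le_trans)
    ultimately have "j = t * d + j'" using \<theta>_inj t(2) by (auto simp: inj_on_def)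
    hence "j mod d = j' mod d" by simp
    thus False using jj by simp
  qed
  define Z where "Z = (\<Union>(j, j')\<in>{(j, j'). j < d \<and> j' < d \<and> j \<noteq> j'}. {x. poly (q j - q j') x = 0})"
  have "finite {(j, j'). j < d \<and> j' < d \<and> j \<noteq> j'}"
    by (rule finite_subset[of _ "{..<d} \<times> {..<d}"]) auto
  moreover have "finite {x. poly (q j - q j') x = 0}" if "j < d" "j' < d" "j \<noteq> j'" for j j'
    by (rule poly_roots_finite) (use ne that in simp)
  ultimately have "finite Z" unfolding Z_def by (intro finite_UN_I) (auto simp del: poly_diff)
  moreover have "infinite (range (to_ac :: 'k \<Rightarrow> _))"
    using finite_imageD[OF _ inj_to_ac] infinite_UNIV_char_0 by blast
  ultimately obtain c :: 'k where c: "to_ac c \<notin> Z" by (metis finite_subset image_subsetI)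
  define \<theta>' where "\<theta>' = (\<Prod>t<e. to_ac c - S (t * d) \<theta>)"
  have \<theta>'L: "\<theta>' \<in> L" unfolding \<theta>'_def by (intro prod_closed) auto
  have S\<theta>': "S j \<theta>' = poly (q j) (to_ac c)" for j
  proof -
    have "S j \<theta>' = (\<Prod>t<e. S j (to_ac c - S (t * d) \<theta>))" unfolding \<theta>'_def by (rule S_prod) auto
    also have "\<dots> = (\<Prod>t<e. to_ac c - S (t * d + j) \<theta>)"
      by (rule prod.cong) (auto simp: S_diff S_S add.commute)
    finally show ?thesis by (simp add: q_def poly_prod)
  qed
  have "S d \<theta>' = (\<Prod>t<e. to_ac c - S (Suc t * d) \<theta>)"
    unfolding S\<theta>' by (simp add: q_def poly_prod add.commute)
  also have "\<dots> = (\<Prod>t\<in>insert e {1..<e}. to_ac c - S (t * d) \<theta>)"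
    by (rule prod.reindex_bij_witness[of _ "\<lambda>i. i - 1" Suc]) (use dp in auto)
  also have "\<dots> = (\<Prod>t\<in>insert 0 {1..<e}. to_ac c - S (t * d) \<theta>)"
    using \<sigma>_order[of \<theta>] by (simp add: e mult.commute)
  also have "insert 0 {1..<e} = {..<e}" using dp by auto
  finally have fix\<theta>': "S d \<theta>' = \<theta>'" by (simp add: \<theta>'_def)
  have "cyclic_extension {x\<in>L. S d x = x} \<sigma> d \<theta>'"
  proof
    show "inj_on (\<lambda>i. S i \<theta>') {..<d}"
    proof (rule inj_onI, rule ccontr)
      fix j j' assume "j \<in> {..<d}" "j' \<in> {..<d}" "S j \<theta>' = S j' \<theta>'" "j \<noteq> j'"
      hence "to_ac c \<in> Z" by (auto simp: Z_def S\<theta>')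
      thus False using c by simp
    qed
  qed (use dp fix\<theta>' \<theta>'L fixed_iff \<sigma>_closed \<sigma>_add \<sigma>_mult in \<open>auto simp: S_add S_mult funpow_swap1[symmetric]\<close>)
  thus ?thesis ..
qed

lemma dim_fixed: "d dvd n \<Longrightarrow> KV.dim {x\<in>L. S d x = x} = d"
  using fixed_field_cyclic cyclic_extension.dim_L by blast

lemma fixed_gcd: "{x\<in>L. S a x = x} = {x\<in>L. S (gcd a n) x = x}"
proof -
  have mul: "S (a * m) x = x" if "S a x = x" for a m x
    using that by (induction m) (simp_all add: funpow_add)
  have "S a x = x" if "S (gcd a n) x = x" for x
  proof -
    obtain m where "a = gcd a n * m" by (metis dvd_def gcd_dvd1)
    thus ?thesis using mul[OF that, of m] by simp
  qed
  moreover have "S (gcd a n) x = x" if x: "x \<in> L" "S a x = x" for x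
  proof (cases "a = 0")
    case True
    thus ?thesis using x by (simp add: \<sigma>_order)
  next
    case False
    then obtain u v where "a * u = n * v + gcd a n" using bezout_nat by blast
    hence "S (n * v + gcd a n) x = x" using mul[OF x(2), of u] by simp
    hence "S (gcd a n) (S (n * v) x) = x" by (simp add: S_S add.commute)
    thus ?thesis using x by (simp add: S_n_mult)
  qed
  ultimately show ?thesis by blast
qed

end


section \<open>The Galois group and the trace\<close>

context cyclic_extension
begin

lemma subfield_L: "subfield L ring_of_type_algebra"
proof -
  let ?R = "ring_of_type_algebra :: 'k alg_closure ring"
  interpret R: field ?R by (rule field_from_type_algebra)
  have minus: "\<ominus>\<^bsub>?R\<^esub> x = - x" for x
    by (rule R.minus_equality) (auto simp: ring_of_type_algebra_def)
  have sub: "subring L ?R"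
    by (rule R.subringI) (auto simp: minus, auto simp: ring_of_type_algebra_def)
  show ?thesis
  proof (rule R.subfieldI'[OF sub])
    fix x assume x: "x \<in> L - {\<zero>\<^bsub>?R\<^esub>}"
    have "inv\<^bsub>?R\<^esub> x = inverse x"
      by (rule R.comm_inv_char) (use x in \<open>auto simp: ring_of_type_algebra_def\<close>)
    thus "inv\<^bsub>?R\<^esub> x \<in> L" using x by simp
  qed
qed

lemma intermediate_field_L: "intermediate_field L"
  using subfield_L by (auto simp: intermediate_field_def)

lemma finite_extension_L: "finite_extension L"
  unfolding finite_extension_def using intermediate_field_L span_powers by blast

lemma ext_degree_L: "ext_degree L = n"
  by (simp add: ext_degree_def dim_L)

sublocale Gal: group "Gal L"
  by (rule group_Gal[OF intermediate_field_L])

text \<open>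
  The elements of the Galois group are undefined outside \<open>L\<close>.
\<close>

definition aut :: "nat \<Rightarrow> 'k alg_closure \<Rightarrow> 'k alg_closure" where
  "aut i = restrict (S i) L"

lemma aut_apply [simp]: "x \<in> L \<Longrightarrow> aut i x = S i x"
  by (simp add: aut_def)

lemma aut_in_Gal [simp, intro]: "aut i \<in> carrier (Gal L)"
proof -
  have "bij_betw (aut i) L L"
  proof (rule bij_betw_byWitness[of _ "S (n * i - i)"])
    show "\<forall>x\<in>L. S (n * i - i) (aut i x) = x" by (simp add: S_inverse_ex)
    show "\<forall>x\<in>L. aut i (S (n * i - i) x) = x"
      by (metis S_S S_closed S_inverse_ex add.commute aut_apply)
  qed auto
  thus ?thesis by (auto simp: Gal_def Bij_def aut_def S_add S_mult)
qed

lemma aut_eq_iff: "aut i = aut j \<longleftrightarrow> [i = j] (mod n)"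
proof
  assume "aut i = aut j"
  hence "S (i mod n) \<theta> = S (j mod n) \<theta>" by (metis S_mod \<theta>_closed aut_apply)
  thus "[i = j] (mod n)" using inj_onD[OF \<theta>_inj, of "i mod n" "j mod n"] n_pos by (simp add: cong_def)
qed (auto simp: aut_def S_cong restrict_def)

text \<open>
  Any \<open>K\<close>-linear map is \<open>y \<mapsto> \<Sum>i<n. a\<^sub>i * \<sigma>\<^sup>i y\<close> by the expansion in dual bases. If it is multiplicative, comparing
  coefficients in \<open>\<phi> (x y) = \<phi> x * \<phi> y\<close> gives \<open>a\<^sub>i * \<sigma>\<^sup>i x = \<phi> x * a\<^sub>i\<close>, so it is \<open>\<sigma>\<^sup>i\<close> for any \<open>i\<close> with \<open>a\<^sub>i \<noteq> 0\<close>.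
\<close>

lemma carrier_Gal: "carrier (Gal L) = aut ` {..<n}"
proof (intro equalityI subsetI)
  fix \<phi> assume \<phi>: "\<phi> \<in> carrier (Gal L)"
  hence B: "\<phi> \<in> extensional L" "\<And>x. x \<in> L \<Longrightarrow> \<phi> x \<in> L"
    by (auto simp: Gal_def Bij_def bij_betw_def)
  have add: "\<phi> (x + y) = \<phi> x + \<phi> y" and mult: "\<phi> (x * y) = \<phi> x * \<phi> y"
    if "x \<in> L" "y \<in> L" for x y using \<phi> that by (auto simp: Gal_def)
  have K: "\<phi> (to_ac c) = to_ac c" for c using \<phi> by (auto simp: Gal_def)
  have sum: "\<phi> (\<Sum>j\<in>A. f j) = (\<Sum>j\<in>A. \<phi> (f j))" if "\<And>j. j \<in> A \<Longrightarrow> f j \<in> L" for f :: "nat \<Rightarrow> _" and A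
    using that
  proof (induction A rule: infinite_finite_induct)
    case (insert j A)
    thus ?case by (simp add: add sum_closed)
  qed (use K[of 0] in auto)
  define a where "a i = (\<Sum>j<n. \<phi> (\<theta> ^ j) * S i (dual j))" for i
  have \<phi>a: "\<phi> y = (\<Sum>i<n. a i * S i y)" if y: "y \<in> L" for y
  proof -
    have "\<phi> y = \<phi> (\<Sum>j<n. Tr (dual j * y) * \<theta> ^ j)" using expansion[OF y] by simp
    also have "\<dots> = (\<Sum>j<n. Tr (dual j * y) * \<phi> (\<theta> ^ j))"
    proof (subst sum)
      have "\<phi> (Tr (dual j * y)) = Tr (dual j * y)" for j
        using Tr_in_K[of "dual j * y"] y K by auto
      thus "(\<Sum>j<n. \<phi> (Tr (dual j * y) * \<theta> ^ j)) = (\<Sum>j<n. Tr (dual j * y) * \<phi> (\<theta> ^ j))"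
        using y by (simp add: mult)
    qed (use y in auto)
    also have "\<dots> = (\<Sum>j<n. \<Sum>i<n. \<phi> (\<theta> ^ j) * S i (dual j) * S i y)"
      using y by (simp add: Tr_def S_mult sum_distrib_left sum_distrib_right mult_ac)
    also have "\<dots> = (\<Sum>i<n. a i * S i y)"
      by (subst sum.swap) (simp add: a_def sum_distrib_right)
    finally show ?thesis .
  qed
  have a_eq: "a i * S i x = \<phi> x * a i" if "x \<in> L" "i < n" for x i
  proof -
    have "(\<Sum>i<n. (a i * S i x - \<phi> x * a i) * S i y) = 0" if y: "y \<in> L" for y
    proof -
      have "(\<Sum>i<n. a i * S i (x * y)) = \<phi> x * (\<Sum>i<n. a i * S i y)"
        using \<phi>a[of "x * y"] \<phi>a[OF y] mult[OF \<open>x \<in> L\<close> y] y \<open>x \<in> L\<close> by simp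
      thus ?thesis using y \<open>x \<in> L\<close>
        by (simp add: S_mult sum_distrib_left left_diff_distrib sum_subtractf mult.assoc)
    qed
    from automorphisms_independent[OF this \<open>i < n\<close>] show ?thesis by simp
  qed
  have "\<exists>i<n. a i \<noteq> 0"
  proof (rule ccontr)
    assume "\<not> ?thesis"
    hence "\<phi> 1 = 0" using \<phi>a[of 1] by simp
    thus False using K[of 1] by simp
  qed
  then obtain i where i: "i < n" "a i \<noteq> 0" by blast
  have "\<phi> = aut i"
  proof
    fix x
    show "\<phi> x = aut i x"
    proof (cases "x \<in> L")
      case True
      thus ?thesis using a_eq[OF True i(1)] i(2) by (simp add: mult.commute)
    next
      case False
      thus ?thesis using B(1) by (simp add: aut_def extensional_def)
    qed
  qed
  thus "\<phi> \<in> aut ` {..<n}" using i by blast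
qed auto

lemma inj_on_aut: "inj_on aut {..<n}"
  by (rule inj_onI) (simp add: aut_eq_iff cong_def)

lemma Gal_mult: "aut i \<otimes>\<^bsub>Gal L\<^esub> aut j = aut (i + j)"
proof -
  have "aut i \<in> Bij L" for i using aut_in_Gal[of i] by (simp add: Gal_def)
  thus ?thesis by (auto simp: Gal_def BijGroup_def compose_def aut_def S_S restrict_def fun_eq_iff)
qed

lemma Gal_one: "\<one>\<^bsub>Gal L\<^esub> = aut 0"
  by (simp add: Gal_def BijGroup_def aut_def restrict_def fun_eq_iff)

lemma aut_pow: "aut 1 [^]\<^bsub>Gal L\<^esub> (i::nat) = aut i"
proof (induction i)
  case 0
  show ?case by (simp only: Gal.nat_pow_0 Gal_one)
next
  case (Suc i)
  show ?case by (simp only: Gal.nat_pow_Suc Suc.IH Gal_mult add.commute plus_1_eq_Suc)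
qed

lemma aut_pow': "aut i [^]\<^bsub>Gal L\<^esub> (m::nat) = aut (i * m)"
  unfolding aut_pow[of i, symmetric] by (subst Gal.nat_pow_pow) (auto simp only: aut_pow aut_in_Gal)

lemma generate_aut: "generate (Gal L) {aut 1} = carrier (Gal L)"
proof
  show "generate (Gal L) {aut 1} \<subseteq> carrier (Gal L)"
    by (rule Gal.generate_incl) auto
  have "aut i \<in> generate (Gal L) {aut 1}" for i
  proof (induction i)
    case 0
    show ?case using generate.one[of "Gal L"] by (simp only: Gal_one)
  next
    case (Suc i)
    have "aut (i + 1) \<in> generate (Gal L) {aut 1}"
      unfolding Gal_mult[symmetric] by (rule generate.eng[OF Suc.IH generate.incl]) simp
    thus ?case by simp
  qed
  thus "carrier (Gal L) \<subseteq> generate (Gal L) {aut 1}" by (auto simp: carrier_Gal)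
qed

lemma ord_aut: "Gal.ord (aut i) = n div gcd i n"
proof -
  have *: "Gal.ord (aut i) dvd m \<longleftrightarrow> n div gcd i n dvd m" for m
  proof -
    have "Gal.ord (aut i) dvd m \<longleftrightarrow> aut (i * m) = aut 0"
      using Gal.pow_eq_id[OF aut_in_Gal, of i m] by (simp only: aut_pow' Gal_one)
    also have "\<dots> \<longleftrightarrow> n dvd i * m" by (simp add: aut_eq_iff cong_0_iff)
    also have "\<dots> \<longleftrightarrow> n div gcd i n dvd m"
    proof -
      define g where "g = gcd i n"
      have g0: "g \<noteq> 0" using n_pos by (simp add: g_def)
      then obtain i' n' where gn: "i = i' * g" "n = n' * g" "coprime i' n'"
        using gcd_coprime_exists[of i n] unfolding g_def by blast
      have "n dvd i * m \<longleftrightarrow> n' dvd i' * m"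
        using g0 by (simp add: gn(1,2) mult.assoc mult.left_commute[of _ g])
      also have "\<dots> \<longleftrightarrow> n' dvd m"
        using gn(3) by (simp add: coprime_dvd_mult_right_iff coprime_commute)
      also have "n' = n div g" using g0 gn(2) by simp
      finally show ?thesis by (simp only: g_def)
    qed
    finally show ?thesis .
  qed
  show ?thesis using *[of "Gal.ord (aut i)"] *[of "n div gcd i n"] by (simp add: dvd_antisym)
qed

lemma trace_eq: "a \<in> L \<Longrightarrow> to_ac (trace L a) = Tr a"
proof -
  assume a: "a \<in> L"
  have "(\<Sum>\<theta>\<in>carrier (Gal L). \<theta> a) = Tr a"
    unfolding carrier_Gal sum.reindex[OF inj_on_aut] using a by (simp add: Tr_def)
  thus ?thesis using Tr_in_K[OF a] by (simp add: trace_def to_ac_of_ac)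
qed

lemma galois_extension_L: "galois_extension L"
proof -
  have "(\<forall>\<phi>\<in>carrier (Gal L). \<phi> x = x) \<longleftrightarrow> x \<in> range to_ac" if "x \<in> L" for x
  proof
    assume "\<forall>\<phi>\<in>carrier (Gal L). \<phi> x = x"
    hence "aut 1 x = x" by blast
    thus "x \<in> range to_ac" using fixed_iff that by simp
  qed (use that in \<open>auto simp: carrier_Gal\<close>)
  thus ?thesis using finite_extension_L by (auto simp: galois_extension_def)
qed

end


section \<open>Skew-forms as twisted polynomials\<close>

global_interpretation FV: vector_space "form_scale :: 'k::field \<Rightarrow> ('a \<Rightarrow> 'a \<Rightarrow> 'k) \<Rightarrow> _"
  by (rule vector_space_form_scale)

lemma dim_zero_subspace: "KV.dim {0} = 0"
  by (rule KV.dim_unique[of "{}"]) (auto simp: KV.independent_empty)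

lemma Alt_add:
  assumes "f \<in> Alt L" "x \<in> L" "y \<in> L" "z \<in> L"
  shows "f (x + y) z = f x z + f y z" "f z (x + y) = f z x + f z y"
  using assms by (auto simp: Alt_def)

lemma Alt_scale:
  assumes "f \<in> Alt L" "x \<in> L" "y \<in> L"
  shows "f (ext_scale c x) y = c * f x y" "f x (ext_scale c y) = c * f x y"
  using assms by (auto simp: Alt_def)

lemma Alt_antisym:
  assumes f: "f \<in> Alt L" and xy: "x \<in> L" "y \<in> L" "x + y \<in> L"
  shows "f x y = - f y x"
proof -
  have "f (x + y) (x + y) = 0" "f x x = 0" "f y y = 0" using f xy by (auto simp: Alt_def)
  thus ?thesis using Alt_add[OF f xy(1,2)] xy by (simp add: eq_neg_iff_add_eq_0 add.commute)
qed

context cyclic_extension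
begin

abbreviation F :: "nat \<Rightarrow> 'k alg_closure \<Rightarrow> 'k alg_closure \<Rightarrow> 'k alg_closure \<Rightarrow> 'k" where
  "F i b \<equiv> skew_form L (aut i) b"

lemma F_apply:
  assumes "b \<in> L" "x \<in> L" "y \<in> L"
  shows "to_ac (F i b x y) = Tr (b * (x * S i y - S i x * y))"
  using assms by (simp add: skew_form_def trace_eq)

lemma F_outside: "x \<notin> L \<or> y \<notin> L \<Longrightarrow> F i b x y = 0"
  by (auto simp: skew_form_def)

lemma form_eqI:
  assumes "\<And>x y. x \<notin> L \<or> y \<notin> L \<Longrightarrow> f x y = g x y"
    and "\<And>x y. x \<in> L \<Longrightarrow> y \<in> L \<Longrightarrow> to_ac (f x y) = (to_ac (g x y) :: 'k alg_closure)"
  shows "f = (g :: 'k alg_closure \<Rightarrow> 'k alg_closure \<Rightarrow> 'k)"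
proof (intro ext)
  fix x y show "f x y = g x y" using assms[of x y] by (cases "x \<in> L \<and> y \<in> L") auto
qed

lemma F_add: "b \<in> L \<Longrightarrow> c \<in> L \<Longrightarrow> F i (b + c) = F i b + F i c"
  by (rule form_eqI) (auto simp: F_outside F_apply Tr_add[symmetric] algebra_simps)

lemma F_scale: "b \<in> L \<Longrightarrow> F i (ext_scale c b) = form_scale c (F i b)"
  by (rule form_eqI)
     (auto simp: F_outside F_apply form_scale_def ext_scale_def Tr_scale[symmetric] mult.assoc)

lemma F_0 [simp]: "F i 0 = 0"
  by (rule form_eqI) (auto simp: F_outside F_apply)

lemma F_sum: "(\<And>j. j \<in> J \<Longrightarrow> b j \<in> L) \<Longrightarrow> F i (\<Sum>j\<in>J. b j) = (\<Sum>j\<in>J. F i (b j))"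
  by (induction J rule: infinite_finite_induct) (auto simp: F_add sum_closed)

lemma sum_form_apply: "(\<Sum>j\<in>J. f j) x y = (\<Sum>j\<in>J. f j x y)"
  by (induction J rule: infinite_finite_induct) auto

lemma F_Alt: assumes b: "b \<in> L" shows "F i b \<in> Alt L"
proof -
  have "F i b (x + y) z = F i b x z + F i b y z" "F i b z (x + y) = F i b z x + F i b z y"
    if "x \<in> L" "y \<in> L" "z \<in> L" for x y z
  proof -
    have "to_ac (F i b (x + y) z) = (to_ac (F i b x z + F i b y z) :: 'k alg_closure)"
      using that b by (simp add: F_apply S_add Tr_add[symmetric] algebra_simps)
    moreover have "to_ac (F i b z (x + y)) = (to_ac (F i b z x + F i b z y) :: 'k alg_closure)"
      using that b by (simp add: F_apply S_add Tr_add[symmetric] algebra_simps)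
    ultimately show "F i b (x + y) z = F i b x z + F i b y z" "F i b z (x + y) = F i b z x + F i b z y"
      by (simp_all only: to_ac_eq_iff)
  qed
  moreover have "F i b (ext_scale c x) y = c * F i b x y" "F i b x (ext_scale c y) = c * F i b x y"
    if "x \<in> L" "y \<in> L" for c x y
  proof -
    have cL: "ext_scale c u \<in> L" if "u \<in> L" for u using that by (simp add: ext_scale_def)
    have "to_ac (F i b (ext_scale c x) y) = (to_ac (c * F i b x y) :: 'k alg_closure)"
      using that b cL by (simp add: F_apply ext_scale_def S_mult Tr_scale[symmetric] algebra_simps)
    moreover have "to_ac (F i b x (ext_scale c y)) = (to_ac (c * F i b x y) :: 'k alg_closure)"
      using that b cL by (simp add: F_apply ext_scale_def S_mult Tr_scale[symmetric] algebra_simps)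
    ultimately show "F i b (ext_scale c x) y = c * F i b x y" "F i b x (ext_scale c y) = c * F i b x y"
      by (simp_all only: to_ac_eq_iff)
  qed
  moreover have "F i b x x = 0" if "x \<in> L" for x
  proof -
    have "to_ac (F i b x x) = (to_ac 0 :: 'k alg_closure)"
      using that b by (simp add: F_apply mult.commute)
    thus ?thesis by (simp only: to_ac_eq_iff)
  qed
  ultimately show ?thesis by (auto simp: Alt_def F_outside)
qed

lemma Tr_S_right:
  assumes "u \<in> L" "x \<in> L" "y \<in> L" "i \<le> n"
  shows "Tr (u * S i x * y) = Tr (x * (S (n - i) u * S (n - i) y))"
proof -
  have "Tr (u * S i x * y) = Tr (S (n - i) (u * S i x * y))" using assms by (simp add: Tr_S)
  also have "S (n - i) (u * S i x * y) = x * (S (n - i) u * S (n - i) y)"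
    using assms by (simp add: S_mult S_S \<sigma>_order mult_ac)
  finally show ?thesis .
qed

text \<open>
  Expanding \<open>x\<close> and \<open>y\<close> in powers of \<open>\<theta>\<close> gives \<open>a\<^sub>i = \<Sum>j k. f(\<theta>\<^sup>j, \<theta>\<^sup>k) * e\<^sub>j * \<sigma>\<^sup>i e\<^sub>k\<close> with the dual basis \<open>e\<close>. The symmetry of
  the \<open>a\<^sub>i\<close> is the antisymmetry of \<open>f\<close> read off from this formula.
\<close>

lemma Alt_imp_trace_form:
  assumes f: "f \<in> Alt L"
  obtains a where "\<And>i. a i \<in> L" "a 0 = 0" "\<And>i. i \<le> n \<Longrightarrow> S i (a (n - i)) = - a i"
    "\<And>x y. x \<in> L \<Longrightarrow> y \<in> L \<Longrightarrow> to_ac (f x y) = Tr (x * (\<Sum>i<n. a i * S i y))"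
proof -
  define c where "c j k = (to_ac (f (\<theta> ^ j) (\<theta> ^ k)) :: 'k alg_closure)" for j k
  define a where "a i = (\<Sum>j<n. \<Sum>k<n. c j k * (dual j * S i (dual k)))" for i
  have cL [simp]: "c j k \<in> L" for j k by (simp add: c_def)
  have Sc [simp]: "S i (c j k) = c j k" for i j k by (simp add: c_def)
  have c_anti: "c j k = - c k j" for j k
    using Alt_antisym[OF f, of "\<theta> ^ j" "\<theta> ^ k"] by (simp add: c_def)
  have aL: "a i \<in> L" for i unfolding a_def by (intro sum_closed) auto
  have anti: "S i (a (n - i)) = - a i" if "i \<le> n" for i
  proof -
    have "S i (a (n - i)) = (\<Sum>j<n. \<Sum>k<n. c j k * (S i (dual j) * dual k))"
      unfolding a_def using that \<sigma>_order
      by (subst S_sum; (intro sum_closed)?; simp add: S_sum S_mult S_S)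
    also have "\<dots> = (\<Sum>k<n. \<Sum>j<n. c j k * (S i (dual j) * dual k))" by (rule sum.swap)
    also have "\<dots> = - a i" unfolding a_def sum_negf[symmetric]
      by (intro sum.cong refl, subst c_anti) (simp add: mult_ac)
    finally show ?thesis .
  qed
  have "a 0 = - a 0"
  proof -
    have "a n = a 0" unfolding a_def by (simp add: \<sigma>_order)
    thus ?thesis using anti[of 0] by simp
  qed
  hence a0: "a 0 = 0" by (simp add: eq_neg_iff_add_eq_0 flip: mult_2)
  have expand: "g (\<Sum>j<n. ext_scale (u j) (\<theta> ^ j)) = (\<Sum>j<n. u j * g (\<theta> ^ j))"
    if add: "\<And>x y. x \<in> L \<Longrightarrow> y \<in> L \<Longrightarrow> g (x + y) = g x + g y"
      and scale: "\<And>c x. x \<in> L \<Longrightarrow> g (ext_scale c x) = c * g x"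
    for u :: "nat \<Rightarrow> 'k" and g
  proof -
    have cl: "ext_scale c x \<in> L" if "x \<in> L" for c x using that by (simp add: ext_scale_def)
    have "g 0 = 0" using scale[OF zero_closed, of 0] by (simp add: ext_scale_def)
    hence "g (\<Sum>j\<in>J. ext_scale (u j) (\<theta> ^ j)) = (\<Sum>j\<in>J. u j * g (\<theta> ^ j))" for J
      by (induction J rule: infinite_finite_induct) (auto simp: add scale cl sum_closed)
    thus ?thesis .
  qed
  have "to_ac (f x y) = Tr (x * (\<Sum>i<n. a i * S i y))" if xy: "x \<in> L" "y \<in> L" for x y
  proof -
    define u where "u z j = trace L (dual j * z)" for z j
    have u: "to_ac (u z j) = Tr (dual j * z)" if "z \<in> L" for z j using that by (simp add: u_def trace_eq)
    have z: "z = (\<Sum>j<n. ext_scale (u z j) (\<theta> ^ j))" if "z \<in> L" for z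
      using expansion[OF that] u[OF that] by (simp add: ext_scale_def)
    have "f x y = (\<Sum>j<n. u x j * f (\<theta> ^ j) y)"
      using expand[of "\<lambda>x. f x y" "u x"] Alt_add(1)[OF f] Alt_scale(1)[OF f] xy z[OF xy(1)] by simp
    also have "\<dots> = (\<Sum>j<n. u x j * (\<Sum>k<n. u y k * f (\<theta> ^ j) (\<theta> ^ k)))"
    proof (intro sum.cong refl arg_cong2[where f = "(*)"])
      fix j
      show "f (\<theta> ^ j) y = (\<Sum>k<n. u y k * f (\<theta> ^ j) (\<theta> ^ k))"
        using expand[of "\<lambda>y. f (\<theta> ^ j) y" "u y"] Alt_add(2)[OF f] Alt_scale(2)[OF f] z[OF xy(2)]
        by simp
    qed
    finally have "to_ac (f x y) = (\<Sum>j<n. \<Sum>k<n. c j k * (Tr (dual j * x) * Tr (dual k * y)))"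
      using xy by (simp add: to_ac_sum u c_def sum_distrib_left mult_ac)
    also have "\<dots> = (\<Sum>j<n. \<Sum>k<n. Tr (c j k * (dual j * x * Tr (dual k * y))))"
    proof (intro sum.cong refl)
      fix j k
      obtain e where e: "Tr (dual k * y) = to_ac e" using Tr_in_K xy by blast
      have "Tr (c j k * (dual j * x * Tr (dual k * y))) = Tr (to_ac (f (\<theta> ^ j) (\<theta> ^ k) * e) * (dual j * x))"
        unfolding e c_def to_ac_mult by (simp only: mult_ac)
      also have "\<dots> = to_ac (f (\<theta> ^ j) (\<theta> ^ k) * e) * Tr (dual j * x)"
        by (rule Tr_scale) (use xy in auto)
      also have "\<dots> = c j k * (Tr (dual j * x) * Tr (dual k * y))"
        unfolding e c_def to_ac_mult by (simp only: mult_ac)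
      finally show "c j k * (Tr (dual j * x) * Tr (dual k * y)) = Tr (c j k * (dual j * x * Tr (dual k * y)))" ..
    qed
    also have "\<dots> = Tr (\<Sum>j<n. \<Sum>k<n. c j k * (dual j * x * Tr (dual k * y)))"
      using xy by (simp add: Tr_sum sum_closed)
    also have "(\<Sum>j<n. \<Sum>k<n. c j k * (dual j * x * Tr (dual k * y)))
        = (\<Sum>j<n. \<Sum>k<n. \<Sum>i<n. x * (c j k * (dual j * S i (dual k)) * S i y))"
      using xy by (simp add: Tr_def S_mult sum_distrib_left mult_ac)
    also have "\<dots> = (\<Sum>j<n. \<Sum>i<n. \<Sum>k<n. x * (c j k * (dual j * S i (dual k)) * S i y))"
      by (intro sum.cong refl sum.swap)
    also have "\<dots> = (\<Sum>i<n. \<Sum>j<n. \<Sum>k<n. x * (c j k * (dual j * S i (dual k)) * S i y))"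
      by (rule sum.swap)
    also have "\<dots> = x * (\<Sum>i<n. a i * S i y)"
      by (simp add: a_def sum_distrib_left sum_distrib_right)
    finally show ?thesis .
  qed
  with aL a0 anti show ?thesis using that by blast
qed

text \<open>
  The terms \<open>i\<close> and \<open>n - i\<close> of the trace form combine to the skew-form of \<open>\<sigma>\<^sup>i\<close>. The middle term is its own
  partner, so its coefficient is halved.
\<close>

lemma Alt_decompose:
  assumes n: "n = 2 * m" and f: "f \<in> Alt L"
  obtains b where "\<And>i. b i \<in> L" "S m (b m) = - b m" "f = (\<Sum>i\<in>{1..m}. F i (b i))"
proof -
  obtain a where aL: "\<And>i. a i \<in> L" and a0: "a 0 = 0" and anti: "\<And>i. i \<le> n \<Longrightarrow> S i (a (n - i)) = - a i"
    and fa: "\<And>x y. x \<in> L \<Longrightarrow> y \<in> L \<Longrightarrow> to_ac (f x y) = Tr (x * (\<Sum>i<n. a i * S i y))"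
    using Alt_imp_trace_form[OF f] by blast
  have m: "m > 0" using n n_pos by simp
  define half :: "'k alg_closure" where "half = to_ac (1 / 2)"
  have half: "half \<in> L" "S i half = half" "half + half = 1" for i
  proof -
    show "half \<in> L" "S i half = half" unfolding half_def by (rule K_closed, rule S_to_ac)
    have "half + half = to_ac (1 / 2 + 1 / 2)" unfolding half_def to_ac_add ..
    also have "(1 / 2 + 1 / 2 :: 'k) = 1" by simp
    finally show "half + half = 1" by simp
  qed
  have Tr_half: "Tr (half * u) = half * Tr u" if "u \<in> L" for u
    unfolding half_def by (rule Tr_scale[OF that])
  define b where "b i = (if i = m then half * a m else a i)" for i
  have bL: "b i \<in> L" for i using aL half by (simp add: b_def)
  have "f = (\<Sum>i\<in>{1..m}. F i (b i))"
  proof (rule form_eqI)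
    fix x y assume "x \<notin> L \<or> y \<notin> L"
    thus "f x y = (\<Sum>i\<in>{1..m}. F i (b i)) x y"
      using f by (auto simp: sum_form_apply F_outside Alt_def)
  next
    fix x y assume xy: "x \<in> L" "y \<in> L"
    define T where "T i = Tr (x * (a i * S i y))" for i
    have T2: "Tr (a i * S i x * y) = - T (n - i)" if "i \<le> n" for i
    proof -
      have "S (n - i) (a i) = - a (n - i)" using anti[of "n - i"] that by simp
      thus ?thesis using xy aL that by (simp add: Tr_S_right T_def Tr_minus)
    qed
    have FT: "Tr (a i * (x * S i y - S i x * y)) = T i + T (n - i)" if "i \<le> n" for i
    proof -
      have "Tr (a i * (x * S i y - S i x * y)) = Tr (x * (a i * S i y) - a i * S i x * y)"
        by (simp add: algebra_simps)
      also have "\<dots> = T i + T (n - i)" using xy aL T2[OF that] by (subst Tr_diff) (auto simp: T_def)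
      finally show ?thesis .
    qed
    have "to_ac (f x y) = (\<Sum>i<n. T i)"
      using xy aL by (simp add: fa sum_distrib_left Tr_sum T_def)
    also have "{..<n} = insert 0 ({1..<m} \<union> (insert m {m+1..<n}))" using n m by auto
    also have "sum T \<dots> = T 0 + ((\<Sum>i\<in>{1..<m}. T i) + (T m + (\<Sum>i\<in>{m+1..<n}. T i)))"
      by (subst sum.insert, simp, use m in simp, subst sum.union_disjoint) (auto simp: disjoint_iff)
    also have "T 0 = 0" by (simp add: T_def a0)
    also have "(\<Sum>i\<in>{m+1..<n}. T i) = (\<Sum>i\<in>{1..<m}. T (n - i))"
      by (rule sum.reindex_bij_witness[of _ "\<lambda>i. n - i" "\<lambda>i. n - i"]) (use n in auto)
    finally have "to_ac (f x y) = (\<Sum>i\<in>{1..<m}. T i + T (n - i)) + T m" by (simp add: sum.distrib)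
    also have "(\<Sum>i\<in>{1..<m}. T i + T (n - i)) = (\<Sum>i\<in>{1..<m}. to_ac (F i (b i) x y))"
    proof (intro sum.cong refl)
      fix i assume i: "i \<in> {1..<m}"
      show "T i + T (n - i) = to_ac (F i (b i) x y)"
        using FT[of i] i n xy aL by (simp add: F_apply b_def)
    qed
    also have "T m = to_ac (F m (b m) x y)"
    proof -
      have "to_ac (F m (b m) x y) = Tr (half * (a m * (x * S m y - S m x * y)))"
        using xy aL half by (simp add: F_apply b_def mult.assoc)
      also have "\<dots> = half * (T m + T m)"
        using xy aL FT[of m] n by (subst Tr_half) auto
      also have "\<dots> = (half + half) * T m" by (simp add: algebra_simps)
      finally show ?thesis by (simp add: half)
    qed
    also have "(\<Sum>i\<in>{1..<m}. to_ac (F i (b i) x y)) + to_ac (F m (b m) x y)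
        = to_ac (\<Sum>i\<in>insert m {1..<m}. F i (b i) x y)" by (simp add: to_ac_sum add.commute)
    also have "insert m {1..<m} = {1..m}" using m by auto
    finally show "to_ac (f x y) = (to_ac ((\<Sum>i\<in>{1..m}. F i (b i)) x y) :: 'k alg_closure)"
      by (simp add: sum_form_apply)
  qed
  moreover have "S m (b m) = - b m" using anti[of m] n aL half by (simp add: b_def S_mult)
  ultimately show ?thesis using that bL by blast
qed

text \<open>
  Written as one trace form, the sum has coefficient \<open>b\<^sub>i\<close> at \<open>\<sigma>\<^sup>i\<close> for \<open>0 < i < m\<close> and \<open>b\<^sub>m - \<sigma>\<^sup>m b\<^sub>m = 2 b\<^sub>m\<close> at \<open>\<sigma>\<^sup>m\<close>;
  these vanish by the independence of automorphisms.
\<close>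

lemma F_unique:
  assumes n: "n = 2 * m" and b: "\<And>i. i \<in> {1..m} \<Longrightarrow> b i \<in> L" and bm: "S m (b m) = - b m"
    and 0: "(\<Sum>i\<in>{1..m}. F i (b i)) = 0" and i: "i \<in> {1..m}"
  shows "b i = 0"
proof -
  have m: "m > 0" using n n_pos by simp
  define a where "a i = (if i = 0 then 0 else if i < m then b i
      else if i = m then b m - S m (b m) else - S i (b (n - i)))" for i
  have "(\<Sum>i<n. a i * S i y) = 0" if y: "y \<in> L" for y
  proof (rule Tr_nondegenerate)
    have aL: "a i \<in> L" if "i < n" for i
    proof -
      have "n - i \<in> {1..m}" if "i > m" using n \<open>i < n\<close> that by auto
      thus ?thesis using b m by (auto simp: a_def not_less_iff_gr_or_eq)
    qed
    show "(\<Sum>i<n. a i * S i y) \<in> L" using aL y by (intro sum_closed) auto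
    fix x assume x: "x \<in> L"
    define T where "T i = x * (b i * S i y)" for i
    define T' where "T' i = x * (S (n - i) (b i) * S (n - i) y)" for i
    have TL: "T i \<in> L" "T' i \<in> L" if "i \<in> {1..m}" for i using b[OF that] x y by (auto simp: T_def T'_def)
    have FT: "to_ac (F i (b i) x y) = Tr (T i - T' i)" if "i \<in> {1..m}" for i
    proof -
      have "to_ac (F i (b i) x y) = Tr (T i - b i * S i x * y)"
        using b[OF that] x y by (simp add: F_apply T_def algebra_simps)
      also have "\<dots> = Tr (T i) - Tr (b i * S i x * y)"
        using b[OF that] x y TL[OF that] by (intro Tr_diff) auto
      also have "Tr (b i * S i x * y) = Tr (T' i)"
        unfolding T'_def using b[OF that] x y that n by (intro Tr_S_right) auto
      finally show ?thesis using TL[OF that] by (simp add: Tr_diff)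
    qed
    have "x * (\<Sum>i<n. a i * S i y) = (\<Sum>i<n. x * (a i * S i y))" by (simp add: sum_distrib_left)
    also have "\<dots> = (\<Sum>i\<in>insert 0 ({1..<m} \<union> (insert m {m+1..<n})). x * (a i * S i y))"
      by (rule sum.cong) (use n m in auto)
    also have "\<dots> = (\<Sum>i\<in>{1..<m}. x * (a i * S i y))
        + (x * (a m * S m y) + (\<Sum>i\<in>{m+1..<n}. x * (a i * S i y)))"
      by (subst sum.insert, simp, use m in simp, subst sum.union_disjoint) (auto simp: a_def disjoint_iff)
    also have "(\<Sum>i\<in>{m+1..<n}. x * (a i * S i y)) = (\<Sum>i\<in>{1..<m}. - T' i)"
      by (rule sum.reindex_bij_witness[of _ "\<lambda>i. n - i" "\<lambda>i. n - i"]) (use n in \<open>auto simp: T'_def a_def\<close>)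
    also have "(\<Sum>i\<in>{1..<m}. x * (a i * S i y)) = (\<Sum>i\<in>{1..<m}. T i)"
      by (rule sum.cong) (auto simp: T_def a_def)
    also have "x * (a m * S m y) = T m - T' m"
      using m n by (simp add: a_def T_def T'_def algebra_simps)
    finally have "x * (\<Sum>i<n. a i * S i y) = (\<Sum>i\<in>insert m {1..<m}. T i - T' i)"
      by (simp add: sum_subtractf sum_negf)
    also have "insert m {1..<m} = {1..m}" using m by auto
    finally have "Tr (x * (\<Sum>i<n. a i * S i y)) = Tr (\<Sum>i\<in>{1..m}. T i - T' i)" by (rule arg_cong)
    also have "\<dots> = (\<Sum>i\<in>{1..m}. Tr (T i - T' i))"
      by (rule Tr_sum) (intro diff_closed TL)
    also have "\<dots> = to_ac ((\<Sum>i\<in>{1..m}. F i (b i)) x y)"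
      by (simp only: sum_form_apply to_ac_sum FT cong: sum.cong)
    finally show "Tr (x * (\<Sum>i<n. a i * S i y)) = 0" unfolding 0 by simp
  qed
  hence a0: "a i = 0" using automorphisms_independent[of a i] i n n_pos by auto
  show ?thesis
  proof (cases "i = m")
    case True
    hence "b m + b m = 0" using a0 m bm by (simp add: a_def)
    thus ?thesis using True by (simp flip: mult_2)
  next
    case False
    thus ?thesis using a0 i by (simp add: a_def)
  qed
qed

lemma F_eq_0_imp:
  assumes n: "n = 2 * m" and i: "0 < i" "i < m" and b: "b \<in> L" "F i b = 0"
  shows "b = 0"
proof -
  define b' where "b' j = (if j = i then b else 0)" for j
  have "(\<Sum>j\<in>{1..m}. F j (b' j)) = (\<Sum>j\<in>{i}. F j (b' j))"
    by (rule sum.mono_neutral_right) (use i in \<open>auto simp: b'_def\<close>)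
  hence "b' i = 0" using i b by (intro F_unique[OF n]) (auto simp: b'_def)
  thus ?thesis by (simp add: b'_def)
qed

lemma subspace_L_subset: "KV.subspace Y \<Longrightarrow> Y \<subseteq> L \<Longrightarrow> \<exists>B. finite B \<and> Y \<subseteq> KV.span B"
  using span_powers by (intro exI[of _ "(\<lambda>j. \<theta> ^ j) ` {..<n}"]) auto

lemma subspace_F_image:
  assumes Y: "KV.subspace Y" "Y \<subseteq> L"
  shows "FV.subspace (F i ` Y)"
proof (rule FV.subspaceI)
  show "0 \<in> F i ` Y" using KV.subspace_0[OF Y(1)] by (intro image_eqI[of _ _ 0]) auto
next
  fix f g assume "f \<in> F i ` Y" "g \<in> F i ` Y"
  then obtain b c where bc: "b \<in> Y" "c \<in> Y" "f = F i b" "g = F i c" by blast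
  have "b \<in> L" "c \<in> L" using bc Y by auto
  hence "f + g = F i (b + c)" using bc by (simp add: F_add)
  thus "f + g \<in> F i ` Y" using KV.subspace_add[OF Y(1) bc(1,2)] by blast
next
  fix c f assume "f \<in> F i ` Y"
  then obtain b where b: "b \<in> Y" "f = F i b" by blast
  hence "b \<in> L" using Y by auto
  hence "form_scale c f = F i (ext_scale c b)" using b by (simp add: F_scale)
  thus "form_scale c f \<in> F i ` Y" using KV.subspace_scale[OF Y(1) b(1)] by blast
qed

lemma form_dim_F_image:
  assumes n: "n = 2 * m" and i: "0 < i" "i < m" and Y: "KV.subspace Y" "Y \<subseteq> L"
  shows "form_dim (F i ` Y) = KV.dim Y"
proof -
  obtain B where B: "finite B" "Y \<subseteq> KV.span B" using subspace_L_subset Y by blast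
  have "KV.dim Y = FV.dim (F i ` Y) + KV.dim {b\<in>Y. F i b = 0}"
    by (rule rank_nullity[OF vector_space_ext_scale vector_space_form_scale Y(1) B])
       (use Y in \<open>auto simp: F_add F_scale subset_iff\<close>)
  also have "{b\<in>Y. F i b = 0} = {0}" using F_eq_0_imp[OF n i] Y KV.subspace_0[OF Y(1)] by auto
  also have "KV.dim {0} = 0"  by (rule dim_zero_subspace)
  finally show ?thesis by (simp add: form_dim_def)
qed

text \<open>
  \<open>f(x, y) = Tr (y * (\<tau>\<^bsup>-1\<^esup>(b x) - b * \<tau> x))\<close>, and the trace form is nondegenerate.
\<close>

lemma F_radical_iff:
  assumes b: "b \<in> L" and x: "x \<in> L"
  shows "F i b x = 0 \<longleftrightarrow> b * x = S i b * S (2 * i) x"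
proof -
  define j where "j = n * i - i"
  have ji: "S j (S i u) = u" "S i (S j u) = u" if "u \<in> L" for u
    using S_inverse_ex[OF that, of i] by (simp_all add: j_def S_S add.commute)
  have Tr: "to_ac (F i b x y) = Tr (y * (S j (b * x) - b * S i x))" if y: "y \<in> L" for y
  proof -
    have "to_ac (F i b x y) = Tr (b * x * S i y - y * (b * S i x))"
      using b x y by (simp add: F_apply algebra_simps)
    also have "\<dots> = Tr (S j (b * x * S i y)) - Tr (y * (b * S i x))"
      using b x y by (simp add: Tr_diff Tr_S)
    also have "\<dots> = Tr (y * (S j (b * x) - b * S i x))"
      using b x y ji by (simp add: Tr_diff[symmetric] S_mult algebra_simps)
    finally show ?thesis .
  qed
  have "F i b x = 0 \<longleftrightarrow> (\<forall>y\<in>L. to_ac (F i b x y) = (0 :: 'k alg_closure))"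
    by (auto simp: fun_eq_iff F_outside)
  also have "\<dots> \<longleftrightarrow> S j (b * x) = b * S i x"
    using Tr_nondegenerate[of "S j (b * x) - b * S i x"] b x by (auto simp: Tr)
  also have "\<dots> \<longleftrightarrow> b * x = S i b * S (2 * i) x"
  proof
    assume "S j (b * x) = b * S i x"
    hence "S i (S j (b * x)) = S i (b * S i x)" by simp
    thus "b * x = S i b * S (2 * i) x" using b x ji by (simp add: S_mult S_S mult_2)
  next
    assume "b * x = S i b * S (2 * i) x"
    hence "b * x = S i (b * S i x)" using b x by (simp add: S_mult S_S mult_2)
    hence "S j (b * x) = S j (S i (b * S i x))" by simp
    thus "S j (b * x) = b * S i x" using ji(1)[of "b * S i x"] b x by simp
  qed
  finally show ?thesis .
qed

lemma form_rank_F: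
  assumes b: "b \<in> L"
  shows "form_rank L (F i b) + KV.dim {x\<in>L. b * x = S i b * S (2 * i) x} = n"
proof -
  obtain B where B: "finite B" "L \<subseteq> KV.span B" using subspace_L_subset[OF subspace_L] by blast
  have FA: "F i b \<in> Alt L" using b by (rule F_Alt)
  have "KV.dim L = vector_space.dim functional_scale (F i b ` L) + KV.dim {x\<in>L. F i b x = 0}"
  proof (rule rank_nullity[OF vector_space_ext_scale vector_space_functional_scale subspace_L B])
    fix x y assume xy: "x \<in> L" "y \<in> L"
    show "F i b (x + y) = F i b x + F i b y"
    proof
      fix z show "F i b (x + y) z = (F i b x + F i b y) z"
        using Alt_add(1)[OF FA xy, of z] by (cases "z \<in> L") (auto simp: F_outside)
    qed
  next
    fix c x assume x: "x \<in> L"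
    show "F i b (ext_scale c x) = functional_scale c (F i b x)"
    proof
      fix z show "F i b (ext_scale c x) z = functional_scale c (F i b x) z"
        using Alt_scale(1)[OF FA x, of z] by (cases "z \<in> L") (auto simp: F_outside functional_scale_def)
    qed
  qed
  also have "{x\<in>L. F i b x = 0} = {x\<in>L. b * x = S i b * S (2 * i) x}" using F_radical_iff[OF b] by auto
  finally show ?thesis by (simp add: form_rank_def dim_L)
qed

end


section \<open>Eigenspaces and the ranks of their forms\<close>

lemma div_power_Suc_double:
  fixes a :: nat
  assumes "2 ^ Suc s dvd a"
  shows "a div 2 ^ s = a div 2 ^ Suc s + a div 2 ^ Suc s"
  using assms by (auto elim!: dvdE)

context cyclic_extension
begin

definition Eig :: "'k alg_closure \<Rightarrow> nat \<Rightarrow> 'k alg_closure set" where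
  "Eig \<epsilon> s = {x\<in>L. S (n div 2 ^ s) x = \<epsilon> * x}"

abbreviation P :: "nat \<Rightarrow> 'k alg_closure set" where "P \<equiv> Eig 1"
abbreviation N :: "nat \<Rightarrow> 'k alg_closure set" where "N \<equiv> Eig (- 1)"

lemma Eig_subset: "Eig \<epsilon> s \<subseteq> L" by (auto simp: Eig_def)

lemma Eig_L: "x \<in> Eig \<epsilon> s \<Longrightarrow> x \<in> L" by (simp add: Eig_def)

lemma subspace_Eig: "KV.subspace (Eig \<epsilon> s)"
  by (rule subspace_ext_scale) (auto simp: Eig_def S_add S_mult algebra_simps)

lemma P_0: "P 0 = L" using \<sigma>_order by (auto simp: Eig_def)

lemma dim_P:
  assumes "2 ^ s dvd n"
  shows "KV.dim (P s) = n div 2 ^ s"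
proof -
  have "n div 2 ^ s dvd n" using assms by (metis dvd_div_mult_self dvd_triv_left)
  thus ?thesis using dim_fixed by (simp add: Eig_def)
qed

lemma P_Suc_cases:
  assumes s: "2 ^ Suc s dvd n"
  shows "P (Suc s) \<subseteq> P s" "N (Suc s) \<subseteq> P s"
    and "x \<in> P s \<Longrightarrow> x - S (n div 2 ^ Suc s) x \<in> N (Suc s)"
    and "x \<in> P s \<Longrightarrow> x + S (n div 2 ^ Suc s) x \<in> P (Suc s)"
proof -
  define h where "h = n div 2 ^ Suc s"
  have h: "n div 2 ^ s = h + h" unfolding h_def by (rule div_power_Suc_double[OF s])
  have E: "Eig \<epsilon> (Suc s) = {x\<in>L. S h x = \<epsilon> * x}" "Eig \<epsilon> s = {x\<in>L. S h (S h x) = \<epsilon> * x}" for \<epsilon>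
    by (simp_all only: Eig_def h S_S) (simp only: h_def)
  show "P (Suc s) \<subseteq> P s" unfolding E by auto
  show "N (Suc s) \<subseteq> P s" unfolding E by (auto simp: S_minus)
  show "x - S (n div 2 ^ Suc s) x \<in> N (Suc s)" if "x \<in> P s"
    using that unfolding E h_def[symmetric] by (auto simp: S_diff)
  show "x + S (n div 2 ^ Suc s) x \<in> P (Suc s)" if "x \<in> P s"
    using that unfolding E h_def[symmetric] by (auto simp: S_add)
qed

text \<open>
  \<open>P\<^bsub>s-1\<^esub>\<close> has twice the dimension of \<open>P\<^sub>s\<close>; an element \<open>x\<close> in the difference yields \<open>x - \<sigma>\<^bsup>n/2^s\<^esup> x\<close>.
\<close>

lemma N_nonzero:
  assumes s: "2 ^ s dvd n" "s > 0"
  obtains u where "u \<in> N s" "u \<noteq> 0"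
proof -
  obtain t where t: "s = Suc t" using s by (cases s) auto
  have tn: "2 ^ t dvd n" using s(1) by (simp add: t dvd_mult_right)
  have "n div 2 ^ s > 0" using s(1) n_pos by (auto elim!: dvdE)
  hence "KV.dim (P t) \<noteq> KV.dim (P s)"
    using dim_P[OF s(1)] dim_P[OF tn] div_power_Suc_double[of t n] s(1) by (simp add: t)
  hence "P t \<noteq> P s" by auto
  then obtain x where x: "x \<in> P t" "x \<notin> P s" using P_Suc_cases(1)[of t] s(1) unfolding t by blast
  have "x - S (n div 2 ^ s) x \<in> N s" using P_Suc_cases(3)[of t x] x s(1) by (simp add: t)
  moreover have "x - S (n div 2 ^ s) x \<noteq> 0" using x by (auto simp: Eig_def)
  ultimately show ?thesis by (rule that)
qed

lemma dim_mult_image: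
  assumes u: "u \<noteq> 0" and Y: "KV.subspace Y" "Y \<subseteq> L"
  shows "KV.dim ((\<lambda>x. u * x) ` Y) = KV.dim Y"
proof -
  obtain B where B: "finite B" "Y \<subseteq> KV.span B" using subspace_L_subset[OF Y] by blast
  have "KV.dim Y = KV.dim ((\<lambda>x. u * x) ` Y) + KV.dim {x\<in>Y. u * x = 0}"
    by (rule rank_nullity[OF vector_space_ext_scale vector_space_ext_scale Y(1) B])
       (auto simp: algebra_simps ext_scale_def)
  also have "{x\<in>Y. u * x = 0} = {0}" using u KV.subspace_0[OF Y(1)] by auto
  also have "KV.dim {0} = 0" by (rule dim_zero_subspace)
  finally show ?thesis by simp
qed

text \<open>
  A nonzero \<open>u\<close> in \<open>N\<^sub>s\<close> gives \<open>N\<^sub>s = u P\<^sub>s\<close>.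
\<close>

lemma dim_N:
  assumes s: "2 ^ s dvd n" "s > 0"
  shows "KV.dim (N s) = n div 2 ^ s"
proof -
  obtain u where u: "u \<in> N s" "u \<noteq> 0" using N_nonzero[OF s] .
  have "N s = (\<lambda>x. u * x) ` P s"
  proof (intro equalityI subsetI)
    fix x assume x: "x \<in> N s"
    have "x / u \<in> P s" using x u by (auto simp: Eig_def S_divide)
    thus "x \<in> (\<lambda>x. u * x) ` P s" using u by (intro image_eqI[of _ _ "x / u"]) auto
  qed (use u in \<open>auto simp: Eig_def S_mult\<close>)
  thus ?thesis using dim_mult_image[OF u(2) subspace_Eig Eig_subset] dim_P[OF s(1)] by simp
qed

text \<open>
  With \<open>\<tau> = \<sigma>\<^sup>i\<close> this is the product of \<open>v, \<tau>\<^sup>2 v, \<dots>, \<tau>\<^bsup>2(r-1)\<^esup> v\<close>. Applying \<open>\<tau>\<^sup>2\<close> exchanges the factor \<open>v\<close> for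
  \<open>\<tau>\<^bsup>2r\<^esup> v\<close>; for \<open>r = ord \<tau> / 2\<close> it is the norm along \<open>\<tau>\<^sup>2\<close>.
\<close>

definition even_orbit_prod :: "nat \<Rightarrow> nat \<Rightarrow> 'k alg_closure \<Rightarrow> 'k alg_closure" where
  "even_orbit_prod i r v = (\<Prod>t<r. S (2 * i * t) v)"

lemma even_orbit_prod_closed [simp, intro]: "v \<in> L \<Longrightarrow> even_orbit_prod i r v \<in> L"
  unfolding even_orbit_prod_def by (intro prod_closed) auto

lemma even_orbit_prod_nonzero: "v \<in> L \<Longrightarrow> v \<noteq> 0 \<Longrightarrow> even_orbit_prod i r v \<noteq> 0"
  by (simp add: even_orbit_prod_def)

lemma S_even_orbit_prod: "v \<in> L \<Longrightarrow> S j (even_orbit_prod i r v) = (\<Prod>t<r. S (j + 2 * i * t) v)"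
  unfolding even_orbit_prod_def by (subst S_prod) (auto simp: S_S)

lemma even_orbit_prod_S: "v \<in> L \<Longrightarrow> even_orbit_prod i r (S j v) = S j (even_orbit_prod i r v)"
  by (simp add: S_even_orbit_prod) (simp add: even_orbit_prod_def S_S add.commute)

lemma even_orbit_prod_mult: "u \<in> L \<Longrightarrow> v \<in> L \<Longrightarrow> even_orbit_prod i r (u * v) = even_orbit_prod i r u * even_orbit_prod i r v"
  by (simp add: even_orbit_prod_def S_mult prod.distrib)

lemma even_orbit_prod_shift: "v \<in> L \<Longrightarrow> S (2 * i) (even_orbit_prod i r v) * v = even_orbit_prod i r v * S (2 * i * r) v"
proof -
  assume v: "v \<in> L"
  have "S (2 * i) (even_orbit_prod i r v) * v = v * (\<Prod>t<r. S (2 * i * Suc t) v)"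
    using v by (simp add: S_even_orbit_prod mult.commute)
  also have "\<dots> = (\<Prod>t<Suc r. S (2 * i * t) v)" by (subst prod.lessThan_Suc_shift) simp
  finally show ?thesis by (simp add: even_orbit_prod_def)
qed

lemma even_orbit_prod_add: "v \<in> L \<Longrightarrow> even_orbit_prod i (q + r) v = even_orbit_prod i q v * S (2 * i * q) (even_orbit_prod i r v)"
  by (induction r) (simp_all add: even_orbit_prod_def S_mult S_S prod_closed algebra_simps)

lemma even_orbit_prod_norm: "v \<in> L \<Longrightarrow> n dvd 2 * i * r \<Longrightarrow> S (2 * i) (even_orbit_prod i r v) = even_orbit_prod i r v"
proof (cases "v = 0")
  case False
  assume v: "v \<in> L" and "n dvd 2 * i * r"
  then obtain q where "2 * i * r = n * q" by (auto simp: dvd_def)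
  hence "S (2 * i * r) v = v" using v by (simp add: S_n_mult)
  thus ?thesis using even_orbit_prod_shift[OF v, of i r] False by simp
qed (simp add: even_orbit_prod_def power_0_left)

lemma S_mult_eigen:
  assumes "x \<in> L" "S h x = \<epsilon> * x" "\<epsilon> = 1 \<or> \<epsilon> = - 1"
  shows "S (h * q) x = \<epsilon> ^ q * x"
proof (induction q)
  case (Suc q)
  have "S (h * Suc q) x = S h (\<epsilon> ^ q * x)" by (simp add: Suc.IH[symmetric] S_S)
  also have "\<dots> = \<epsilon> ^ q * S h x"
  proof -
    have "\<epsilon> ^ q = 1 \<or> \<epsilon> ^ q = - 1" using assms(3) by (auto simp: minus_one_power_iff split: if_splits)
    thus ?thesis using assms(1) by (auto simp: S_minus)
  qed
  finally show ?case using assms(2) by simp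
qed simp

text \<open>
  Since \<open>i / gcd(i, n)\<close> is odd, \<open>\<tau>\<^bsup>ord \<tau> / 2^s\<^esup>\<close> is an odd power of \<open>\<sigma>\<^bsup>n/2^s\<^esup>\<close>; it therefore acts on \<open>Eig \<epsilon> s\<close>
  as multiplication by \<open>\<epsilon>\<close>. This is how the eigenspaces enter the computation of ranks.
\<close>

lemma order_data:
  assumes ord: "n div gcd i n = 2 ^ \<beta> * k" and k: "odd k" and \<beta>: "\<beta> > 0"
  obtains i' where "odd i'" "2 ^ \<beta> dvd n" "\<And>s. s \<le> \<beta> \<Longrightarrow> i * (2 ^ (\<beta> - s) * k) = n div 2 ^ s * i'"
    "gcd (2 * i) n = 2 * n div (2 ^ \<beta> * k)" "n dvd i * (2 ^ \<beta> * k)"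
proof -
  define g where "g = gcd i n"
  have g0: "g \<noteq> 0" using n_pos by (simp add: g_def)
  then obtain i' n' where gn: "i = i' * g" "n = n' * g" "coprime i' n'"
    using gcd_coprime_exists[of i n] unfolding g_def by blast
  have "n div g = n'" using gn(2) g0 by simp
  hence n': "n' = 2 ^ \<beta> * k" using ord unfolding g_def by simp
  have "even n'" using \<beta> by (simp add: n')
  hence i': "odd i'" using gn(3) by (metis coprime_common_divisor_nat dvd_refl odd_one coprime_def even_mult_iff dvd_trans)
  have nb: "n = 2 ^ \<beta> * (k * g)" by (simp add: gn(2) n' mult_ac)
  show ?thesis
  proof
    show "odd i'" by fact
    show "2 ^ \<beta> dvd n" by (simp add: nb)
    show "i * (2 ^ (\<beta> - s) * k) = n div 2 ^ s * i'" if "s \<le> \<beta>" for s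
    proof -
      have "(2::nat) ^ \<beta> = 2 ^ s * 2 ^ (\<beta> - s)" using that by (simp flip: power_add)
      hence "n = 2 ^ s * (2 ^ (\<beta> - s) * (k * g))" by (simp add: nb)
      hence "n div 2 ^ s = 2 ^ (\<beta> - s) * (k * g)" by simp
      thus ?thesis by (simp add: gn(1) mult_ac)
    qed
    obtain n'' where n'': "n' = 2 * n''" using \<open>even n'\<close> by blast
    have "gcd (2 * i) n = gcd (2 * g * i') (2 * g * n'')" by (simp only: gn(1,2) n'' mult_ac)
    also have "\<dots> = 2 * g * gcd i' n''" by (rule gcd_mult_distrib_nat[symmetric])
    finally have "gcd (2 * i) n = 2 * g * gcd i' n''" .
    moreover have "gcd i' n'' = 1" using gn(3) by (simp add: n'')
    moreover have "2 * n div (2 ^ \<beta> * k) = 2 * g"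
    proof -
      have "n' > 0" using n_pos gn(2) by (cases n') auto
      moreover have "2 * n = n' * (2 * g)" by (simp add: gn(2))
      ultimately show ?thesis by (simp only: n'[symmetric]) simp
    qed
    ultimately show "gcd (2 * i) n = 2 * n div (2 ^ \<beta> * k)" by simp
    show "n dvd i * (2 ^ \<beta> * k)" by (simp add: n'[symmetric] gn(1,2))
  qed
qed

text \<open>
  Take square roots of 1 repeatedly: the first result other than 1 is \<open>-1\<close>, which has no square root in \<open>L\<close>.
\<close>

lemma root_of_unity_sign:
  assumes no_i: "\<And>w. w \<in> L \<Longrightarrow> w\<^sup>2 \<noteq> - 1"
  shows "z \<in> L \<Longrightarrow> z ^ (2 ^ s) = 1 \<Longrightarrow> z = 1 \<or> z = - 1"
proof (induction s)
  case (Suc s)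
  have "(z ^ (2 ^ s))\<^sup>2 = 1" using Suc.prems(2) by (simp add: power_mult[symmetric] mult.commute)
  hence "z ^ (2 ^ s) = 1 \<or> z ^ (2 ^ s) = - 1" by (rule power2_eq_1_iff[THEN iffD1])
  thus ?case
  proof
    assume *: "z ^ (2 ^ s) = - 1"
    show ?thesis
    proof (cases s)
      case (Suc t)
      have "(z ^ (2 ^ t))\<^sup>2 = - 1" using * by (simp add: Suc power_mult[symmetric] mult.commute)
      thus ?thesis using no_i[of "z ^ (2 ^ t)"] Suc.prems(1) by simp
    qed (use * in simp)
  qed (use Suc in simp)
qed simp

text \<open>
  Take norms along \<open>\<tau>\<^sup>2\<close> of both sides of the equation for the radical; the norm of \<open>x\<close> cancels.
\<close>

lemma radical_norm:
  assumes b: "b \<in> L" and x: "x \<in> L" "x \<noteq> 0" and eq: "b * x = S i b * S (2 * i) x"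
    and r: "n dvd 2 * i * r"
  shows "S i (even_orbit_prod i r b) = even_orbit_prod i r b"
proof -
  have "even_orbit_prod i r b * even_orbit_prod i r x = even_orbit_prod i r (S i b * S (2 * i) x)"
    using b x by (simp add: eq[symmetric] even_orbit_prod_mult)
  also have "\<dots> = S i (even_orbit_prod i r b) * S (2 * i) (even_orbit_prod i r x)"
    using b x by (simp add: even_orbit_prod_mult even_orbit_prod_S)
  also have "S (2 * i) (even_orbit_prod i r x) = even_orbit_prod i r x" using x r by (intro even_orbit_prod_norm)
  finally show ?thesis using even_orbit_prod_nonzero[OF x] by simp
qed

text \<open>
  The norm \<open>M\<close> of \<open>b\<close> has an odd number \<open>k\<close> of factors, each negated by \<open>\<tau>\<^sup>k\<close>, so \<open>\<tau>\<^sup>k M = - M\<close> contradicts \<open>\<tau> M = M\<close>.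
\<close>

lemma N_1_nondegenerate:
  assumes ord: "n div gcd i n = 2 * k" and k: "odd k"
    and b: "b \<in> N 1" "b \<noteq> 0" and x: "x \<in> L" and eq: "b * x = S i b * S (2 * i) x"
  shows "x = 0"
proof (rule ccontr)
  assume x0: "x \<noteq> 0"
  obtain i' where i': "odd i'" "\<And>s. s \<le> 1 \<Longrightarrow> i * (2 ^ (1 - s) * k) = n div 2 ^ s * i'"
    and nd: "n dvd i * (2 ^ 1 * k)"
    using order_data[of i 1 k] ord k by auto
  have nd: "n dvd 2 * i * k" using nd by (simp add: mult_ac)
  define M where "M = even_orbit_prod i k b"
  have bL: "b \<in> L" using b(1) by (rule Eig_L)
  have M_L: "M \<in> L" using bL by (simp add: M_def)
  have "S i M = M" unfolding M_def by (rule radical_norm[OF bL x x0 eq nd])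
  hence "S (i * k) M = M" using S_mult_eigen[OF M_L, of i 1 k] by simp
  moreover have "S (i * k) b = - b"
    using S_mult_eigen[of b "n div 2" "- 1" i'] b i' i'(2)[of 1] by (simp add: Eig_def)
  hence "S (i * k) M = - M"
    unfolding M_def even_orbit_prod_S[OF bL, symmetric] using k bL
    by (simp add: even_orbit_prod_def S_minus prod_uminus minus_one_power_iff)
  ultimately have "M + M = 0" by (simp add: eq_neg_iff_add_eq_0)
  hence "M = 0" by (simp flip: mult_2)
  thus False using even_orbit_prod_nonzero[OF bL b(2)] by (simp add: M_def)
qed

text \<open>
  Let \<open>2 e = ord \<tau> / 2\<^sup>s\<close>, so that \<open>\<tau>\<^bsup>2e\<^esup> b = - b\<close>, and let \<open>Q\<close> be the product of the first \<open>e\<close> factors of the norm of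
  \<open>b\<close> along \<open>\<tau>\<^sup>2\<close>. Then \<open>\<tau>\<^sup>2 Q = - Q\<close>, and the norm is \<open>Q ^ 2\<^sup>s\<close> up to sign. If \<open>\<tau>\<close> fixed it, \<open>z = \<tau> Q / Q\<close> would be
  \<open>1\<close> or \<open>-1\<close>, so \<open>\<tau>\<^sup>2 Q = Q\<close>.
\<close>

lemma N_nondegenerate:
  assumes ord: "n div gcd i n = 2 ^ \<beta> * k" and k: "odd k" and s: "0 < s" "s < \<beta>"
    and no_i: "\<And>w. w \<in> L \<Longrightarrow> w\<^sup>2 \<noteq> - 1"
    and b: "b \<in> N s" "b \<noteq> 0" and x: "x \<in> L" and eq: "b * x = S i b * S (2 * i) x"
  shows "x = 0"
proof (rule ccontr)
  assume x0: "x \<noteq> 0"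
  obtain i' where i': "odd i'" "\<And>s. s \<le> \<beta> \<Longrightarrow> i * (2 ^ (\<beta> - s) * k) = n div 2 ^ s * i'"
    and nd: "n dvd i * (2 ^ \<beta> * k)"
    using order_data[OF ord k] s by auto
  define e where "e = 2 ^ (\<beta> - s - 1) * k"
  have e: "2 * e = 2 ^ (\<beta> - s) * k"
  proof -
    have "Suc (\<beta> - s - 1) = \<beta> - s" using s by simp
    hence "2 * 2 ^ (\<beta> - s - 1) = (2::nat) ^ (\<beta> - s)" by (simp only: power_Suc[symmetric])
    thus ?thesis by (simp only: e_def mult.assoc[symmetric])
  qed
  have e2: "2 * e * 2 ^ s = 2 ^ \<beta> * k" unfolding e using s by (simp add: mult_ac flip: power_add)
  have bL: "b \<in> L" using b(1) by (rule Eig_L)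
  have Sb: "S (2 * i * e) b = - b"
  proof -
    have "2 * i * e = i * (2 * e)" by simp
    also have "\<dots> = n div 2 ^ s * i'" unfolding e using s by (intro i'(2)) simp
    finally have "2 * i * e = n div 2 ^ s * i'" .
    thus ?thesis using S_mult_eigen[of b "n div 2 ^ s" "- 1" i'] b i'(1) by (simp add: Eig_def)
  qed
  define Q where "Q = even_orbit_prod i e b"
  have QL: "Q \<in> L" "Q \<noteq> 0" using bL b(2) even_orbit_prod_nonzero by (auto simp: Q_def)
  have SQ: "S (2 * i) Q = - Q"
  proof -
    have "S (2 * i) Q * b = - Q * b" using even_orbit_prod_shift[OF bL, of i e] Sb by (simp add: Q_def)
    thus ?thesis using b(2) mult_right_cancel by blast
  qed
  have even_orbit_prod_block: "even_orbit_prod i (e * r) b = Q ^ r \<or> even_orbit_prod i (e * r) b = - (Q ^ r)" for r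
  proof (induction r)
    case 0
    thus ?case by (simp add: even_orbit_prod_def)
  next
    case (Suc r)
    have "even_orbit_prod i (e * Suc r) b = even_orbit_prod i (e * r) b * S (2 * i * e * r) Q"
      using even_orbit_prod_add[OF bL, of i "e * r" e] by (simp add: Q_def mult_ac add.commute)
    moreover have "S (2 * i * e * r) Q = Q \<or> S (2 * i * e * r) Q = - Q"
    proof -
      have "S (2 * i * e) Q = - Q \<or> S (2 * i * e) Q = Q"
        unfolding Q_def even_orbit_prod_S[OF bL, symmetric] Sb using bL
        by (auto simp: even_orbit_prod_def S_minus prod_uminus minus_one_power_iff)
      thus ?thesis
      proof
        assume "S (2 * i * e) Q = - Q"
        hence "S (2 * i * e * r) Q = (- 1) ^ r * Q" using QL by (intro S_mult_eigen) auto
        thus ?thesis by (simp add: minus_one_power_iff)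
      next
        assume "S (2 * i * e) Q = Q"
        hence "S (2 * i * e * r) Q = 1 ^ r * Q" using QL by (intro S_mult_eigen) auto
        thus ?thesis by simp
      qed
    qed
    ultimately show ?case using Suc.IH by (auto simp: mult.commute)
  qed
  define M where "M = even_orbit_prod i (e * 2 ^ s) b"
  have "2 * i * (e * 2 ^ s) = i * (2 * e * 2 ^ s)" by simp
  hence "n dvd 2 * i * (e * 2 ^ s)" using nd by (simp only: e2)
  hence "S i M = M" unfolding M_def by (intro radical_norm[OF bL x x0 eq])
  hence "S i (Q ^ 2 ^ s) = Q ^ 2 ^ s" using even_orbit_prod_block[of "2 ^ s"] QL by (auto simp: M_def S_minus)
  hence Sr: "S i Q ^ 2 ^ s = Q ^ 2 ^ s" using QL by (simp add: S_power)
  define z where "z = S i Q / Q"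
  have "z ^ 2 ^ s = 1" using QL Sr by (simp add: z_def power_divide)
  moreover have "z \<in> L" using QL by (simp add: z_def)
  ultimately have "z = 1 \<or> z = - 1" by (intro root_of_unity_sign[OF no_i])
  moreover have "S i Q = z * Q" using QL by (simp add: z_def)
  ultimately consider "S i Q = Q" | "S i Q = - Q" by auto
  hence "S i (S i Q) = Q" using QL(1) by cases (simp_all add: S_minus)
  hence "S (2 * i) Q = Q" by (simp only: S_S mult_2)
  with SQ have "Q + Q = 0" by (metis add.right_inverse)
  thus False using QL by (simp flip: mult_2)
qed

text \<open>
  The quotient of two elements of the radical is fixed by \<open>\<tau>\<^sup>2\<close>.
\<close>

lemma dim_radical:
  assumes b: "b \<in> L" "b \<noteq> 0" and x0: "x0 \<in> L" "x0 \<noteq> 0" "b * x0 = S i b * S (2 * i) x0"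
  shows "KV.dim {x\<in>L. b * x = S i b * S (2 * i) x} = gcd (2 * i) n"
proof -
  define Y where "Y = {x\<in>L. S (2 * i) x = x}"
  have Sb: "S i b \<noteq> 0" "S (2 * i) x0 \<noteq> 0" using b x0 by auto
  have "{x\<in>L. b * x = S i b * S (2 * i) x} = (\<lambda>y. x0 * y) ` Y"
  proof (intro equalityI subsetI)
    fix x assume "x \<in> {x\<in>L. b * x = S i b * S (2 * i) x}"
    hence x: "x \<in> L" "b * x = S i b * S (2 * i) x" by auto
    have "b * x0 * S (2 * i) x = S i b * S (2 * i) x0 * S (2 * i) x" by (simp only: x0(3))
    also have "\<dots> = S i b * S (2 * i) x * S (2 * i) x0" by (simp only: mult_ac)
    also have "\<dots> = b * x * S (2 * i) x0" by (simp only: x(2))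
    finally have "x0 * S (2 * i) x = x * S (2 * i) x0"
      using b(2) by (simp add: mult.assoc)
    hence "S (2 * i) x / S (2 * i) x0 = x / x0" using x0(2) Sb(2) by (simp add: field_simps)
    hence "x / x0 \<in> Y" using x x0 by (simp add: Y_def S_divide)
    thus "x \<in> (\<lambda>y. x0 * y) ` Y" using x0 by (intro image_eqI[of _ _ "x / x0"]) auto
  next
    fix x assume "x \<in> (\<lambda>y. x0 * y) ` Y"
    then obtain y where y: "y \<in> L" "S (2 * i) y = y" "x = x0 * y" by (auto simp: Y_def)
    have "b * x = S i b * S (2 * i) x" using y x0 by (simp add: S_mult mult.assoc[symmetric])
    thus "x \<in> {x\<in>L. b * x = S i b * S (2 * i) x}" using y x0 by simp
  qed
  moreover have "KV.subspace Y"
    by (rule subspace_ext_scale) (auto simp: Y_def S_add S_mult)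
  moreover have "KV.dim Y = gcd (2 * i) n"
    unfolding Y_def fixed_gcd[of "2 * i"] by (rule dim_fixed) simp
  ultimately show ?thesis using dim_mult_image[OF x0(2), of Y] by (auto simp: Y_def)
qed

text \<open>
  Let \<open>\<tau>\<^sup>k b = \<epsilon> b\<close> and \<open>r = (k + 1) / 2\<close>. The product \<open>Q\<close> of the \<open>\<tau>\<^bsup>2t\<^esup> b\<close> for \<open>t < r\<close> satisfies
  \<open>\<tau>\<^sup>2 Q = Q * \<tau>\<^bsup>k+1\<^esup> b / b = \<epsilon> Q * \<tau> b / b\<close>, so \<open>x = w / Q\<close> lies in the radical for any \<open>w\<close> with \<open>\<tau>\<^sup>2 w = \<epsilon> w\<close>. For
  \<open>\<epsilon> = - 1\<close> such a \<open>w\<close> is a product of \<open>k\<close> conjugates of a nonzero \<open>v\<close> in \<open>N\<^bsub>\<beta>-1\<^esub>\<close>, which \<open>\<tau>\<^bsup>2k\<^esup>\<close> negates.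
\<close>

lemma degenerate_vector:
  assumes ord: "n div gcd i n = 2 ^ \<beta> * k" and k: "odd k" and \<beta>: "\<beta> > 0"
    and b: "b \<noteq> 0" "b \<in> P \<beta> \<or> b \<in> N \<beta> \<and> \<beta> \<ge> 2"
  obtains x0 where "x0 \<in> L" "x0 \<noteq> 0" "b * x0 = S i b * S (2 * i) x0"
proof -
  obtain i' where i': "odd i'" "\<And>s. s \<le> \<beta> \<Longrightarrow> i * (2 ^ (\<beta> - s) * k) = n div 2 ^ s * i'"
    and n2: "2 ^ \<beta> dvd n"
    using order_data[OF ord k \<beta>] by blast
  have bL: "b \<in> L" using b Eig_L by blast
  obtain \<epsilon> w where \<epsilon>: "\<epsilon> = 1 \<or> \<epsilon> = - 1" and Sb: "S (i * k) b = \<epsilon> * b"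
    and w: "w \<in> L" "w \<noteq> 0" "S (2 * i) w = \<epsilon> * w"
  proof (cases "b \<in> P \<beta>")
    case True
    have "S (i * k) b = 1 * b"
      using S_mult_eigen[of b "n div 2 ^ \<beta>" 1 i'] True i'(2)[of \<beta>] by (simp add: Eig_def)
    thus ?thesis by (intro that[of 1 1]) auto
  next
    case False
    hence bN: "b \<in> N \<beta>" "\<beta> \<ge> 2" using b by auto
    have "S (i * k) b = - 1 * b"
      using S_mult_eigen[of b "n div 2 ^ \<beta>" "- 1" i'] bN i'(1) i'(2)[of \<beta>] by (simp add: Eig_def)
    moreover have "2 ^ (\<beta> - 1) dvd n" using n2 by (meson diff_le_self dvd_trans le_imp_power_dvd)
    then obtain v where v: "v \<in> N (\<beta> - 1)" "v \<noteq> 0" using N_nonzero[of "\<beta> - 1"] bN by auto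
    have vL: "v \<in> L" using v(1) by (rule Eig_L)
    have "\<beta> - (\<beta> - 1) = 1" using bN by simp
    hence "S (2 * i * k) v = - v"
      using S_mult_eigen[of v "n div 2 ^ (\<beta> - 1)" "- 1" i'] v i'(1) i'(2)[of "\<beta> - 1"]
      by (simp add: Eig_def mult_ac)
    hence "S (2 * i) (even_orbit_prod i k v) * v = - even_orbit_prod i k v * v"
      using even_orbit_prod_shift[OF vL, of i k] by simp
    hence "S (2 * i) (even_orbit_prod i k v) = - even_orbit_prod i k v" using v(2) mult_right_cancel by blast
    ultimately show ?thesis using v vL even_orbit_prod_nonzero by (intro that[of "- 1" "even_orbit_prod i k v"]) auto
  qed
  define r where "r = (k + 1) div 2"
  have r: "2 * r = k + 1" using k by (simp add: r_def)
  define Q where "Q = even_orbit_prod i r b"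
  have Q: "Q \<in> L" "Q \<noteq> 0" using bL b even_orbit_prod_nonzero by (auto simp: Q_def)
  have "S (2 * i * r) b = S i (S (i * k) b)"
  proof -
    have "2 * i * r = i + i * k" using r by (metis add.commute distrib_left mult.assoc mult.left_commute mult_1_right)
    thus ?thesis by (simp add: S_S)
  qed
  also have "\<dots> = \<epsilon> * S i b" using Sb \<epsilon> bL by (auto simp: S_minus)
  finally have SQ: "S (2 * i) Q * b = Q * (\<epsilon> * S i b)"
    using even_orbit_prod_shift[OF bL, of i r] by (simp add: Q_def)
  have nz: "S (2 * i) Q \<noteq> 0" using Q by simp
  have "b * (w / Q) = S i b * (\<epsilon> * w / S (2 * i) Q)"
  proof -
    have "b * w * S (2 * i) Q = w * (Q * (\<epsilon> * S i b))" using SQ by (simp add: mult_ac)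
    thus ?thesis using nz Q by (simp add: field_simps)
  qed
  hence "b * (w / Q) = S i b * S (2 * i) (w / Q)" using w Q by (simp add: S_divide)
  thus ?thesis using w Q by (intro that[of "w / Q"]) auto
qed

lemma rank_subspace_F_image:
  assumes Y: "KV.subspace Y" "Y \<subseteq> L" and rk: "\<And>b. b \<in> Y \<Longrightarrow> b \<noteq> 0 \<Longrightarrow> form_rank L (F i b) = r"
  shows "rank_subspace L r (F i ` Y)"
proof -
  have "form_rank L f = r" if f: "f \<in> F i ` Y" "f \<noteq> 0" for f
  proof -
    obtain b where b: "b \<in> Y" "f = F i b" using f by blast
    with f(2) have "b \<noteq> 0" by auto
    thus ?thesis using rk b by simp
  qed
  thus ?thesis using Y F_Alt subspace_F_image[OF Y]
    by (auto simp: rank_subspace_def)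
qed

lemma form_rank_nondegenerate:
  assumes b: "b \<in> L" and nd: "\<And>x. x \<in> L \<Longrightarrow> b * x = S i b * S (2 * i) x \<Longrightarrow> x = 0"
  shows "form_rank L (F i b) = n"
proof -
  have "{x\<in>L. b * x = S i b * S (2 * i) x} = {0}" using nd by auto
  thus ?thesis using form_rank_F[OF b, of i] by (simp add: dim_zero_subspace)
qed

lemma rank_F_N_1:
  assumes "n div gcd i n = 2 * k" "odd k"
  shows "rank_subspace L n (F i ` N 1)"
  by (rule rank_subspace_F_image[OF subspace_Eig Eig_subset], rule form_rank_nondegenerate)
     (use N_1_nondegenerate[OF assms] Eig_L in blast)+

lemma rank_F_N:
  assumes "n div gcd i n = 2 ^ \<beta> * k" "odd k" "0 < s" "s < \<beta>" "\<And>w. w \<in> L \<Longrightarrow> w\<^sup>2 \<noteq> - 1"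
  shows "rank_subspace L n (F i ` N s)"
  by (rule rank_subspace_F_image[OF subspace_Eig Eig_subset], rule form_rank_nondegenerate)
     (use N_nondegenerate[OF assms] Eig_L in blast)+

lemma rank_F_degenerate:
  assumes ord: "n div gcd i n = 2 ^ \<beta> * k" and k: "odd k" and \<beta>: "\<beta> > 0"
    and Y: "Y = P \<beta> \<or> Y = N \<beta> \<and> \<beta> \<ge> 2"
  shows "rank_subspace L (n - 2 * n div (2 ^ \<beta> * k)) (F i ` Y)"
proof (rule rank_subspace_F_image)
  show "KV.subspace Y" "Y \<subseteq> L" using Y subspace_Eig Eig_subset by blast+
  fix b assume b: "b \<in> Y" "b \<noteq> 0"
  have bL: "b \<in> L" using b Y Eig_L by blast
  have "b \<in> P \<beta> \<or> b \<in> N \<beta> \<and> \<beta> \<ge> 2" using b Y by auto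
  then obtain x0 where "x0 \<in> L" "x0 \<noteq> 0" "b * x0 = S i b * S (2 * i) x0"
    using degenerate_vector[OF ord k \<beta> b(2)] by blast
  hence "KV.dim {x\<in>L. b * x = S i b * S (2 * i) x} = gcd (2 * i) n"
    by (rule dim_radical[OF bL b(2)])
  moreover have "gcd (2 * i) n = 2 * n div (2 ^ \<beta> * k)" using order_data[OF ord k \<beta>] by blast
  ultimately show "form_rank L (F i b) = n - 2 * n div (2 ^ \<beta> * k)"
    using form_rank_F[OF bL, of i] by simp
qed

end


section \<open>Existence of a cyclic extension without a square root of minus one\<close>

lemma coefficient_hom_to_ac: "coefficient_hom (to_ac :: 'k::field \<Rightarrow> 'k alg_closure)"
  by unfold_locales auto

context prime_root_of_unity
begin

text \<open>
  Clear denominators.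
\<close>

lemma powers_independent_rat:
  fixes u :: "nat \<Rightarrow> rat"
  assumes "(\<Sum>j<p - 1. of_rat (u j) * z ^ j) = 0"
  shows "\<forall>j\<in>{..<p - 1}. u j = 0"
proof -
  define D where "D = (\<Prod>j<p - 1. snd (quotient_of (u j)))"
  have "D \<noteq> 0" using quotient_of_denom_pos' by (auto simp: D_def less_le)
  have "\<exists>c. of_int D * u j = of_int c" if "j < p - 1" for j
  proof -
    obtain a b where ab: "quotient_of (u j) = (a, b)" by fastforce
    have "b dvd D" unfolding D_def using that ab by (intro dvd_prod_eqI[of _ j]) auto
    then obtain e where "D = b * e" by (auto simp: dvd_def)
    hence "of_int D * u j = of_int (a * e)"
      using quotient_of_div[OF ab] quotient_of_denom_pos[OF ab] by simp
    thus ?thesis by blast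
  qed
  then obtain c where c: "\<And>j. j < p - 1 \<Longrightarrow> of_int D * u j = of_int (c j)" by metis
  define f where "f = (\<Sum>j<p - 1. Polynomial.monom (c j) j)"
  have co: "Polynomial.coeff f j = (if j < p - 1 then c j else 0)" for j
    by (simp add: f_def coeff_sum sum.delta)
  have "int.ev f z = (\<Sum>j<p - 1. of_rat (of_int D) * (of_rat (u j) * z ^ j))"
    unfolding f_def int.ev_sum
  proof (rule sum.cong)
    fix j assume "j \<in> {..<p - 1}"
    hence "(of_int (c j) :: 'a) = of_rat (of_int D * u j)" using c by simp
    thus "int.ev (Polynomial.monom (c j) j) z = of_rat (of_int D) * (of_rat (u j) * z ^ j)"
      by (simp add: of_rat_mult)
  qed simp
  also have "\<dots> = 0" using assms by (simp flip: sum_distrib_left)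
  finally have ev0: "int.ev f z = 0" .
  have "f = 0"
  proof (rule powers_independent_int[OF _ ev0])
    have "Polynomial.degree f \<le> p - 2" by (rule degree_le) (auto simp: co)
    thus "Polynomial.degree f < p - 1" using p_gt_1 by simp
  qed
  hence "c j = 0" if "j < p - 1" for j using co[of j] that by simp
  thus ?thesis using c \<open>D \<noteq> 0\<close> by fastforce
qed

end

lemma prime_root_of_unity_exists:
  assumes p: "prime p"
  obtains z :: "'a::{alg_closed_field,field_char_0}" where "prime_root_of_unity p z"
proof -
  define S where "S = (\<Sum>i<p. Polynomial.monom (1::'a) i)"
  have p1: "p > 1" using p by (rule prime_gt_1_nat)
  have coS: "Polynomial.coeff S i = (if i < p then 1 else 0)" for i
    by (simp add: S_def coeff_sum sum.delta)
  have "p - 1 \<le> Polynomial.degree S" by (rule le_degree) (use p1 in \<open>simp add: coS\<close>)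
  hence "Polynomial.degree S > 0" using p1 by simp
  then obtain z where "poly S z = 0" using alg_closed_imp_poly_has_root by blast
  hence z: "(\<Sum>i<p. z ^ i) = 0" by (simp add: S_def poly_sum poly_monom)
  have "prime_root_of_unity p z"
  proof
    show "z ^ p = 1" using power_diff_1_eq[of z p] z by simp
    show "z \<noteq> 1" using z p1 by auto
  qed (rule p)
  thus ?thesis by (rule that)
qed

text \<open>
  The field \<open>K(\<zeta>)\<close> for \<open>\<zeta>\<close> of prime order \<open>p\<close>; the primitive root \<open>g\<close> modulo \<open>p\<close> turns its Galois group, a
  subgroup of the units modulo \<open>p\<close>, into a set of exponents.
\<close>

locale cyclotomic_extension =
  prime_root_of_unity p z for p :: nat and z :: "'k::field_char_0 alg_closure" +
  fixes g :: nat
  assumes primroot: "residue_primroot p g"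
begin

sublocale ac: coefficient_hom "to_ac :: 'k \<Rightarrow> 'k alg_closure"
  by (rule coefficient_hom_to_ac)

text \<open>
  The minimal polynomial of \<open>\<zeta>\<close> over \<open>K\<close>, up to a constant factor.
\<close>

definition mipo :: "'k poly" where
  "mipo = (ARG_MIN Polynomial.degree m. m \<noteq> 0 \<and> ac.ev m z = 0)"

definition Phi :: "'k poly" where "Phi = (\<Sum>i<p. Polynomial.monom 1 i)"

lemma ev_Phi: "ac.ev Phi x = (\<Sum>i<p. x ^ i)"
  by (simp add: Phi_def ac.ev_sum)

lemma coeff_Phi: "Polynomial.coeff Phi i = (if i < p then 1 else 0)"
  by (simp add: Phi_def coeff_sum sum.delta)

lemma Phi_nonzero: "Phi \<noteq> 0" using coeff_Phi[of 0] p_gt_1 by auto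

lemma degree_Phi: "Polynomial.degree Phi = p - 1"
proof (rule antisym)
  show "Polynomial.degree Phi \<le> p - 1" by (rule degree_le) (auto simp: coeff_Phi)
  show "p - 1 \<le> Polynomial.degree Phi" by (rule le_degree) (use p_gt_1 in \<open>simp add: coeff_Phi\<close>)
qed

lemma not_dvd_1: "\<not> p dvd 1" using p_gt_1 by simp

lemma ev_Phi_z: "ac.ev Phi z = 0"
  using sum_powers_eq_0[OF not_dvd_1] by (simp add: ev_Phi)

lemma mipo: "mipo \<noteq> 0" "ac.ev mipo z = 0"
  and mipo_least: "f \<noteq> 0 \<Longrightarrow> ac.ev f z = 0 \<Longrightarrow> Polynomial.degree mipo \<le> Polynomial.degree f"
proof -
  let ?P = "\<lambda>m. m \<noteq> 0 \<and> ac.ev m z = 0"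
  have P: "?P Phi" using Phi_nonzero ev_Phi_z by simp
  show "mipo \<noteq> 0" "ac.ev mipo z = 0"
    using arg_min_natI[of ?P Phi Polynomial.degree, OF P] by (simp_all add: mipo_def)
  show "f \<noteq> 0 \<Longrightarrow> ac.ev f z = 0 \<Longrightarrow> Polynomial.degree mipo \<le> Polynomial.degree f"
    using arg_min_nat_le[of ?P f Polynomial.degree] by (simp add: mipo_def)
qed

lemma ev_mod_mipo: "ac.ev (f mod mipo) z = ac.ev f z"
proof -
  have "ac.ev f z = ac.ev (f div mipo * mipo + f mod mipo) z" by simp
  also have "\<dots> = ac.ev (f mod mipo) z" by (simp only: ac.ev_add ac.ev_mult mipo(2)) simp
  finally show ?thesis ..
qed

lemma mipo_dvd_iff: "mipo dvd f \<longleftrightarrow> ac.ev f z = 0"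
proof
  assume f: "ac.ev f z = 0"
  have "f mod mipo = 0"
  proof (rule ccontr)
    assume nz: "f mod mipo \<noteq> 0"
    hence "Polynomial.degree mipo \<le> Polynomial.degree (f mod mipo)"
      using f by (intro mipo_least) (simp_all add: ev_mod_mipo)
    moreover have "Polynomial.degree (f mod mipo) < Polynomial.degree mipo"
      using degree_mod_less[OF mipo(1), of f] nz by simp
    ultimately show False by simp
  qed
  thus "mipo dvd f" by (simp add: dvd_eq_mod_eq_0)
qed (use mipo(2) ac.ev_dvd in blast)

lemma degree_mipo: "Polynomial.degree mipo > 0"
proof (rule ccontr)
  assume "\<not> ?thesis"
  then obtain c where "mipo = [:c:]" by (metis degree_eq_zeroE neq0_conv)
  thus False using mipo by simp
qed

lemma degree_mod_mipo: "Polynomial.degree (f mod mipo) < Polynomial.degree mipo"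
  using degree_mod_less[OF mipo(1), of f] degree_mipo by auto

text \<open>The exponents \<open>e\<close> for which \<open>\<zeta> \<mapsto> \<zeta>\<^bsup>g^e\<^esup>\<close> extends to an automorphism over \<open>K\<close>.\<close>

definition conj_exp :: "nat set" where
  "conj_exp = {e. ac.ev mipo (z ^ (g ^ e)) = 0}"

lemma fermat: "[g ^ (p - 1) = 1] (mod p)"
  using primroot prime_p by (metis euler_theorem residue_primroot_def totient_prime coprime_commute)

lemma primroot_inj: "e < p - 1 \<Longrightarrow> e' < p - 1 \<Longrightarrow> [g ^ e = g ^ e'] (mod p) \<Longrightarrow> e = e'"
  using residue_primroot_is_generator[OF p_gt_1 primroot] prime_p
  by (auto simp: bij_betw_def inj_on_def cong_def totient_prime)

lemma primroot_surj: "0 < j \<Longrightarrow> j < p \<Longrightarrow> \<exists>e<p - 1. [g ^ e = j] (mod p)"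
proof -
  assume j: "0 < j" "j < p"
  have "\<not> p dvd j" using j by (auto dest: dvd_imp_le)
  hence "coprime p j" by (rule prime_imp_coprime[OF prime_p])
  hence "j \<in> totatives p" using j by (simp add: totatives_def coprime_commute)
  hence "j \<in> (\<lambda>i. g ^ i mod p) ` {..<p - 1}"
    using residue_primroot_is_generator[OF p_gt_1 primroot] prime_p by (auto simp: bij_betw_def totient_prime)
  thus ?thesis using j by (auto simp: cong_def)
qed

lemma conj_exp_0: "0 \<in> conj_exp" using mipo by (simp add: conj_exp_def)

text \<open>
  \<open>mipo\<close> divides \<open>mipo(x ^ g\<^sup>a)\<close>, because the latter vanishes at \<open>\<zeta>\<close>. Now evaluate at \<open>\<zeta> ^ g\<^sup>b\<close>.
\<close>

lemma conj_exp_add: "a \<in> conj_exp \<Longrightarrow> b \<in> conj_exp \<Longrightarrow> a + b \<in> conj_exp"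
proof -
  assume ab: "a \<in> conj_exp" "b \<in> conj_exp"
  have "mipo dvd pcompose mipo (Polynomial.monom 1 (g ^ a))"
    using ab(1) by (simp add: mipo_dvd_iff ac.ev_pcompose conj_exp_def)
  hence "ac.ev (pcompose mipo (Polynomial.monom 1 (g ^ a))) (z ^ (g ^ b)) = 0"
    using ab(2) ac.ev_dvd by (auto simp: conj_exp_def)
  thus ?thesis by (simp add: ac.ev_pcompose conj_exp_def power_add mult.commute flip: power_mult)
qed

lemma conj_exp_mult: "a \<in> conj_exp \<Longrightarrow> a * b \<in> conj_exp"
  by (induction b) (auto simp: conj_exp_0 conj_exp_add)

lemma g_pow_cong: "[g ^ (e + (p - 1) * q) = g ^ e] (mod p)"
proof -
  have "[g ^ e * (g ^ (p - 1)) ^ q = g ^ e * 1 ^ q] (mod p)"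
    by (intro cong_mult cong_pow fermat cong_refl)
  thus ?thesis by (simp add: power_add power_mult)
qed

lemma conj_exp_periodic: "e + (p - 1) * q \<in> conj_exp \<longleftrightarrow> e \<in> conj_exp"
  using z_pow_cong[OF g_pow_cong[of e q]] by (simp add: conj_exp_def)

definition min_exp :: nat where "min_exp = (LEAST e. e > 0 \<and> e \<in> conj_exp)"

lemma min_exp: "min_exp > 0" "min_exp \<in> conj_exp" and min_exp_least: "e > 0 \<Longrightarrow> e \<in> conj_exp \<Longrightarrow> min_exp \<le> e"
proof -
  have "p - 1 > 0 \<and> p - 1 \<in> conj_exp"
    using conj_exp_periodic[of 0 1] conj_exp_0 p_gt_1 by simp
  from LeastI[of "\<lambda>e. e > 0 \<and> e \<in> conj_exp", OF this]
  show "min_exp > 0" "min_exp \<in> conj_exp" by (simp_all add: min_exp_def)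
  show "e > 0 \<Longrightarrow> e \<in> conj_exp \<Longrightarrow> min_exp \<le> e" unfolding min_exp_def by (rule Least_le) simp
qed

text \<open>
  Euclidean division by \<open>min_exp\<close>; subtraction is addition of a multiple of \<open>p - 2\<close>, modulo the period \<open>p - 1\<close>.
\<close>

lemma min_exp_dvd: "e \<in> conj_exp \<Longrightarrow> min_exp dvd e"
proof -
  assume e: "e \<in> conj_exp"
  define q where "q = e div min_exp"
  have "e + min_exp * (q * (p - 2)) \<in> conj_exp" by (intro conj_exp_add e conj_exp_mult min_exp)
  also have "e + min_exp * (q * (p - 2)) = e mod min_exp + (p - 1) * (q * min_exp)"
  proof -
    have "e = e mod min_exp + q * min_exp" unfolding q_def by (rule mod_div_mult_eq[symmetric])
    moreover have "p - 1 = Suc (p - 2)" using p_gt_1 by simp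
    ultimately show ?thesis by (simp add: algebra_simps)
  qed
  finally have "e mod min_exp \<in> conj_exp" by (simp only: conj_exp_periodic)
  hence "e mod min_exp = 0" using min_exp_least[of "e mod min_exp"] min_exp(1) by (meson gr0I mod_less_divisor not_le)
  thus ?thesis by (simp add: dvd_eq_mod_eq_0)
qed

text \<open>
  The number of conjugates of \<open>\<zeta>\<close>, hence the degree of \<open>K(\<zeta>)\<close>.
\<close>

definition h :: nat where "h = (p - 1) div min_exp"

lemma min_exp_h: "p - 1 = min_exp * h"
proof -
  have "p - 1 \<in> conj_exp" using conj_exp_periodic[of 0 1] conj_exp_0 by simp
  thus ?thesis using min_exp_dvd by (simp add: h_def)
qed

lemma h_pos: "h > 0" using min_exp_h p_gt_1 by (cases h) auto

definition G :: nat where "G = g ^ min_exp"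

lemma conjugates_inj: "inj_on (\<lambda>t. z ^ (G ^ t)) {..<h}"
proof (rule inj_onI)
  fix s t assume st: "s \<in> {..<h}" "t \<in> {..<h}" "z ^ (G ^ s) = z ^ (G ^ t)"
  hence "[g ^ (min_exp * s) = g ^ (min_exp * t)] (mod p)" by (simp add: z_pow_eq_iff G_def power_mult)
  moreover have "min_exp * s < p - 1" "min_exp * t < p - 1" unfolding min_exp_h using st min_exp by auto
  ultimately have "min_exp * s = min_exp * t" by (intro primroot_inj)
  thus "s = t" using min_exp by simp
qed

lemma conjugate_root: "ac.ev mipo (z ^ (G ^ t)) = 0"
  using conj_exp_mult[OF min_exp(2), of t] by (simp add: conj_exp_def G_def power_mult)

lemma mipo_roots: "{x. ac.ev mipo x = 0} \<subseteq> (\<lambda>t. z ^ (G ^ t)) ` {..<h}"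
proof
  fix x assume "x \<in> {x. ac.ev mipo x = 0}"
  hence x: "ac.ev mipo x = 0" by simp
  have "mipo dvd Phi" using ev_Phi_z by (simp add: mipo_dvd_iff)
  hence "ac.ev Phi x = 0" using x by (rule ac.ev_dvd)
  hence "(\<Prod>j\<in>{1..<p}. x - z ^ j) = 0" by (simp only: prod_linear_factors ev_Phi)
  then obtain j where j: "1 \<le> j" "j < p" "x = z ^ j" by auto
  then obtain e where e: "e < p - 1" "[g ^ e = j] (mod p)" using primroot_surj[of j] by auto
  have xe: "x = z ^ (g ^ e)" using z_pow_cong[OF e(2)] j(3) by simp
  hence "e \<in> conj_exp" using x by (simp add: conj_exp_def)
  then obtain t where t: "e = min_exp * t" using min_exp_dvd by (auto simp: dvd_def)
  have "t < h" using e(1) min_exp unfolding t min_exp_h by simp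
  moreover have "x = z ^ (G ^ t)" by (simp add: xe t G_def power_mult)
  ultimately show "x \<in> (\<lambda>t. z ^ (G ^ t)) ` {..<h}" by blast
qed

text \<open>
  Count the roots of the cyclotomic polynomial \<open>Phi = mipo * q\<close>: there are \<open>p - 1\<close> of them, at most \<open>deg q\<close> are
  roots of \<open>q\<close>, and those of \<open>mipo\<close> are among the \<open>h\<close> conjugates.
\<close>

lemma degree_mipo_le: "Polynomial.degree mipo \<le> h"
proof -
  have "mipo dvd Phi" using ev_Phi_z by (simp add: mipo_dvd_iff)
  then obtain q where q: "Phi = mipo * q" by (auto simp: dvd_def)
  have q0: "q \<noteq> 0" using q Phi_nonzero by auto
  have deg: "p - 1 = Polynomial.degree mipo + Polynomial.degree q"
    using degree_mult_eq[OF mipo(1) q0] q degree_Phi by simp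
  define Rq where "Rq = {x. poly (map_poly to_ac q :: 'k alg_closure poly) x = 0}"
  have mq: "map_poly to_ac q \<noteq> (0 :: 'k alg_closure poly)" using q0 by (simp add: map_poly_eq_0_iff)
  have Rq: "finite Rq" "card Rq \<le> Polynomial.degree q"
    using poly_roots_finite[OF mq] card_poly_roots_bound[OF mq] by (auto simp: Rq_def degree_map_poly)
  have "(\<lambda>j. z ^ j) ` {1..<p} \<subseteq> (\<lambda>t. z ^ (G ^ t)) ` {..<h} \<union> Rq"
  proof
    fix x assume "x \<in> (\<lambda>j. z ^ j) ` {1..<p}"
    then obtain j where j: "1 \<le> j" "j < p" "x = z ^ j" by auto
    hence "\<not> p dvd j" by (auto dest: dvd_imp_le)
    hence "ac.ev Phi x = 0" using sum_powers_eq_0[of j] j(3) by (simp add: ev_Phi)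
    hence "ac.ev mipo x = 0 \<or> ac.ev q x = 0" by (simp add: q)
    thus "x \<in> (\<lambda>t. z ^ (G ^ t)) ` {..<h} \<union> Rq" using mipo_roots by (auto simp: Rq_def ac.ev_def)
  qed
  hence "card ((\<lambda>j. z ^ j) ` {1..<p}) \<le> card ((\<lambda>t. z ^ (G ^ t)) ` {..<h} \<union> Rq)"
    using Rq by (intro card_mono) auto
  also have "\<dots> \<le> h + Polynomial.degree q"
    using card_Un_le[of "(\<lambda>t. z ^ (G ^ t)) ` {..<h}" Rq] card_image_le[of "{..<h}" "\<lambda>t. z ^ (G ^ t)"] Rq
    by simp
  also have "card ((\<lambda>j. z ^ j) ` {1..<p}) = p - 1"
    by (subst card_image) (auto intro: inj_on_subset[OF z_pow_inj])
  finally show ?thesis using deg by simp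
qed

definition KZ :: "'k alg_closure set" where "KZ = range (\<lambda>f. ac.ev f z)"

text \<open>
  The substitution \<open>\<zeta> \<mapsto> \<zeta>\<^sup>G\<close>; it does not depend on the chosen polynomial because \<open>mipo\<close> vanishes at \<open>\<zeta>\<^sup>G\<close>.
\<close>

definition conj_map :: "'k alg_closure \<Rightarrow> 'k alg_closure" where
  "conj_map x = ac.ev (SOME f. ac.ev f z = x) (z ^ G)"

lemma conj_map_ev: "conj_map (ac.ev f z) = ac.ev f (z ^ G)"
proof -
  define f' where "f' = (SOME f'. ac.ev f' z = ac.ev f z)"
  have "ac.ev f' z = ac.ev f z" unfolding f'_def by (rule someI[of _ f]) simp
  hence "mipo dvd f' - f" by (simp add: mipo_dvd_iff)
  hence "ac.ev (f' - f) (z ^ G) = 0" by (rule ac.ev_dvd) (use conjugate_root[of 1] in simp)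
  thus ?thesis by (simp add: conj_map_def f'_def)
qed

lemma conj_map_pow_ev: "(conj_map ^^ i) (ac.ev f z) = ac.ev f (z ^ (G ^ i))"
proof (induction i)
  case (Suc i)
  have "(conj_map ^^ Suc i) (ac.ev f z) = conj_map (ac.ev (pcompose f (Polynomial.monom 1 (G ^ i))) z)"
    by (simp add: Suc.IH ac.ev_pcompose)
  also have "\<dots> = ac.ev f (z ^ (G ^ Suc i))"
    unfolding conj_map_ev by (simp add: ac.ev_pcompose flip: power_mult)
  finally show ?case .
qed simp

lemma ev_const: "ac.ev [:c:] x = to_ac c" by simp

lemma ev_X: "ac.ev [:0, 1:] x = x" by simp

text \<open>
  For the fixed field, write \<open>x = f(\<zeta>)\<close> with \<open>deg f < deg mipo\<close>. If \<open>x\<close> is fixed, \<open>f - x\<close> has the \<open>h\<close> conjugates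
  of \<open>\<zeta>\<close> as roots, more than its degree allows unless it is zero; then \<open>x\<close> is the constant term of \<open>f\<close>.
\<close>

lemma cyclotomic_cyclic: "cyclic_extension KZ conj_map h z"
proof
  show "to_ac c \<in> KZ" for c unfolding KZ_def by (metis ev_const rangeI)
  show zKZ: "z \<in> KZ" unfolding KZ_def by (metis ev_X rangeI)
  show "x + y \<in> KZ" "x * y \<in> KZ" if "x \<in> KZ" "y \<in> KZ" for x y
    using that unfolding KZ_def by (auto simp flip: ac.ev_add ac.ev_mult)
  show "conj_map x \<in> KZ" if xK: "x \<in> KZ" for x
  proof -
    obtain f where "x = ac.ev f z" using xK by (auto simp: KZ_def)
    hence "conj_map x = ac.ev (pcompose f (Polynomial.monom 1 G)) z" by (simp add: conj_map_ev ac.ev_pcompose)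
    thus ?thesis by (simp add: KZ_def)
  qed
  show "conj_map (x + y) = conj_map x + conj_map y" "conj_map (x * y) = conj_map x * conj_map y" if "x \<in> KZ" "y \<in> KZ" for x y
    using that unfolding KZ_def by (auto simp: conj_map_ev simp flip: ac.ev_add ac.ev_mult)
  show "(conj_map ^^ h) x = x" if xK: "x \<in> KZ" for x
  proof -
    obtain f where f: "x = ac.ev f z" using xK by (auto simp: KZ_def)
    have "z ^ (G ^ h) = z ^ 1"
      by (rule z_pow_cong) (use fermat in \<open>simp only: G_def power_mult[symmetric] min_exp_h[symmetric]\<close>)
    thus ?thesis by (simp add: f conj_map_pow_ev)
  qed
  show "inj_on (\<lambda>i. (conj_map ^^ i) z) {..<h}"
    using conjugates_inj conj_map_pow_ev[of _ "[:0, 1:]"] by simp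
  show "conj_map x = x \<longleftrightarrow> x \<in> range to_ac" if xK: "x \<in> KZ" for x
  proof
    assume fx: "conj_map x = x"
    have fixp: "(conj_map ^^ i) x = x" for i by (induction i) (simp_all add: fx)
    obtain f0 where "x = ac.ev f0 z" using xK by (auto simp: KZ_def)
    define f where "f = f0 mod mipo"
    have f: "x = ac.ev f z" using \<open>x = ac.ev f0 z\<close> by (simp add: f_def ev_mod_mipo)
    have "map_poly to_ac f - [:x:] = 0"
    proof (rule poly_eq_0_of_many_roots[OF conjugates_inj])
      show "poly (map_poly to_ac f - [:x:]) (z ^ (G ^ t)) = 0" for t
        using fixp[of t] conj_map_pow_ev[of t f] f by (simp add: ac.ev_def)
      have "Polynomial.degree (map_poly to_ac f - [:x:]) \<le> Polynomial.degree f"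
        by (rule degree_diff_le) (simp_all add: degree_map_poly)
      also have "\<dots> < card {..<h}" using degree_mod_mipo[of f0] degree_mipo_le by (simp add: f_def)
      finally show "Polynomial.degree (map_poly to_ac f - [:x:]) < card {..<h}" .
    qed simp
    hence "map_poly to_ac f = [:x:]" by simp
    hence "Polynomial.coeff (map_poly to_ac f) 0 = x" by simp
    thus "x \<in> range to_ac" by (auto simp: coeff_map_poly)
  next
    assume "x \<in> range to_ac"
    then obtain c where "x = to_ac c" by auto
    thus "conj_map x = x" using conj_map_ev[of "[:c:]"] by simp
  qed
qed (rule h_pos)

text \<open>
  The rational span of the products of \<open>B\<close> with \<open>1, \<zeta>, \<dots>, \<zeta>\<^bsup>deg mipo - 1\<^esup>\<close> is \<open>K(\<zeta>)\<close>, which contains the \<open>p - 1\<close>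
  independent elements \<open>1, \<zeta>, \<dots>, \<zeta>\<^bsup>p-2\<^esup>\<close>.
\<close>

lemma degree_bound:
  fixes B :: "'k set"
  assumes B: "finite B" "module.span (\<lambda>(q::rat) x. of_rat q * x) B = UNIV"
  shows "p - 1 \<le> card B * h"
proof -
  interpret Qk: vector_space "\<lambda>(q::rat) (x::'k). of_rat q * x" by (rule vector_space_rat)
  interpret Q: vector_space "\<lambda>(q::rat) (x::'k alg_closure). of_rat q * x" by (rule vector_space_rat)
  have to_ac_rat: "to_ac (of_rat q :: 'k) = of_rat q" for q
    by (cases q) (simp add: of_rat_rat)
  define T where "T = (\<lambda>(b, i). to_ac b * z ^ i) ` (B \<times> {..<Polynomial.degree mipo})"
  have cT: "to_ac c * z ^ i \<in> Q.span T" if i: "i < Polynomial.degree mipo" for c i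
  proof -
    have "c \<in> Qk.span B" using B by simp
    thus ?thesis
    proof (induction c rule: Qk.span_induct_alt)
      case base
      thus ?case using Q.span_zero by simp
    next
      case (step q b c)
      have "to_ac b * z ^ i \<in> Q.span T" using step i by (intro Q.span_base) (auto simp: T_def)
      hence "of_rat q * (to_ac b * z ^ i) + to_ac c * z ^ i \<in> Q.span T"
        using step by (intro Q.span_add Q.span_scale)
      thus ?case by (simp add: to_ac_rat algebra_simps)
    qed
  qed
  have "z ^ j \<in> Q.span T" for j
  proof -
    define f where "f = Polynomial.monom 1 j mod mipo"
    have "z ^ j = ac.ev f z" by (simp add: f_def ev_mod_mipo)
    also have "\<dots> = (\<Sum>i\<le>Polynomial.degree f. to_ac (Polynomial.coeff f i) * z ^ i)"
      by (simp add: ac.ev_def poly_altdef degree_map_poly coeff_map_poly)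
    also have "\<dots> \<in> Q.span T"
      using degree_mod_mipo[of "Polynomial.monom 1 j"] by (intro Q.span_sum cT) (simp add: f_def)
    finally show ?thesis .
  qed
  hence sub: "(\<lambda>j. z ^ j) ` {..<p - 1} \<subseteq> Q.span T" by auto
  have ind: "Q.independent ((\<lambda>j. z ^ j) ` {..<p - 1})"
    by (rule Q.independent_family) (use powers_independent_rat in auto)
  have finT: "finite T" using B by (simp add: T_def)
  have "p - 1 = card ((\<lambda>j. z ^ j) ` {..<p - 1})"
    by (subst card_image) (auto intro: inj_on_subset[OF z_pow_inj])
  also have "\<dots> \<le> card T" using Q.independent_span_bound[OF finT ind sub] by simp
  also have "\<dots> \<le> card (B \<times> {..<Polynomial.degree mipo})"
    unfolding T_def using B by (intro card_image_le) auto
  also have "\<dots> \<le> card B * h" using degree_mipo_le by (simp add: card_cartesian_product)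
  finally show ?thesis .
qed

text \<open>
  A square root of \<open>-1\<close> and the square root \<open>s\<close> of \<open>p\<close> are both outside \<open>K\<close>, so the generator of the Galois
  group negates both. It fixes their product, a square root of \<open>-p\<close>, which would thus lie in \<open>K\<close>.
\<close>

lemma no_sqrt_minus_1:
  assumes p4: "[p = 1] (mod 4)" and i: "\<not> (\<exists>x::'k. x\<^sup>2 = - 1)"
    and sq: "\<not> (\<exists>s::'k. s\<^sup>2 = of_nat p \<or> s\<^sup>2 = - of_nat p)"
    and w: "w \<in> KZ"
  shows "w\<^sup>2 \<noteq> - 1"
proof
  interpret C: cyclic_extension KZ conj_map h z by (rule cyclotomic_cyclic)
  assume w2: "w\<^sup>2 = - 1"
  obtain f where f: "(int.ev f z)\<^sup>2 = of_nat p" using sqrt_p_exists[OF p4] by blast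
  define s where "s = int.ev f z"
  have "s = ac.ev (map_poly of_int f) z"
    by (simp add: s_def int.ev_def ac.ev_def map_poly_map_poly o_def)
  hence sK: "s \<in> KZ" by (simp add: KZ_def)
  have s2: "s\<^sup>2 = of_nat p" using f by (simp add: s_def)
  have sign: "conj_map x = x \<or> conj_map x = - x" if "x \<in> KZ" "x\<^sup>2 = to_ac c" for x c
  proof -
    have "(conj_map x)\<^sup>2 = conj_map (x\<^sup>2)" using C.S_power[of x 1 2] that by simp
    also have "\<dots> = x\<^sup>2" using that C.S_to_ac[of 1 c] by simp
    finally show ?thesis by (simp add: power2_eq_iff)
  qed
  have fixed: "\<exists>y. to_ac y = x \<and> y\<^sup>2 = c" if "x \<in> KZ" "x\<^sup>2 = to_ac c" "conj_map x = x" for x c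
  proof -
    have "x \<in> range to_ac" using C.fixed_iff[OF that(1)] that(3) by simp
    then obtain y where "x = to_ac y" by auto
    thus ?thesis using that(2) by (metis to_ac_power to_ac_eq_iff)
  qed
  have wc: "w\<^sup>2 = to_ac (- 1)" and sc: "s\<^sup>2 = to_ac (of_nat p)" using w2 s2 by simp_all
  have "conj_map w = - w" using sign[OF w wc] fixed[OF w wc] i by blast
  moreover have "conj_map s = - s" using sign[OF sK sc] fixed[OF sK sc] sq by blast
  ultimately have "conj_map (w * s) = w * s" using C.S_mult[OF w sK, of 1] by simp
  moreover have "(w * s)\<^sup>2 = to_ac (- of_nat p)" using w2 s2 by (simp add: power_mult_distrib)
  moreover have "w * s \<in> KZ" using w sK by simp
  ultimately show False using fixed sq by blast
qed

end

text \<open>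
  The index \<open>min_exp = (p - 1) / h\<close> is at most \<open>d = card B\<close>, so it divides \<open>d!\<close>. As \<open>n d!\<close> divides \<open>p - 1\<close>, the
  number \<open>n\<close> divides \<open>h\<close>, and the fixed field of the \<open>n\<close>-th power of the generator has degree \<open>n\<close>.
\<close>

lemma cyclic_extension_exists:
  assumes K: "number_field TYPE('k::field_char_0)" and i: "\<not> (\<exists>x::'k. x\<^sup>2 = - 1)" and n: "n > 0"
  shows "\<exists>(L :: 'k alg_closure set) \<sigma> \<theta>. cyclic_extension L \<sigma> n \<theta> \<and> (\<forall>w\<in>L. w\<^sup>2 \<noteq> - 1)"
proof -
  obtain B :: "'k set" where B: "finite B" "module.span (\<lambda>(q::rat) x. of_rat q * x) B = UNIV"
    using K by (auto simp: number_field_def)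
  define bad where "bad = {p::nat. prime p \<and> (\<exists>s::'k. s\<^sup>2 = of_nat p \<or> s\<^sup>2 = - of_nat p)}"
  have fbad: "finite bad" unfolding bad_def by (rule finite_primes_with_square_root[OF K])
  \<comment> \<open>The last factor keeps \<open>p\<close> from dividing it, so that \<open>p\<close> is not bad.\<close>
  define M where "M = 4 * (n * fact (card B)) * \<Prod>bad"
  have "0 \<notin> bad" by (auto simp: bad_def)
  hence "\<Prod>bad > 0" using prod_zero_iff[OF fbad, of "\<lambda>x. x"] by simp
  hence "M > 0" using n by (simp add: M_def)
  then obtain p where p: "prime p" "[p = 1] (mod M)" using prime_cong_1_exists[of M] by auto
  have cong: "[p = 1] (mod m)" if "m dvd M" for m using p(2) that by (rule cong_dvd_modulus_nat)
  have pbad: "p \<notin> bad"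
  proof
    assume "p \<in> bad"
    hence "p dvd \<Prod>bad" using fbad by (intro dvd_prodI) auto
    hence "[p = 1] (mod p)" by (intro cong) (simp add: M_def)
    thus False using prime_gt_1_nat[OF p(1)] by (simp add: cong_def)
  qed
  obtain z :: "'k alg_closure" where z: "prime_root_of_unity p z"
    using prime_root_of_unity_exists[OF p(1)] .
  obtain g where g: "residue_primroot p g"
    using prime_primitive_root_exists[OF prime_gt_1_nat[OF p(1)] p(1)] by blast
  interpret C: cyclotomic_extension p z g
    using z g by (simp add: cyclotomic_extension_def cyclotomic_extension_axioms_def)
  interpret E: cyclic_extension C.KZ C.conj_map C.h z by (rule C.cyclotomic_cyclic)
  have "C.min_exp * C.h \<le> card B * C.h" using C.degree_bound[OF B] by (simp only: C.min_exp_h)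
  hence "C.min_exp \<le> card B" using C.h_pos by simp
  hence "C.min_exp dvd fact (card B)" using C.min_exp(1) by (intro dvd_fact) auto
  moreover have "n * fact (card B) dvd C.min_exp * C.h"
  proof -
    have "[p = 1] (mod n * fact (card B))" by (intro cong) (simp add: M_def)
    hence "n * fact (card B) dvd p - 1" using C.p_gt_1 by (simp add: cong_altdef_nat)
    thus ?thesis by (simp only: C.min_exp_h)
  qed
  ultimately have "n * C.min_exp dvd C.h * C.min_exp" by (metis dvd_trans dvd_refl mult.commute mult_dvd_mono)
  hence "n dvd C.h" using C.min_exp(1) by simp
  then obtain \<theta> where \<theta>: "cyclic_extension {x\<in>C.KZ. (C.conj_map ^^ n) x = x} C.conj_map n \<theta>"
    using E.fixed_field_cyclic by blast
  have p4: "[p = 1] (mod 4)" by (intro cong) (simp add: M_def)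
  have "w\<^sup>2 \<noteq> - 1" if "w \<in> C.KZ" for w
    using C.no_sqrt_minus_1[OF p4 i _ that] pbad p(1) by (simp add: bad_def)
  with \<theta> show ?thesis by blast
qed


section \<open>The decomposition of the space of skew-forms\<close>

text \<open>
  Uniqueness of the representation is reduced to that of zero by taking differences.
\<close>

lemma direct_decompositionI:
  fixes W :: "'i \<Rightarrow> ('a \<Rightarrow> 'a \<Rightarrow> 'k::field) set"
  assumes J: "finite J" and W: "\<And>j. j \<in> J \<Longrightarrow> FV.subspace (W j)"
    and closed: "\<And>w. (\<And>j. j \<in> J \<Longrightarrow> w j \<in> W j) \<Longrightarrow> sum w J \<in> S"
    and span: "\<And>f. f \<in> S \<Longrightarrow> \<exists>w. (\<forall>j\<in>J. w j \<in> W j) \<and> f = sum w J"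
    and indep: "\<And>w j. (\<And>j. j \<in> J \<Longrightarrow> w j \<in> W j) \<Longrightarrow> sum w J = 0 \<Longrightarrow> j \<in> J \<Longrightarrow> w j = 0"
  shows "direct_decomposition S J W"
  unfolding direct_decomposition_def
proof (intro conjI ballI J W)
  show "bij_betw (\<lambda>w. \<Sum>j\<in>J. w j) (\<Pi>\<^sub>E j\<in>J. W j) S"
    unfolding bij_betw_def
  proof
    show "inj_on (\<lambda>w. \<Sum>j\<in>J. w j) (\<Pi>\<^sub>E j\<in>J. W j)"
    proof (rule inj_onI)
      fix v w assume v: "v \<in> (\<Pi>\<^sub>E j\<in>J. W j)" and w: "w \<in> (\<Pi>\<^sub>E j\<in>J. W j)"
        and eq: "(\<Sum>j\<in>J. v j) = (\<Sum>j\<in>J. w j)"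
      have "v j - w j \<in> W j" if "j \<in> J" for j
        using FV.subspace_diff[OF W[OF that]] v w that by (auto simp: PiE_mem)
      moreover have "(\<Sum>j\<in>J. v j - w j) = 0" using eq by (simp add: sum_subtractf)
      ultimately have "v j - w j = 0" if "j \<in> J" for j
        using indep[of "\<lambda>j. v j - w j" j] that by blast
      thus "v = w" using v w by (intro PiE_ext[of v J W w]) auto
    qed
    show "(\<lambda>w. \<Sum>j\<in>J. w j) ` (\<Pi>\<^sub>E j\<in>J. W j) = S"
    proof (intro equalityI subsetI)
      fix f assume "f \<in> (\<lambda>w. \<Sum>j\<in>J. w j) ` (\<Pi>\<^sub>E j\<in>J. W j)"
      thus "f \<in> S" using closed by (auto simp: PiE_mem)
    next
      fix f assume "f \<in> S"
      then obtain w where w: "\<forall>j\<in>J. w j \<in> W j" "f = sum w J" using span by blast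
      have "f = (\<Sum>j\<in>J. restrict w J j)" using w(2) by simp
      moreover have "restrict w J \<in> (\<Pi>\<^sub>E j\<in>J. W j)" using w(1) by simp
      ultimately show "f \<in> (\<lambda>w. \<Sum>j\<in>J. w j) ` (\<Pi>\<^sub>E j\<in>J. W j)" by blast
    qed
  qed
qed

context cyclic_extension
begin

text \<open>
  The summands of \<open>L = P\<^sub>\<beta> \<oplus> N\<^sub>1 \<oplus> \<dots> \<oplus> N\<^sub>\<beta>\<close>, numbered from 0 to \<open>\<beta>\<close>.
\<close>

definition Z :: "nat \<Rightarrow> nat \<Rightarrow> 'k alg_closure set" where
  "Z \<beta> t = (if t = 0 then P \<beta> else N t)"

lemma Z_subset: "Z \<beta> t \<subseteq> L" using Eig_subset by (simp add: Z_def)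

lemma subspace_Z: "KV.subspace (Z \<beta> t)" using subspace_Eig by (simp add: Z_def)

lemma halves: "to_ac (1 / 2) * x + to_ac (1 / 2) * x = (x :: 'k alg_closure)"
proof -
  have "to_ac (1 / 2) * x + to_ac (1 / 2) * x = to_ac (1 / 2 + 1 / 2) * x"
    by (simp only: to_ac_add distrib_right)
  also have "(1 / 2 + 1 / 2 :: 'k) = 1" by simp
  finally show ?thesis by simp
qed

text \<open>
  Split the component in \<open>P\<^sub>\<beta>\<close> into its halves \<open>(x \<plusminus> \<sigma>\<^bsup>n/2^(\<beta>+1)\<^esup> x) / 2\<close> in \<open>P\<^bsub>\<beta>+1\<^esub>\<close> and \<open>N\<^bsub>\<beta>+1\<^esub>\<close>.
\<close>

lemma Z_span:
  assumes "2 ^ \<beta> dvd n" "x \<in> L"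
  shows "\<exists>y. (\<forall>t\<le>\<beta>. y t \<in> Z \<beta> t) \<and> x = (\<Sum>t\<le>\<beta>. y t)"
  using assms
proof (induction \<beta>)
  case 0
  thus ?case by (intro exI[of _ "\<lambda>_. x"]) (simp add: Z_def P_0)
next
  case (Suc \<beta>)
  have "2 ^ \<beta> dvd n" using Suc.prems(1) by (simp add: dvd_mult_right)
  then obtain y where y: "\<forall>t\<le>\<beta>. y t \<in> Z \<beta> t" "x = (\<Sum>t\<le>\<beta>. y t)" using Suc by blast
  define h where "h = n div 2 ^ Suc \<beta>"
  have y0: "y 0 \<in> P \<beta>" using y(1) by (auto simp: Z_def)
  define u where "u = ext_scale (1 / 2) (y 0 + S h (y 0))"
  define v where "v = ext_scale (1 / 2) (y 0 - S h (y 0))"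
  have u: "u \<in> P (Suc \<beta>)" unfolding u_def h_def
    by (rule KV.subspace_scale[OF subspace_Eig P_Suc_cases(4)[OF Suc.prems(1) y0]])
  have v: "v \<in> N (Suc \<beta>)" unfolding v_def h_def
    by (rule KV.subspace_scale[OF subspace_Eig P_Suc_cases(3)[OF Suc.prems(1) y0]])
  have uv: "u + v = y 0"
  proof -
    have "u + v = to_ac (1 / 2) * y 0 + to_ac (1 / 2) * y 0"
      unfolding u_def v_def ext_scale_def distrib_left right_diff_distrib by (simp only: ab_semigroup_add_class.add_ac) simp
    thus ?thesis by (simp only: halves)
  qed
  define y' where "y' t = (if t = 0 then u else if t = Suc \<beta> then v else y t)" for t
  have "(\<Sum>t\<le>Suc \<beta>. y' t) = u + (\<Sum>t\<in>{1..\<beta>}. y t) + v"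
  proof -
    have "{..\<beta>} = insert 0 {1..\<beta>}" by auto
    thus ?thesis by (simp add: y'_def)
  qed
  also have "\<dots> = x"
  proof -
    have "{..\<beta>} = insert 0 {1..\<beta>}" by auto
    hence "x = y 0 + (\<Sum>t\<in>{1..\<beta>}. y t)" using y(2) by simp
    thus ?thesis using uv by (simp add: algebra_simps)
  qed
  finally have "x = (\<Sum>t\<le>Suc \<beta>. y' t)" by simp
  moreover have "\<forall>t\<le>Suc \<beta>. y' t \<in> Z (Suc \<beta>) t" 
  proof (intro allI impI)
    fix t assume t: "t \<le> Suc \<beta>"
    show "y' t \<in> Z (Suc \<beta>) t"
    proof (cases "t = 0 \<or> t = Suc \<beta>")
      case True
      thus ?thesis using u v by (auto simp: y'_def Z_def)
    next
      case False
      hence "y t \<in> Z \<beta> t" using y(1) t by simp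
      thus ?thesis using False by (simp add: y'_def Z_def)
    qed
  qed
  ultimately show ?case by blast
qed

lemma Z_independent:
  assumes "2 ^ \<beta> dvd n" "\<And>t. t \<le> \<beta> \<Longrightarrow> y t \<in> Z \<beta> t" "(\<Sum>t\<le>\<beta>. y t) = 0" "t \<le> \<beta>"
  shows "y t = 0"
  using assms
proof (induction \<beta> arbitrary: y t)
  case (Suc \<beta>)
  define h where "h = n div 2 ^ Suc \<beta>"
  define y' where "y' t = (if t = 0 then y 0 + y (Suc \<beta>) else y t)" for t
  have y0: "y 0 \<in> P (Suc \<beta>)" and y1: "y (Suc \<beta>) \<in> N (Suc \<beta>)"
    using Suc.prems(2)[of 0] Suc.prems(2)[of "Suc \<beta>"] by (auto simp: Z_def)
  have "y 0 + y (Suc \<beta>) \<in> P \<beta>"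
    using P_Suc_cases(1,2)[OF Suc.prems(1)] y0 y1 by (intro KV.subspace_add[OF subspace_Eig]) auto
  hence "y' t \<in> Z \<beta> t" if "t \<le> \<beta>" for t
    using Suc.prems(2)[of t] that by (auto simp: y'_def Z_def split: if_splits)
  moreover have "(\<Sum>t\<le>\<beta>. y' t) = 0"
  proof -
    have "{..\<beta>} = insert 0 {1..\<beta>}" by auto
    thus ?thesis using Suc.prems(3) by (simp add: y'_def algebra_simps)
  qed
  moreover have "2 ^ \<beta> dvd n" using Suc.prems(1) by (simp add: dvd_mult_right)
  ultimately have y'0: "y' t = 0" if "t \<le> \<beta>" for t using Suc.IH[of y' t] that by blast
  have sum0: "y 0 + y (Suc \<beta>) = 0" using y'0[of 0] by (simp add: y'_def)
  have mem: "y 0 \<in> L" "S h (y 0) = y 0" "y (Suc \<beta>) \<in> L" "S h (y (Suc \<beta>)) = - y (Suc \<beta>)"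
    using y0 y1 by (simp_all only: Eig_def h_def) auto
  have "S h (y 0 + y (Suc \<beta>)) = y 0 - y (Suc \<beta>)" using mem by (simp add: S_add)
  hence "y 0 - y (Suc \<beta>) = 0" by (simp only: sum0 S_0)
  hence "y 0 = y (Suc \<beta>)" by simp
  hence "y 0 = 0" "y (Suc \<beta>) = 0" using sum0 by (simp_all flip: mult_2)
  thus ?case using y'0[of t] Suc.prems(4) by (cases "t = 0"; cases "t = Suc \<beta>") (auto simp: y'_def)
qed simp

lemma Eig_1: "n = 2 * m \<Longrightarrow> Eig \<epsilon> 1 = {x\<in>L. S m x = \<epsilon> * x}"
  unfolding Eig_def by simp

text \<open>
  The forms of the involution depend on \<open>b\<close> only through its component in \<open>N\<^sub>1\<close>: for \<open>b\<close> fixed by \<open>\<sigma>\<^sup>m\<close> the two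
  terms of the skew-form have equal traces.
\<close>

lemma F_half_image:
  assumes n: "n = 2 * m"
  shows "F m ` L = F m ` N 1"
proof (intro equalityI subsetI)
  fix f assume "f \<in> F m ` L"
  then obtain b where b: "b \<in> L" "f = F m b" by blast
  define c where "c = ext_scale (1 / 2) (b - S m b)"
  define e where "e = ext_scale (1 / 2) (b + S m b)"
  have m: "n div 2 ^ Suc 0 = m" using n by simp
  have bP: "b \<in> P 0" using b P_0 by simp
  have dv: "2 ^ Suc 0 dvd n" using n by simp
  have c: "c \<in> N 1"
    using KV.subspace_scale[OF subspace_Eig P_Suc_cases(3)[OF dv bP]] unfolding c_def m by simp
  have e: "e \<in> P 1"
    using KV.subspace_scale[OF subspace_Eig P_Suc_cases(4)[OF dv bP]] unfolding e_def m by simp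
  have bce: "b = c + e"
  proof -
    have "c + e = to_ac (1 / 2) * b + to_ac (1 / 2) * b"
      unfolding c_def e_def ext_scale_def distrib_left right_diff_distrib by (simp only: ab_semigroup_add_class.add_ac) simp
    thus ?thesis by (simp only: halves)
  qed
  have eL: "e \<in> L" "S m e = e" using e unfolding Eig_1[OF n] by auto
  have "F m e = 0"
  proof (rule form_eqI)
    fix x y assume xy: "x \<in> L" "y \<in> L"
    have "n - m = m" using n by simp
    hence "Tr (e * S m x * y) = Tr (e * (x * S m y))"
      using Tr_S_right[of e x y m] eL xy n by (simp add: mult_ac)
    moreover have "to_ac (F m e x y) = Tr (e * (x * S m y)) - Tr (e * S m x * y)"
      using eL xy by (simp add: F_apply Tr_diff[symmetric] algebra_simps)
    ultimately show "to_ac (F m e x y) = (to_ac ((0 :: 'k alg_closure \<Rightarrow> 'k alg_closure \<Rightarrow> 'k) x y) :: 'k alg_closure)"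
      by simp
  qed (simp add: F_outside)
  hence "F m b = F m c" using c eL Eig_L[OF c] by (simp add: bce F_add)
  thus "f \<in> F m ` N 1" using b c by blast
next
  fix f assume "f \<in> F m ` N 1"
  thus "f \<in> F m ` L" using Eig_subset by blast
qed

text \<open>
  The label of the summand that \<open>Z \<beta> t\<close> contributes, where \<open>\<beta>\<close> belongs to the index \<open>i\<close>.
\<close>

definition summand_label :: "nat \<Rightarrow> nat \<Rightarrow> nat \<Rightarrow> summand" where
  "summand_label \<beta> i t = (if \<beta> = 0 then SA i
     else if \<beta> = 1 then (if t = 0 then SV i else SU i)
     else if t = 0 then SV1 i else if t = \<beta> then SV2 i else SE i t)"

definition summand_index :: "nat \<Rightarrow> summand \<Rightarrow> nat" where
  "summand_index m j = (case j of SB \<Rightarrow> m | SU i \<Rightarrow> i | SV i \<Rightarrow> i | SA i \<Rightarrow> i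
     | SV1 i \<Rightarrow> i | SV2 i \<Rightarrow> i | SE i s \<Rightarrow> i)"

lemma summand_index_label [simp]:
  "summand_index m (summand_label \<beta> i t) = i" "summand_index m SB = m"
  by (simp_all add: summand_label_def summand_index_def)

lemma summand_label_inj: "inj_on (summand_label \<beta> i) {..\<beta>}"
  by (auto simp: inj_on_def summand_label_def)

text \<open>
  Grouping the labels by their index \<open>i\<close> reduces the claim to \<open>Alt_decompose\<close> and \<open>F_unique\<close> across the indices, and
  to \<open>Z_span\<close> and \<open>Z_independent\<close> within one index.
\<close>

lemma Alt_decomposition:
  fixes \<beta> :: "nat \<Rightarrow> nat" and W :: "summand \<Rightarrow> ('k alg_closure \<Rightarrow> 'k alg_closure \<Rightarrow> 'k) set"
  assumes n: "n = 2 * m" and \<beta>: "\<And>i. i \<in> {1..<m} \<Longrightarrow> 2 ^ \<beta> i dvd n"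
    and WB: "W SB = F m ` L"
    and W: "\<And>i t. i \<in> {1..<m} \<Longrightarrow> t \<le> \<beta> i \<Longrightarrow> W (summand_label (\<beta> i) i t) = F i ` Z (\<beta> i) t"
    and J: "J = insert SB (\<Union>i\<in>{1..<m}. summand_label (\<beta> i) i ` {..\<beta> i})"
  shows "direct_decomposition (Alt L) J W"
proof -
  define ix where "ix = summand_index m"
  define lab where "lab i = summand_label (\<beta> i) i" for i
  have ix [simp]: "ix (lab i t) = i" "ix SB = m" for i t by (simp_all add: ix_def lab_def)
  have m: "m > 0" using n n_pos by simp
  have finJ: "finite J" by (simp add: J)
  have ixJ: "ix ` J \<subseteq> {1..m}" using m by (auto simp: J lab_def[symmetric])
  have block: "{j\<in>J. ix j = i} = lab i ` {..\<beta> i}" if "i \<in> {1..<m}" for i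
    using that by (auto simp: J lab_def[symmetric])
  have block_m: "{j\<in>J. ix j = m} = {SB}" by (auto simp: J lab_def[symmetric])
  have labinj: "inj_on (lab i) {..\<beta> i}" for i unfolding lab_def by (rule summand_label_inj)
  have Wlab: "W (lab i t) = F i ` Z (\<beta> i) t" if "i \<in> {1..<m}" "t \<le> \<beta> i" for i t
    unfolding lab_def using W that .
  have WN: "W SB = F m ` N 1" using WB F_half_image[OF n] by simp
  have Y: "\<exists>Y. KV.subspace Y \<and> Y \<subseteq> L \<and> W j = F (ix j) ` Y" if j: "j \<in> J" for j
  proof (cases "j = SB")
    case True
    thus ?thesis using WN subspace_Eig Eig_subset by (intro exI[of _ "N 1"]) auto
  next
    case False
    then obtain i t where it: "i \<in> {1..<m}" "t \<le> \<beta> i" "j = lab i t" using j by (auto simp: J lab_def)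
    thus ?thesis using Wlab subspace_Z Z_subset by (intro exI[of _ "Z (\<beta> i) t"]) auto
  qed
  have WA: "W j \<subseteq> Alt L" "FV.subspace (W j)" if "j \<in> J" for j
    using Y[OF that] subspace_F_image by (auto intro!: F_Alt)
  have Alt_sub: "FV.subspace (Alt L :: ('k alg_closure \<Rightarrow> 'k alg_closure \<Rightarrow> 'k) set)"
    by (rule FV.subspaceI) (auto simp: Alt_def form_scale_def algebra_simps)
  have group: "(\<Sum>j\<in>J. F (ix j) (y j)) = (\<Sum>i\<in>{1..m}. F i (\<Sum>j\<in>{j\<in>J. ix j = i}. y j))"
    if "\<And>j. j \<in> J \<Longrightarrow> y j \<in> L" for y
  proof -
    have "(\<Sum>j\<in>J. F (ix j) (y j)) = (\<Sum>i\<in>{1..m}. \<Sum>j\<in>{j\<in>J. ix j = i}. F (ix j) (y j))"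
      by (rule sum.group[symmetric]) (use finJ ixJ in auto)
    also have "\<dots> = (\<Sum>i\<in>{1..m}. F i (\<Sum>j\<in>{j\<in>J. ix j = i}. y j))"
      using that by (intro sum.cong refl) (subst F_sum; simp)
    finally show ?thesis .
  qed
  show ?thesis
  proof (rule direct_decompositionI[OF finJ WA(2)])
    fix w assume "\<And>j. j \<in> J \<Longrightarrow> w j \<in> W j"
    thus "sum w J \<in> Alt L" using WA(1) by (intro FV.subspace_sum[OF Alt_sub]) auto
  next
    fix f :: "'k alg_closure \<Rightarrow> 'k alg_closure \<Rightarrow> 'k" assume "f \<in> Alt L"
    then obtain b where b: "\<And>i. b i \<in> L" "S m (b m) = - b m" "f = (\<Sum>i\<in>{1..m}. F i (b i))"
      using Alt_decompose[OF n] by blast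
    have "\<exists>y. (\<forall>t\<le>\<beta> i. y t \<in> Z (\<beta> i) t) \<and> b i = (\<Sum>t\<le>\<beta> i. y t)" if "i \<in> {1..<m}" for i
      by (rule Z_span[OF \<beta>[OF that] b(1)])
    hence "\<forall>i\<in>{1..<m}. \<exists>y. (\<forall>t\<le>\<beta> i. y t \<in> Z (\<beta> i) t) \<and> b i = (\<Sum>t\<le>\<beta> i. y t)" by (intro ballI)
    from bchoice[OF this] obtain yy
      where "\<forall>i\<in>{1..<m}. (\<forall>t\<le>\<beta> i. yy i t \<in> Z (\<beta> i) t) \<and> b i = (\<Sum>t\<le>\<beta> i. yy i t)"
      by (elim exE)
    hence yy: "\<And>i t. i \<in> {1..<m} \<Longrightarrow> t \<le> \<beta> i \<Longrightarrow> yy i t \<in> Z (\<beta> i) t"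
      "\<And>i. i \<in> {1..<m} \<Longrightarrow> b i = (\<Sum>t\<le>\<beta> i. yy i t)" by simp_all
    define y where "y j = (if j = SB then b m else yy (ix j) (the_inv_into {..\<beta> (ix j)} (lab (ix j)) j))" for j
    have labSB: "lab i t \<noteq> SB" for i t by (simp add: lab_def summand_label_def)
    have ylab: "y (lab i t) = yy i t" if "t \<le> \<beta> i" for i t
      using that labSB by (simp add: y_def the_inv_into_f_f[OF labinj])
    have bN: "b m \<in> N 1" using b unfolding Eig_1[OF n] by simp
    have yW: "F (ix j) (y j) \<in> W j" "y j \<in> L" if j: "j \<in> J" for j
    proof -
      have "F (ix j) (y j) \<in> W j \<and> y j \<in> L"
      proof (cases "j = SB")
        case True
        thus ?thesis using WN bN b(1) by (auto simp: y_def)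
      next
        case False
        then obtain i t where it: "i \<in> {1..<m}" "t \<le> \<beta> i" "j = lab i t" using j by (auto simp: J lab_def)
        have "yy i t \<in> Z (\<beta> i) t" using yy(1) it by simp
        thus ?thesis using it Wlab subsetD[OF Z_subset] by (auto simp: ylab)
      qed
      thus "F (ix j) (y j) \<in> W j" "y j \<in> L" by simp_all
    qed
    have blk: "(\<Sum>j\<in>{j\<in>J. ix j = i}. y j) = b i" if i: "i \<in> {1..m}" for i
    proof (cases "i = m")
      case True
      thus ?thesis by (simp add: block_m y_def)
    next
      case False
      hence i: "i \<in> {1..<m}" using i by auto
      thus ?thesis unfolding block[OF i] sum.reindex[OF labinj] by (simp add: ylab yy(2))
    qed
    have "(\<Sum>j\<in>J. F (ix j) (y j)) = (\<Sum>i\<in>{1..m}. F i (\<Sum>j\<in>{j\<in>J. ix j = i}. y j))"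
      by (rule group) (rule yW(2))
    also have "\<dots> = f" unfolding b(3) by (rule sum.cong[OF refl]) (simp only: blk)
    finally have "f = (\<Sum>j\<in>J. F (ix j) (y j))" ..
    thus "\<exists>w. (\<forall>j\<in>J. w j \<in> W j) \<and> f = sum w J" using yW by (intro exI[of _ "\<lambda>j. F (ix j) (y j)"]) auto
  next
    fix w j0 assume w: "\<And>j. j \<in> J \<Longrightarrow> w j \<in> W j" and 0: "sum w J = 0" and j0: "j0 \<in> J"
    have "\<exists>y. w j = F (ix j) y \<and> (if j = SB then y \<in> N 1 else \<forall>i\<in>{1..<m}. \<forall>t\<le>\<beta> i. j = lab i t \<longrightarrow> y \<in> Z (\<beta> i) t)"
      if j: "j \<in> J" for j
    proof (cases "j = SB")
      case True
      thus ?thesis using w[OF j] WN by auto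
    next
      case False
      then obtain i t where it: "i \<in> {1..<m}" "t \<le> \<beta> i" "j = lab i t" using j by (auto simp: J lab_def)
      then obtain y where y: "y \<in> Z (\<beta> i) t" "w j = F i y" using w[OF j] Wlab by auto
      have uniq: "i' = i \<and> t' = t" if "i' \<in> {1..<m}" "t' \<le> \<beta> i'" "j = lab i' t'" for i' t'
      proof -
        have "i' = i" using it(3) that(3) ix by metis
        thus ?thesis using inj_onD[OF labinj, of i t' t] it that by auto
      qed
      have "\<forall>i'\<in>{1..<m}. \<forall>t'\<le>\<beta> i'. j = lab i' t' \<longrightarrow> y \<in> Z (\<beta> i') t'"
      proof (intro ballI allI impI)
        fix i' t' assume "i' \<in> {1..<m}" "t' \<le> \<beta> i'" "j = lab i' t'"
        from uniq[OF this] y(1) show "y \<in> Z (\<beta> i') t'" by simp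
      qed
      moreover have "w j = F (ix j) y" using y(2) it(3) by simp
      ultimately show ?thesis using False by (intro exI[of _ y]) (simp only: if_False simp_thms)
    qed
    hence "\<forall>j\<in>J. \<exists>y. w j = F (ix j) y \<and>
        (if j = SB then y \<in> N 1 else \<forall>i\<in>{1..<m}. \<forall>t\<le>\<beta> i. j = lab i t \<longrightarrow> y \<in> Z (\<beta> i) t)"
      by (intro ballI)
    from bchoice[OF this] obtain y where y: "\<forall>j\<in>J. w j = F (ix j) (y j) \<and>
        (if j = SB then y j \<in> N 1 else \<forall>i\<in>{1..<m}. \<forall>t\<le>\<beta> i. j = lab i t \<longrightarrow> y j \<in> Z (\<beta> i) t)"
      by (elim exE)
    have SBJ: "SB \<in> J" by (simp add: J)
    have labJ: "lab i t \<in> J" if "i \<in> {1..<m}" "t \<le> \<beta> i" for i t using that by (auto simp: J lab_def)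
    have labSB: "lab i t \<noteq> SB" for i t by (simp add: lab_def summand_label_def)
    have ySB: "y SB \<in> N 1" using bspec[OF y SBJ] by simp
    have ylab: "y (lab i t) \<in> Z (\<beta> i) t" if "i \<in> {1..<m}" "t \<le> \<beta> i" for i t
      using bspec[OF y labJ[OF that]] labSB that by auto
    have yL: "y j \<in> L" if j: "j \<in> J" for j
    proof (cases "j = SB")
      case True
      thus ?thesis using Eig_L[OF ySB] by simp
    next
      case False
      then obtain i t where "i \<in> {1..<m}" "t \<le> \<beta> i" "j = lab i t" using j by (auto simp: J lab_def)
      thus ?thesis using ylab Z_subset by blast
    qed
    define b where "b i = (\<Sum>j\<in>{j\<in>J. ix j = i}. y j)" for i
    have "sum w J = (\<Sum>j\<in>J. F (ix j) (y j))" using y by (intro sum.cong) auto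
    hence F0: "(\<Sum>i\<in>{1..m}. F i (b i)) = 0" using 0 group[of y, OF yL] by (simp add: b_def)
    have bL: "b i \<in> L" for i unfolding b_def using yL by (intro sum_closed) auto
    have bm: "b m = y SB" by (simp add: b_def block_m)
    have "S m (b m) = - b m" using ySB unfolding bm Eig_1[OF n] by simp
    hence b0: "b i = 0" if "i \<in> {1..m}" for i
      using F_unique[OF n _ _ F0 that] bL by blast
    have "y j0 = 0"
    proof (cases "j0 = SB")
      case True
      thus ?thesis using b0[of m] bm m by simp
    next
      case False
      then obtain i t where it: "i \<in> {1..<m}" "t \<le> \<beta> i" "j0 = lab i t" using j0 by (auto simp: J lab_def)
      have "(\<Sum>t\<le>\<beta> i. y (lab i t)) = 0"
        using b0[of i] it(1) unfolding b_def block[OF it(1)] sum.reindex[OF labinj] by simp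
      thus ?thesis unfolding it(3)
        using Z_independent[OF \<beta>[OF it(1)], of "\<lambda>t. y (lab i t)" t] ylab[OF it(1)] it(2) by simp
    qed
    thus "w j0 = 0" using bspec[OF y j0] by simp
  qed
qed

end


section \<open>The decomposition theorem\<close>

theorem corollary4p4:
  fixes n \<alpha> k :: nat
  assumes n: "n = 2 ^ \<alpha> * k" and alpha: "\<alpha> \<ge> 2" and k: "odd k"
    and K: "number_field TYPE('k::field_char_0)"
    and nonsquare: "\<not> (\<exists>x::'k. x\<^sup>2 = - 1)"
  shows "\<exists>(L :: 'k alg_closure set) \<sigma>.
    galois_extension L \<and> ext_degree L = n \<and>
    \<sigma> \<in> carrier (Gal L) \<and> generate (Gal L) {\<sigma>} = carrier (Gal L) \<and>
    (let A = (\<lambda>i. A_space L (\<sigma> [^]\<^bsub>Gal L\<^esub> (i::nat)));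
         d = (\<lambda>i. group.ord (Gal L) (\<sigma> [^]\<^bsub>Gal L\<^esub> (i::nat)));
         \<beta> = (\<lambda>i. multiplicity 2 (d i));
         k' = (\<lambda>i. d i div 2 ^ \<beta> i);
         I = {1..n div 2 - 1};
         I2 = {i\<in>I. d i mod 4 = 2 \<and> d i \<noteq> 2};
         I1 = {i\<in>I. d i mod 2 = 1};
         I0 = {i\<in>I. d i mod 4 = 0}
     in \<exists>U V V1 V2 E.
          direct_decomposition (Alt L)
            ({SB} \<union> (\<Union>i\<in>I2. {SU i, SV i}) \<union> (\<Union>i\<in>I1. {SA i}) \<union>
             (\<Union>i\<in>I0. {SV1 i, SV2 i} \<union> (\<Union>s\<in>{1..\<beta> i - 1}. {SE i s})))
            (\<lambda>j. case j of SB \<Rightarrow> A (n div 2) | SU i \<Rightarrow> U i | SV i \<Rightarrow> V i | SA i \<Rightarrow> A i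
                 | SV1 i \<Rightarrow> V1 i | SV2 i \<Rightarrow> V2 i | SE i s \<Rightarrow> E i s) \<and>
          (\<forall>i\<in>I2.
             U i \<subseteq> A i \<and> rank_subspace L n (U i) \<and> form_dim (U i) = n div 2 \<and>
             V i \<subseteq> A i \<and> rank_subspace L (n - 2 * n div d i) (V i) \<and> form_dim (V i) = n div 2) \<and>
          (\<forall>i\<in>I0.
             (\<forall>s\<in>{1..\<beta> i - 1}.
                E i s \<subseteq> A i \<and> rank_subspace L n (E i s) \<and> form_dim (E i s) = n div 2 ^ s) \<and>
             (\<forall>W\<in>{V1 i, V2 i}.
                W \<subseteq> A i \<and> rank_subspace L (n - 2 * n div d i) W \<and>
                form_dim W = k' i * n div d i)))"
proof -
  have n0: "n > 0" using n k by (auto intro: Nat.gr0I)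
  define m where "m = n div 2"
  have "even n" using n alpha by (cases \<alpha>) auto
  hence nm: "n = 2 * m" by (simp add: m_def)
  obtain L :: "'k alg_closure set" and \<sigma>0 \<theta>
    where C: "cyclic_extension L \<sigma>0 n \<theta>" and no_i: "\<forall>w\<in>L. w\<^sup>2 \<noteq> - 1"
    using cyclic_extension_exists[OF K nonsquare n0] by blast
  interpret C: cyclic_extension L \<sigma>0 n \<theta> by (rule C)
  define \<sigma> where "\<sigma> = C.aut 1"
  define d where "d i = n div gcd i n" for i
  define \<beta> where "\<beta> i = multiplicity 2 (d i)" for i
  define I where "I = {1..<m}"
  have A: "A_space L (\<sigma> [^]\<^bsub>Gal L\<^esub> (i::nat)) = C.F i ` L" for i
    unfolding \<sigma>_def C.aut_pow A_space_def ..
  have ord: "group.ord (Gal L) (\<sigma> [^]\<^bsub>Gal L\<^esub> (i::nat)) = d i" for i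
    unfolding \<sigma>_def C.aut_pow C.ord_aut d_def ..
  have I: "{1..n div 2 - 1} = I" by (auto simp: I_def m_def)
  have d_dvd: "d i dvd n" and d_pos: "d i > 0" for i
  proof -
    show "d i dvd n" unfolding d_def by (metis dvd_div_mult_self dvd_triv_left gcd_dvd2)
    thus "d i > 0" using n0 by (rule dvd_pos_nat[rotated])
  qed
  \<comment> \<open>Only \<open>i = n/2\<close> gives an involution, and it is outside the index range.\<close>
  have d_gt_2: "d i \<noteq> 2" if "i \<in> I" for i
  proof
    assume "d i = 2"
    have "n = d i * gcd i n" unfolding d_def by simp
    hence "gcd i n = m" using nm \<open>d i = 2\<close> by simp
    hence "m dvd i" by (metis gcd_dvd1)
    thus False using that by (auto simp: I_def dest: dvd_imp_le)
  qed
  define k' where "k' i = d i div 2 ^ \<beta> i" for i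
  have d_eq: "d i = 2 ^ \<beta> i * k' i" and k'_odd: "odd (k' i)" for i
  proof -
    show "d i = 2 ^ \<beta> i * k' i" unfolding k'_def \<beta>_def by (simp add: multiplicity_dvd)
    show "odd (k' i)" unfolding k'_def \<beta>_def using d_pos[of i] by (intro multiplicity_decompose) auto
  qed
  have \<beta>_dvd: "2 ^ \<beta> i dvd n" for i using d_dvd[of i] d_eq[of i] by (metis dvd_mult_left)
  have \<beta>_cases: "d i mod 2 = 1 \<longleftrightarrow> \<beta> i = 0" "d i mod 4 = 2 \<longleftrightarrow> \<beta> i = 1" "d i mod 4 = 0 \<longleftrightarrow> \<beta> i \<ge> 2" for i
  proof -
    have "(d i mod 2 = 1 \<longleftrightarrow> \<beta> i = 0) \<and> (d i mod 4 = 2 \<longleftrightarrow> \<beta> i = 1) \<and> (d i mod 4 = 0 \<longleftrightarrow> \<beta> i \<ge> 2)"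
    proof -
      obtain q where q: "k' i = 2 * q + 1" using k'_odd[of i] by (rule oddE)
      consider "\<beta> i = 0" | "\<beta> i = 1" | "\<beta> i \<ge> 2" by linarith
      thus ?thesis
      proof cases
        case 1
        hence "d i = 2 * q + 1" using d_eq[of i] q by simp
        hence "d i mod 2 = 1" "d i mod 4 \<noteq> 2" "d i mod 4 \<noteq> 0" by presburger+
        thus ?thesis using 1 by simp
      next
        case 2
        hence "d i = 4 * q + 2" using d_eq[of i] q by simp
        hence "d i mod 2 = 0" "d i mod 4 = 2" by presburger+
        thus ?thesis using 2 by simp
      next
        case 3
        define b where "b = \<beta> i - 2"
        have "\<beta> i = Suc (Suc b)" using 3 by (simp add: b_def)
        hence "d i = 4 * (2 ^ b * k' i)" using d_eq[of i] by simp
        hence "d i mod 2 = 0" "d i mod 4 = 0" by presburger+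
        thus ?thesis using 3 by simp
      qed
    qed
    thus "d i mod 2 = 1 \<longleftrightarrow> \<beta> i = 0" "d i mod 4 = 2 \<longleftrightarrow> \<beta> i = 1" "d i mod 4 = 0 \<longleftrightarrow> \<beta> i \<ge> 2"
      by simp_all
  qed
  define I2 where "I2 = {i\<in>I. d i mod 4 = 2 \<and> d i \<noteq> 2}"
  define I1 where "I1 = {i\<in>I. d i mod 2 = 1}"
  define I0 where "I0 = {i\<in>I. d i mod 4 = 0}"
  have I2: "I2 = {i\<in>I. \<beta> i = 1}" and I1: "I1 = {i\<in>I. \<beta> i = 0}" and I0: "I0 = {i\<in>I. \<beta> i \<ge> 2}"
    using d_gt_2 \<beta>_cases by (auto simp: I2_def I1_def I0_def)
  define U where "U i = C.F i ` C.N 1" for i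
  define V where "V i = C.F i ` C.P 1" for i
  define V1 where "V1 i = C.F i ` C.P (\<beta> i)" for i
  define V2 where "V2 i = C.F i ` C.N (\<beta> i)" for i
  define E where "E i s = C.F i ` C.N s" for i s
  define W where "W j = (case j of SB \<Rightarrow> C.F m ` L | SU i \<Rightarrow> U i | SV i \<Rightarrow> V i | SA i \<Rightarrow> C.F i ` L
      | SV1 i \<Rightarrow> V1 i | SV2 i \<Rightarrow> V2 i | SE i s \<Rightarrow> E i s)" for j
  define J where "J = {SB} \<union> (\<Union>i\<in>I2. {SU i, SV i}) \<union> (\<Union>i\<in>I1. {SA i}) \<union>
    (\<Union>i\<in>I0. {SV1 i, SV2 i} \<union> (\<Union>s\<in>{1..\<beta> i - 1}. {SE i s}))"
  have sub: "C.F i ` C.Eig \<epsilon> s \<subseteq> C.F i ` L" for i \<epsilon> s using C.Eig_subset by (intro image_mono)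
  have lab: "C.summand_label (\<beta> i) i ` {..\<beta> i} = (if \<beta> i = 0 then {SA i} else if \<beta> i = 1 then {SU i, SV i}
      else {SV1 i, SV2 i} \<union> (\<Union>s\<in>{1..\<beta> i - 1}. {SE i s}))" for i
  proof -
    consider "\<beta> i = 0" | "\<beta> i = 1" | "\<beta> i \<ge> 2" by linarith
    thus ?thesis
    proof cases
      case 1
      thus ?thesis by (simp add: C.summand_label_def)
    next
      case 2
      have "{..1::nat} = {0, 1}" by auto
      thus ?thesis using 2 by (auto simp: C.summand_label_def)
    next
      case 3
      hence "{..\<beta> i} = {0, \<beta> i} \<union> {1..\<beta> i - 1}" by auto
      thus ?thesis using 3 by (auto simp: C.summand_label_def image_Un)
    qed
  qed
  have decomp: "direct_decomposition (Alt L) J W"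
  proof (rule C.Alt_decomposition[OF nm, of \<beta>])
    show "2 ^ \<beta> i dvd n" for i by (rule \<beta>_dvd)
    show "W SB = C.F m ` L" by (simp add: W_def)
    show "W (C.summand_label (\<beta> i) i t) = C.F i ` C.Z (\<beta> i) t" if tl: "t \<le> \<beta> i" for i t
    proof -
      consider "\<beta> i = 0" | "\<beta> i = 1" "t = 0" | "\<beta> i = 1" "t = 1" | "\<beta> i \<ge> 2" using tl by linarith
      thus ?thesis
        using tl C.P_0
        by cases (auto simp: W_def C.summand_label_def C.Z_def U_def V_def V1_def V2_def E_def)
    qed
    show "J = insert SB (\<Union>i\<in>{1..<m}. C.summand_label (\<beta> i) i ` {..\<beta> i})"
      unfolding lab J_def I2 I1 I0 I_def[symmetric] by auto
  qed
  have rk: "n - 2 * n div d i = n - 2 * n div (2 ^ \<beta> i * k' i)" for i by (simp only: d_eq[symmetric])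
  have ordi: "n div gcd i n = 2 ^ \<beta> i * k' i" for i by (simp only: d_eq[symmetric] d_def)
  have part2: "U i \<subseteq> C.F i ` L \<and> rank_subspace L n (U i) \<and> form_dim (U i) = n div 2 \<and>
      V i \<subseteq> C.F i ` L \<and> rank_subspace L (n - 2 * n div d i) (V i) \<and> form_dim (V i) = n div 2"
    if i: "i \<in> I2" for i
  proof -
    have b1: "\<beta> i = 1" and iI: "i \<in> I" using i by (simp_all add: I2)
    have im: "0 < i" "i < m" using iI by (auto simp: I_def)
    have dv: "2 ^ 1 dvd n" using nm by simp
    have "rank_subspace L n (U i)" unfolding U_def
      by (rule C.rank_F_N_1[OF _ k'_odd[of i]]) (use ordi[of i] b1 in simp)
    moreover have "rank_subspace L (n - 2 * n div d i) (V i)"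
      unfolding V_def rk using C.rank_F_degenerate[OF ordi k'_odd, of i "C.P 1"] b1 by simp
    moreover have "form_dim (U i) = n div 2" "form_dim (V i) = n div 2"
      unfolding U_def V_def C.form_dim_F_image[OF nm im C.subspace_Eig C.Eig_subset]
      using C.dim_N[OF dv] C.dim_P[OF dv] by simp_all
    ultimately show ?thesis using sub unfolding U_def V_def by blast
  qed
  have part0: "(\<forall>s\<in>{1..\<beta> i - 1}. E i s \<subseteq> C.F i ` L \<and> rank_subspace L n (E i s) \<and> form_dim (E i s) = n div 2 ^ s) \<and>
      (\<forall>W\<in>{V1 i, V2 i}. W \<subseteq> C.F i ` L \<and> rank_subspace L (n - 2 * n div d i) W \<and> form_dim W = k' i * n div d i)"
    if i: "i \<in> I0" for i
  proof -
    have b2: "\<beta> i \<ge> 2" and iI: "i \<in> I" using i by (simp_all add: I0)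
    have im: "0 < i" "i < m" using iI by (auto simp: I_def)
    have E: "E i s \<subseteq> C.F i ` L \<and> rank_subspace L n (E i s) \<and> form_dim (E i s) = n div 2 ^ s"
      if s: "s \<in> {1..\<beta> i - 1}" for s
    proof -
      have s': "0 < s" "s < \<beta> i" using s b2 by auto
      have "2 ^ s dvd n" using s' \<beta>_dvd[of i] by (meson dvd_trans le_imp_power_dvd less_imp_le)
      hence "form_dim (E i s) = n div 2 ^ s"
        unfolding E_def C.form_dim_F_image[OF nm im C.subspace_Eig C.Eig_subset]
        using s' by (intro C.dim_N)
      moreover have "rank_subspace L n (E i s)"
        unfolding E_def using no_i by (intro C.rank_F_N[OF ordi k'_odd s']) blast
      ultimately show ?thesis using sub unfolding E_def by blast
    qed
    have V: "W \<subseteq> C.F i ` L \<and> rank_subspace L (n - 2 * n div d i) W \<and> form_dim W = k' i * n div d i"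
      if W: "W \<in> {V1 i, V2 i}" for W
    proof -
      obtain Y where Y: "W = C.F i ` Y" "Y = C.P (\<beta> i) \<or> Y = C.N (\<beta> i)"
        using W by (auto simp: V1_def V2_def)
      have YE: "KV.subspace Y" "Y \<subseteq> L" "KV.dim Y = n div 2 ^ \<beta> i"
      proof -
        show "KV.subspace Y" using Y(2) C.subspace_Eig by auto
        show "Y \<subseteq> L" using Y(2) C.Eig_subset by metis
        show "KV.dim Y = n div 2 ^ \<beta> i"
          using Y(2) C.dim_P[OF \<beta>_dvd[of i]] C.dim_N[OF \<beta>_dvd[of i]] b2 by auto
      qed
      have "k' i * n div d i = n div 2 ^ \<beta> i"
        using k'_odd[of i] by (simp add: d_eq[of i] mult.commute[of "k' i"] odd_pos)
      hence "form_dim W = k' i * n div d i"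
        unfolding Y(1) C.form_dim_F_image[OF nm im YE(1,2)] YE(3) ..
      moreover have "rank_subspace L (n - 2 * n div d i) W"
        unfolding Y(1) rk by (rule C.rank_F_degenerate[OF ordi k'_odd]) (use b2 Y(2) in auto)
      moreover have "W \<subseteq> C.F i ` L" unfolding Y(1) using YE(2) by (rule image_mono)
      ultimately show ?thesis by (intro conjI)
    qed
    show ?thesis
    proof (rule conjI; rule ballI)
      fix s assume "s \<in> {1..\<beta> i - 1}"
      thus "E i s \<subseteq> C.F i ` L \<and> rank_subspace L n (E i s) \<and> form_dim (E i s) = n div 2 ^ s" by (rule E)
    next
      fix W assume "W \<in> {V1 i, V2 i}"
      thus "W \<subseteq> C.F i ` L \<and> rank_subspace L (n - 2 * n div d i) W \<and> form_dim W = k' i * n div d i" by (rule V)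
    qed
  qed
  have galois: "galois_extension L \<and> ext_degree L = n \<and>
      \<sigma> \<in> carrier (Gal L) \<and> generate (Gal L) {\<sigma>} = carrier (Gal L)"
    unfolding \<sigma>_def using C.galois_extension_L C.ext_degree_L C.generate_aut by simp
  have W_eq: "W = (\<lambda>j. case j of SB \<Rightarrow> C.F m ` L | SU i \<Rightarrow> U i | SV i \<Rightarrow> V i | SA i \<Rightarrow> C.F i ` L
      | SV1 i \<Rightarrow> V1 i | SV2 i \<Rightarrow> V2 i | SE i s \<Rightarrow> E i s)"
    by (rule ext) (simp only: W_def)
  show ?thesis
    unfolding Let_def
  proof (intro exI[of _ L] exI[of _ \<sigma>], unfold A ord I, fold \<beta>_def, fold k'_def I2_def I1_def I0_def m_def)
    show "galois_extension L \<and> ext_degree L = n \<and> \<sigma> \<in> carrier (Gal L) \<and>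
      generate (Gal L) {\<sigma>} = carrier (Gal L) \<and>
      (\<exists>U V V1 V2 E.
        direct_decomposition (Alt L)
          ({SB} \<union> (\<Union>i\<in>I2. {SU i, SV i}) \<union> (\<Union>i\<in>I1. {SA i}) \<union>
           (\<Union>i\<in>I0. {SV1 i, SV2 i} \<union> (\<Union>s\<in>{1..\<beta> i - 1}. {SE i s})))
          (\<lambda>j. case j of SB \<Rightarrow> C.F m ` L | SU i \<Rightarrow> U i | SV i \<Rightarrow> V i | SA i \<Rightarrow> C.F i ` L
            | SV1 i \<Rightarrow> V1 i | SV2 i \<Rightarrow> V2 i | SE i s \<Rightarrow> E i s) \<and>
        (\<forall>i\<in>I2. U i \<subseteq> C.F i ` L \<and> rank_subspace L n (U i) \<and> form_dim (U i) = m \<and>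
          V i \<subseteq> C.F i ` L \<and> rank_subspace L (n - 2 * n div d i) (V i) \<and> form_dim (V i) = m) \<and>
        (\<forall>i\<in>I0.
          (\<forall>s\<in>{1..\<beta> i - 1}. E i s \<subseteq> C.F i ` L \<and> rank_subspace L n (E i s) \<and>
             form_dim (E i s) = n div 2 ^ s) \<and>
          (\<forall>W\<in>{V1 i, V2 i}. W \<subseteq> C.F i ` L \<and> rank_subspace L (n - 2 * n div d i) W \<and>
             form_dim W = k' i * n div d i)))"
      using galois decomp part2 part0 unfolding J_def W_eq m_def[symmetric]
      by (intro conjI exI[of _ U] exI[of _ V] exI[of _ V1] exI[of _ V2] exI[of _ E] ballI) blast+
  qed
qed

end
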